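(* Let $T_0[1,n_0]$ and $T_1[1,n_1]$ be strings over a finite alphabet $\Sigma$ as described in the context, with Burrows–Wheeler transforms $\mathrm{BWT}_0,\mathrm{BWT}_1$ and LCP arrays $\mathrm{LCP}_0,\mathrm{LCP}_1$. Given $\mathrm{BWT}_0,\mathrm{LCP}_0,\mathrm{BWT}_1,\mathrm{LCP}_1$ (and not the strings themselves), the Gap algorithm computes the multi-string BWT $\mathrm{BWT}_{01}$ and the array $\mathrm{LCP}_{01}$ in time $O\big(\log(|\Sigma|)\,(n_0+n_1)\,\mathrm{avelcp}_{01}\big)$, where $\mathrm{avelcp}_{01}=\big(\sum_{i=2}^{n_0+n_1}\mathrm{LCP}_{01}[i]\big)/(n_0+n_1)$ is the average LCP of the string $T_0T_1$.
   Context: Strings: $T_0[1,n_0]$, $T_1[1,n_1]$ over a finite ordered alphabet $\Sigma$, with $T_0[n_0]=\$_0$, $T_1[n_1]=\$_1$, where $\$_0<\$_1$ are symbols occurring nowhere else and smaller than every other symbol. $T[i,j]$ denotes $T[i]\cdots T[j]$ (equal to $T[i,n]$ if $j\ge n$, empty if $i>j$); lexicographic order has a proper prefix smaller than the longer string; $\mathrm{LCP}(S,S')$ is the length of the longest common prefix. For a string $T[1,n]$, its suffix array $\mathrm{SA}$ is the permutation of $[1,n]$ sorting suffixes lexicographically; its LCP array $\mathrm{LCP}[1,n+1]$ has $\mathrm{LCP}[i]=\mathrm{LCP}(T[\mathrm{SA}[i-1],n],T[\mathrm{SA}[i],n])$ for $2\le i\le n$ and $\mathrm{LCP}[1]=\mathrm{LCP}[n+1]=-1$;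 its BWT is $\mathrm{BWT}[i]=T[\mathrm{SA}[i]-1]$ if $\mathrm{SA}[i]>1$ and $T[n]$ if $\mathrm{SA}[i]=1$. $\mathrm{SA}_\delta,\mathrm{LCP}_\delta,\mathrm{BWT}_\delta$ ($\delta=0,1$) are these for $T_\delta$. The context of $\mathrm{BWT}_\delta[i]$ is $T_\delta[\mathrm{SA}_\delta[i],n_\delta]$. $\mathrm{SA}_{01}$ is the suffix array of the concatenation $T_0T_1$ and $\mathrm{LCP}_{01}[1,n_0+n_1+1]$ its LCP array (with $\mathrm{LCP}_{01}[1]=\mathrm{LCP}_{01}[n_0+n_1+1]=-1$). The multi-string BWT is $\mathrm{BWT}_{01}[i]=T_0[n_0]$ if $\mathrm{SA}_{01}[i]=1$; $T_0[\mathrm{SA}_{01}[i]-1]$ if $1<\mathrm{SA}_{01}[i]\le n_0$; $T_1[n_1]$ if $\mathrm{SA}_{01}[i]=n_0+1$; $T_1[\mathrm{SA}_{01}[i]-n_0-1]$ if $\mathrm{SA}_{01}[i]>n_0+1$; equivalently it merges $\mathrm{BWT}_0$ and $\mathrm{BWT}_1$ ordering all symbols by the lexicographic order of their contexts. Phases: $Z^{(0)}=0^{n_0}1^{n_1}$ and an integer array $B[1,n_0+n_1+1]$ is initialized to $B[1]=B[n_0+n_1+1]=1$, all other entries $0$. Phase $h\ge1$ computes a bit vector $Z^{(h)}$ from $Z^{(h-1)}$ and updates $B$: set $F[c]=1+$(number of occurrences of symbols smaller than $c$ in $\mathrm{BWT}_0$ and $\mathrm{BWT}_1$), $\mathrm{Bid}[c]=-1$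 for all $c$, $k_0=k_1=1$; for $k=1,\dots,n_0+n_1$: if $B[k]\ne0$ and $B[k]\ne h$ set $id\gets k$; let $b=Z^{(h-1)}[k]$, $c=\mathrm{BWT}_b[k_b]$ and increment $k_b$; $j\gets F[c]$, increment $F[c]$; set $Z^{(h)}[j]\gets b$; if $\mathrm{Bid}[c]\ne id$ then set $\mathrm{Bid}[c]\gets id$ and, if $B[j]=0$, set $B[j]\gets h$. The $i$-th $0$ of $Z^{(h)}$ is identified with $\mathrm{BWT}_0[i]$ and the $j$-th $1$ with $\mathrm{BWT}_1[j]$. At the end of a phase, a block is an interval $[\ell,m]$ with $B[\ell]\ne0$, $B[m+1]\ne0$, $B[\ell+1]=\dots=B[m]=0$; it is monochrome if $Z^{(h)}[\ell,m]$ contains only $0$'s or only $1$'s. Gap algorithm: it executes these phases, but after a block has been processed in a phase and is monochrome it is marked irrelevant; in later phases irrelevant blocks are not processed but skipped (storing for each irrelevant block only its numbers $(r_0,r_1)$ of $0$'s and $1$'s to advance $k_0,k_1$, and updating each $F[c]$ lazily at the first occurrence of $c$ in an active block via rank queries on wavelet trees of $\mathrm{BWT}_0,\mathrm{BWT}_1$), and adjacent irrelevant blocks are merged. It stops when no active (non-irrelevant) block remains, and then outputs $\mathrm{BWT}_{01}$ by merging $\mathrm{BWT}_0,\mathrm{BWT}_1$ according to the final bit vector, and $\mathrm{LCP}_{01}[i]=B[i]-1$ where $B[i]\ne0$, and otherwise the corresponding value from $\mathrm{LCP}_0$ or $\mathrm{LCP}_1$. *)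

theory Defs
  imports
    Complex_Main
    "HOL-Library.List_Lexorder"
    "HOL-Library.Monad_Syntax"
    "HOL-Library.Sublist"
    "HOL-Library.While_Combinator"
begin

section \<open>Strings, suffix arrays, LCP arrays, Burrows-Wheeler transforms\<close>

text \<open>Strings and input/output arrays are lists whose positions are counted from 1.\<close>

definition nth1 :: "'a list \<Rightarrow> nat \<Rightarrow> 'a" (infixl "!!" 100) where
  "xs !! i = xs ! (i - 1)"

definition suf :: "'a list \<Rightarrow> nat \<Rightarrow> 'a list" where
  "suf T i = drop (i - 1) T"

definition lcp :: "'a list \<Rightarrow> 'a list \<Rightarrow> nat" where
  "lcp S S' = length (longest_common_prefix S S')"

text \<open>The order on lists is the one of \<open>List_Lexorder\<close>: lexicographic, with a proper
  prefix smaller than the longer string.\<close>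

definition suffix_array :: "'a::linorder list \<Rightarrow> nat list" where
  "suffix_array T = sort_key (suf T) [1..<Suc (length T)]"

definition lcp_array :: "'a::linorder list \<Rightarrow> int list" where
  "lcp_array T = map
     (\<lambda>i. if 2 \<le> i \<and> i \<le> length T
          then int (lcp (suf T (suffix_array T !! (i - 1))) (suf T (suffix_array T !! i)))
          else -1)
     [1..<length T + 2]"

definition bwt :: "'a::linorder list \<Rightarrow> 'a list" where
  "bwt T = map (\<lambda>p. if p > 1 then T !! (p - 1) else T !! length T) (suffix_array T)"

definition multi_bwt :: "'a::linorder list \<Rightarrow> 'a list \<Rightarrow> 'a list" where
  "multi_bwt T0 T1 = map
     (\<lambda>p. if p = 1 then T0 !! length T0
          else if p \<le> length T0 then T0 !! (p - 1)
          else if p = length T0 + 1 then T1 !! length T1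
          else T1 !! (p - length T0 - 1))
     (suffix_array (T0 @ T1))"

definition avelcp :: "'a::linorder list \<Rightarrow> 'a list \<Rightarrow> real" where
  "avelcp T0 T1 =
     (\<Sum>i = 2..length T0 + length T1. real_of_int (lcp_array (T0 @ T1) !! i))
       / real (length T0 + length T1)"

definition terminated_pair ::
  "'a::linorder set \<Rightarrow> 'a \<Rightarrow> 'a \<Rightarrow> 'a list \<Rightarrow> 'a list \<Rightarrow> bool" where
  "terminated_pair \<Sigma> d0 d1 T0 T1 \<longleftrightarrow>
     T0 \<noteq> [] \<and> T1 \<noteq> [] \<and> set T0 \<subseteq> \<Sigma> \<and> set T1 \<subseteq> \<Sigma> \<and>
     last T0 = d0 \<and> d0 \<notin> set (butlast T0) \<and> d0 \<notin> set T1 \<and>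
     last T1 = d1 \<and> d1 \<notin> set (butlast T1) \<and> d1 \<notin> set T0 \<and>
     d0 < d1 \<and> (\<forall>c \<in> \<Sigma> - {d0, d1}. d1 < c)"


section \<open>Programs with a running time\<close>

text \<open>A program maps a store to a result, a new store and the time spent. The model is the
  unit-cost RAM up to constant factors: each access to an array or to a mutable variable costs 1,
  as does each loop iteration, each step along a list and each visited wavelet tree node. The
  mutable arrays live in the store and are reachable only through \<open>rd\<close> and \<open>wr\<close>, so they
  are used in a single-threaded way and cannot be copied for free. Arrays may be indexed by
  symbols (think of the ranks of the symbols in the alphabet).\<close>

type_synonym ('s, 'r) prog = "'s \<Rightarrow> 'r \<times> 's \<times> nat"

definition return :: "'r \<Rightarrow> ('s, 'r) prog" where
  "return x = (\<lambda>s. (x, s, 0))"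

definition prog_bind :: "('s, 'r) prog \<Rightarrow> ('r \<Rightarrow> ('s, 'q) prog) \<Rightarrow> ('s, 'q) prog" where
  "prog_bind m f = (\<lambda>s. let (x, s1, t1) = m s; (y, s2, t2) = f x s1 in (y, s2, t1 + t2))"

adhoc_overloading Monad_Syntax.bind \<rightleftharpoons> prog_bind

definition tick :: "nat \<Rightarrow> ('s, unit) prog" where
  "tick t = (\<lambda>s. ((), s, t))"

definition rd :: "('s \<Rightarrow> 'i \<Rightarrow> 'v) \<Rightarrow> 'i \<Rightarrow> ('s, 'v) prog" where
  "rd sel i = (\<lambda>s. (sel s i, s, 1))"

definition wr :: "((('i \<Rightarrow> 'v) \<Rightarrow> ('i \<Rightarrow> 'v)) \<Rightarrow> 's \<Rightarrow> 's) \<Rightarrow> 'i \<Rightarrow> 'v \<Rightarrow> ('s, unit) prog" where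
  "wr upd i v = (\<lambda>s. ((), upd (\<lambda>a. a(i := v)) s, 1))"

definition rd_input :: "'a list \<Rightarrow> nat \<Rightarrow> ('s, 'a) prog" where
  "rd_input xs i = (\<lambda>s. (xs !! i, s, 1))"

primrec foreach :: "'i list \<Rightarrow> ('i \<Rightarrow> ('s, unit) prog) \<Rightarrow> ('s, unit) prog" where
  "foreach [] f = return ()"
| "foreach (i # is) f = do { tick 1; f i; foreach is f }"


section \<open>Wavelet trees\<close>

text \<open>The alphabet is halved at each level. \<open>Node p ns l r\<close> represents a sequence: \<open>l\<close> represents
  its subsequence of symbols smaller than \<open>p\<close>, \<open>r\<close> that of the other symbols, and \<open>ns ! i\<close> is the
  number of symbols smaller than \<open>p\<close> among the first \<open>i\<close>.\<close>

datatype 'a wavelet_tree = Leaf | Node 'a "nat list" "'a wavelet_tree" "'a wavelet_tree"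

primrec prefix_counts :: "'a::linorder \<Rightarrow> nat \<Rightarrow> 'a list \<Rightarrow> nat list" where
  "prefix_counts p n [] = [n]"
| "prefix_counts p n (x # xs) = n # prefix_counts p (if x < p then n + 1 else n) xs"

fun build_wt :: "'a::linorder list \<Rightarrow> 'a list \<Rightarrow> ('s, 'a wavelet_tree) prog" where
  "build_wt syms xs =
     (if length syms \<le> 1 then do { tick 1; return Leaf }
      else let m = length syms div 2; p = syms ! m in
        do {
          tick (1 + length syms + length xs);
          l \<leftarrow> build_wt (take m syms) (filter (\<lambda>x. x < p) xs);
          r \<leftarrow> build_wt (drop m syms) (filter (\<lambda>x. p \<le> x) xs);
          return (Node p (prefix_counts p 0 xs) l r)
        })"

declare build_wt.simps [simp del]

text \<open>\<open>wt_rank w c i\<close> is the number of occurrences of \<open>c\<close> among the first \<open>i\<close> symbols of the sequence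
  that \<open>w\<close> represents.\<close>

primrec wt_rank :: "'a::linorder wavelet_tree \<Rightarrow> 'a \<Rightarrow> nat \<Rightarrow> ('s, nat) prog" where
  "wt_rank Leaf c i = do { tick 1; return i }"
| "wt_rank (Node p ns l r) c i =
     do { tick 1; if c < p then wt_rank l c (ns ! i) else wt_rank r c (i - ns ! i) }"


section \<open>The Gap algorithm\<close>

text \<open>The bits 0 and 1 are \<open>False\<close> and \<open>True\<close>; a family indexed by \<open>bool\<close> collects the objects
  belonging to the two strings. In phase \<open>h\<close>, \<open>arr_Z\<close> holds \<open>Z\<close> of phase \<open>h - 1\<close> and \<open>arr_Z'\<close>
  receives \<open>Z\<close> of phase \<open>h\<close>. \<open>arr_K\<close> holds the pointers \<open>k\<^sub>0\<close> and \<open>k\<^sub>1\<close>; \<open>arr_N\<close> counts the zeros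
  and the ones in the current block; \<open>arr_C c\<close> is 1 plus the number of symbols smaller than
  \<open>c\<close> in the two input BWTs.\<close>

record 'a store =
  arr_Z :: "nat \<Rightarrow> bool"
  arr_Z' :: "nat \<Rightarrow> bool"
  arr_B :: "nat \<Rightarrow> nat"
  arr_C :: "'a \<Rightarrow> nat"
  arr_F :: "'a \<Rightarrow> nat"
  arr_Bid :: "'a \<Rightarrow> int"
  arr_K :: "bool \<Rightarrow> nat"
  arr_N :: "bool \<Rightarrow> nat"

text \<open>The positions \<open>1, \<dots>, n\<^sub>0 + n\<^sub>1\<close> are covered, from left to right, by a list of segments:
  \<open>Active d\<close> is an active block of length \<open>d\<close>, which the previous phase may have split further, and
  \<open>Irrelevant r\<^sub>0 r\<^sub>1\<close> is a maximal run of irrelevant blocks with \<open>r\<^sub>0\<close> zeros and \<open>r\<^sub>1\<close> ones.\<close>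

datatype segment = Active nat | Irrelevant nat nat

primrec is_active :: "segment \<Rightarrow> bool" where
  "is_active (Active d) = True"
| "is_active (Irrelevant r0 r1) = False"

text \<open>The segments produced by a phase are accumulated in reverse order.\<close>

fun add_irrelevant :: "nat \<Rightarrow> nat \<Rightarrow> segment list \<Rightarrow> segment list" where
  "add_irrelevant r0 r1 (Irrelevant s0 s1 # acc) = Irrelevant (s0 + r0) (s1 + r1) # acc"
| "add_irrelevant r0 r1 acc = Irrelevant r0 r1 # acc"

text \<open>The loop body of phase \<open>h\<close> at position \<open>k\<close>, in the block starting at position \<open>l\<close>. As blocks
  may have been skipped, \<open>F[c]\<close> is brought up to date when \<open>c\<close> occurs for the first time in
  the block.\<close>

definition entry ::
  "(bool \<Rightarrow> 'a::linorder list) \<Rightarrow> (bool \<Rightarrow> 'a wavelet_tree) \<Rightarrow> nat \<Rightarrow> nat \<Rightarrow> nat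
     \<Rightarrow> ('a store, unit) prog" where
  "entry bw w h l k = do {
     k0 \<leftarrow> rd arr_K False;
     k1 \<leftarrow> rd arr_K True;
     b \<leftarrow> rd arr_Z k;
     n \<leftarrow> rd arr_N b;
     wr arr_N_update b (n + 1);
     c \<leftarrow> rd_input (bw b) (if b then k1 else k0);
     i \<leftarrow> rd arr_Bid c;
     (if i \<noteq> int l then do {
        x \<leftarrow> rd arr_C c;
        r0 \<leftarrow> wt_rank (w False) c (k0 - 1);
        r1 \<leftarrow> wt_rank (w True) c (k1 - 1);
        wr arr_F_update c (x + r0 + r1)
      } else return ());
     wr arr_K_update b ((if b then k1 else k0) + 1);
     j \<leftarrow> rd arr_F c;
     wr arr_F_update c (j + 1);
     wr arr_Z'_update j b;
     (if i \<noteq> int l then do {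
        wr arr_Bid_update c (int l);
        v \<leftarrow> rd arr_B j;
        (if v = 0 then wr arr_B_update j h else return ())
      } else return ())
   }"

text \<open>Completion of the block \<open>[l, k - 1]\<close>. Since the two bit arrays exchange their roles after
  each phase, the bits of a block that will not be looked at any more are
  recorded in both of them.\<close>

definition close_block :: "nat \<Rightarrow> nat \<Rightarrow> segment list \<Rightarrow> ('a store, segment list) prog" where
  "close_block l k acc = do {
     r0 \<leftarrow> rd arr_N False;
     r1 \<leftarrow> rd arr_N True;
     wr arr_N_update False 0;
     wr arr_N_update True 0;
     (if r0 = 0 \<or> r1 = 0 then do {
        foreach [l..<k] (\<lambda>i. do { b \<leftarrow> rd arr_Z i; wr arr_Z'_update i b });
        return (add_irrelevant r0 r1 acc)
      } else return (Active (r0 + r1) # acc))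
   }"

text \<open>Phase \<open>h\<close> on an active segment: \<open>d\<close> positions starting at \<open>k\<close> remain, and the current block
  starts at position \<open>l\<close>.\<close>

primrec entries ::
  "(bool \<Rightarrow> 'a::linorder list) \<Rightarrow> (bool \<Rightarrow> 'a wavelet_tree) \<Rightarrow> nat \<Rightarrow> nat \<Rightarrow> nat \<Rightarrow> nat
     \<Rightarrow> segment list \<Rightarrow> ('a store, segment list) prog" where
  "entries bw w h 0 l k acc = close_block l k acc"
| "entries bw w h (Suc d) l k acc = do {
     tick 1;
     v \<leftarrow> rd arr_B k;
     if l < k \<and> v \<noteq> 0 \<and> v \<noteq> h then do {
       acc' \<leftarrow> close_block l k acc;
       entry bw w h k k;
       entries bw w h d k (k + 1) acc'
     } else do {
       entry bw w h l k;
       entries bw w h d l (k + 1) acc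
     }
   }"

fun segments ::
  "(bool \<Rightarrow> 'a::linorder list) \<Rightarrow> (bool \<Rightarrow> 'a wavelet_tree) \<Rightarrow> nat \<Rightarrow> nat \<Rightarrow> segment list
     \<Rightarrow> segment list \<Rightarrow> ('a store, segment list) prog" where
  "segments bw w h k [] acc = do { tick (1 + length acc); return (rev acc) }"
| "segments bw w h k (Irrelevant r0 r1 # ss) acc = do {
     tick 1;
     k0 \<leftarrow> rd arr_K False;
     k1 \<leftarrow> rd arr_K True;
     wr arr_K_update False (k0 + r0);
     wr arr_K_update True (k1 + r1);
     segments bw w h (k + r0 + r1) ss (add_irrelevant r0 r1 acc)
   }"
| "segments bw w h k (Active d # ss) acc = do {
     tick 1;
     acc' \<leftarrow> entries bw w h d k k acc;
     segments bw w h (k + d) ss acc'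
   }"

definition swap_Z :: "('a store, unit) prog" where
  "swap_Z = (\<lambda>s. ((), s\<lparr>arr_Z := arr_Z' s, arr_Z' := arr_Z s\<rparr>, 1))"

definition phase ::
  "'a::linorder list \<Rightarrow> (bool \<Rightarrow> 'a list) \<Rightarrow> (bool \<Rightarrow> 'a wavelet_tree) \<Rightarrow> nat \<Rightarrow> segment list
     \<Rightarrow> ('a store, segment list) prog" where
  "phase syms bw w h ss = do {
     foreach syms (\<lambda>c. do { x \<leftarrow> rd arr_C c; wr arr_F_update c x; wr arr_Bid_update c (-1) });
     wr arr_K_update False 1;
     wr arr_K_update True 1;
     ss' \<leftarrow> segments bw w h 1 ss [];
     swap_Z;
     return ss'
   }"

text \<open>The phases \<open>h = 1, 2, \<dots>\<close>, as long as there are active blocks; the result is \<open>None\<close> if this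
  never stops. Testing whether there is one costs the length of the list of segments.\<close>

definition phases ::
  "'a::linorder list \<Rightarrow> (bool \<Rightarrow> 'a list) \<Rightarrow> (bool \<Rightarrow> 'a wavelet_tree) \<Rightarrow> segment list
     \<Rightarrow> 'a store \<Rightarrow> ('a store \<times> nat) option" where
  "phases syms bw w ss s =
     map_option (\<lambda>(h, ss, s, t). (s, t + 1 + length ss))
       (while_option
         (\<lambda>(h, ss, s, t). list_ex is_active ss)
         (\<lambda>(h, ss, s, t). let (ss', s', t') = phase syms bw w h ss s
            in (h + 1, ss', s', t + 1 + length ss + t'))
         (1, ss, s, 0))"

primrec cumulate :: "'a list \<Rightarrow> nat \<Rightarrow> ('a store, unit) prog" where
  "cumulate [] x = return ()"
| "cumulate (c # cs) x = do {
     tick 1;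
     y \<leftarrow> rd arr_C c;
     wr arr_C_update c x;
     cumulate cs (x + y)
   }"

definition initialize ::
  "'a::linorder list \<Rightarrow> (bool \<Rightarrow> 'a list) \<Rightarrow> ('a store, bool \<Rightarrow> 'a wavelet_tree) prog" where
  "initialize syms bw = (let n0 = length (bw False); n1 = length (bw True) in do {
     foreach [1..<Suc n0] (\<lambda>k. wr arr_Z_update k False);
     foreach [Suc n0..<Suc (n0 + n1)] (\<lambda>k. wr arr_Z_update k True);
     foreach [1..<n0 + n1 + 2] (\<lambda>k. wr arr_B_update k 0);
     wr arr_B_update 1 1;
     wr arr_B_update (n0 + n1 + 1) 1;
     wr arr_N_update False 0;
     wr arr_N_update True 0;
     foreach syms (\<lambda>c. wr arr_C_update c 0);
     foreach (bw False) (\<lambda>c. do { x \<leftarrow> rd arr_C c; wr arr_C_update c (x + 1) });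
     foreach (bw True) (\<lambda>c. do { x \<leftarrow> rd arr_C c; wr arr_C_update c (x + 1) });
     cumulate syms 1;
     w0 \<leftarrow> build_wt syms (bw False);
     w1 \<leftarrow> build_wt syms (bw True);
     return (\<lambda>b. if b then w1 else w0)
   })"

text \<open>The output for the positions \<open>i, \<dots>, i + d - 1\<close>. By convention, the first entry of an LCP
  array is \<open>-1\<close>, as is the one behind the last position.\<close>

primrec merge_output ::
  "(bool \<Rightarrow> 'a list) \<Rightarrow> (bool \<Rightarrow> int list) \<Rightarrow> nat \<Rightarrow> nat \<Rightarrow> ('a store, 'a list \<times> int list) prog" where
  "merge_output bw lc 0 i = do { tick 1; return ([], [-1]) }"
| "merge_output bw lc (Suc d) i = do {
     tick 1;
     b \<leftarrow> rd arr_Z i;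
     k \<leftarrow> rd arr_K b;
     wr arr_K_update b (k + 1);
     c \<leftarrow> rd_input (bw b) k;
     v \<leftarrow> rd arr_B i;
     x \<leftarrow> rd_input (lc b) k;
     (cs, xs) \<leftarrow> merge_output bw lc d (i + 1);
     return (c # cs, (if i = 1 then -1 else if v \<noteq> 0 then int v - 1 else x) # xs)
   }"

definition final_output ::
  "(bool \<Rightarrow> 'a list) \<Rightarrow> (bool \<Rightarrow> int list) \<Rightarrow> ('a store, 'a list \<times> int list) prog" where
  "final_output bw lc = do {
     wr arr_K_update False 1;
     wr arr_K_update True 1;
     merge_output bw lc (length (bw False) + length (bw True)) 1
   }"

text \<open>\<open>syms\<close> is the alphabet in increasing order. The result consists of the two output arrays and
  the running time. The algorithm starts from uninitialized memory.\<close>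

definition gap ::
  "'a::linorder list \<Rightarrow> 'a list \<Rightarrow> int list \<Rightarrow> 'a list \<Rightarrow> int list
     \<Rightarrow> (('a list \<times> int list) \<times> nat) option" where
  "gap syms bwt0 lcp0 bwt1 lcp1 =
     (let bw = (\<lambda>b. if b then bwt1 else bwt0);
          lc = (\<lambda>b. if b then lcp1 else lcp0);
          (w, s, t) = initialize syms bw undefined
      in map_option
           (\<lambda>(s', t'). let (out, s'', t'') = final_output bw lc s' in (out, t + t' + t''))
           (phases syms bw w [Active (length bwt0 + length bwt1)] s))"

end

theory Submission
  imports Defs "HOL-Library.Multiset" "HOL-Library.Product_Lexorder"
begin

text \<open>Identify the entries of the two input BWTs with the positions of \<open>T0 @ T1\<close>. After phase \<open>h\<close>, the bit
  vector lists the bits of the entries sorted by the first \<open>h\<close> symbols of their contexts, with ties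
  broken by the bit and then by the whole context. Going from every entry to its predecessor in its
  own string turns the order of phase \<open>h\<close> into that of phase \<open>h + 1\<close>, as in a step of radix sort.

  A \<open>g\<close>-block is a maximal interval of ranks whose contexts agree in the first \<open>g\<close> symbols. Phase \<open>h\<close>
  has to process only the \<open>(h - 2)\<close>-blocks that contain both bits: a monochrome \<open>g\<close>-block is sent
  into monochrome \<open>(g + 1)\<close>-blocks, whose bits are already final, and the boundaries inside
  those that remain undetected separate entries of one string, so that their LCP values
  are found in its LCP array.

  A rank that is active in phase \<open>h \<ge> 3\<close> is adjacent to an LCP value of at least \<open>h - 2\<close>. Summed over all
  phases there are hence at most \<open>2 n + 2 S\<close> active ranks, where \<open>S\<close> is the sum of the LCP values, and each
  one costs \<open>O(log \<bar>\<Sigma>\<bar>)\<close>. The overhead \<open>O(\<bar>\<Sigma>\<bar>)\<close> of a phase is absorbed since the maximal LCP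
  value \<open>m\<close> satisfies \<open>m (m + 1) \<le> 2 S\<close>, and \<open>n \<le> S + \<bar>\<Sigma>\<bar> + 1\<close>.\<close>

section \<open>Lists\<close>

text \<open>Activity lags behind by one phase: the boundaries of the \<open>g\<close>-blocks are
  completed in phase \<open>g\<close>, but the bits between them are counted only when phase
  \<open>g + 1\<close> traverses them. So the segments given to phase \<open>h\<close> describe
  \<open>(h - 2)\<close>-blocks, and the index \<open>g - 1\<close> accompanies phase
  \<open>Suc g\<close>. The content of \<open>B\<close> depends on which boundaries were skipped. To
  keep this history out of the invariants, \<open>B\<close> is given by a closed formula: the LCP
  value at a boundary and the bits belonging to one shorter word decide whether and when the
  boundary is found. The time bound needs a threshold on the length: if all symbols of
  \<open>T0 @ T1\<close> differ, the LCP sum is 0 although the cost is positive. From length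
  \<open>(card \<Sigma> + 2)^2\<close> on, repetitions make the LCP sum dominate both the length and
  the alphabet overhead of all phases, with a factor that is the same for all alphabets.\<close>

lemma take_mono: "xs \<le> ys \<Longrightarrow> take g xs \<le> take g ys" for xs ys :: "'a::linorder list"
proof (induction xs arbitrary: g ys)
  case (Cons x xs)
  then show ?case by (cases ys; cases g) auto
qed simp

lemma take_less_imp_less: "take g xs < take g ys \<Longrightarrow> xs < ys" for xs ys :: "'a::linorder list"
  using take_mono[of ys xs g] by (meson leD leI)

text \<open>Neither string being a prefix of the other, a mismatch inside both decides. Suffixes of
  \<open>T0\<close> are thus compared as if \<open>T1\<close> did not follow.\<close>

lemma append_less_append_iff:
  fixes xs ys :: "'a::linorder list"
  assumes "\<not> prefix xs ys" "\<not> prefix ys xs"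
  shows "xs @ us < ys @ vs \<longleftrightarrow> xs < ys"
  using assms by (induction xs ys rule: list_induct2') auto

lemma lcp_append:
  assumes "\<not> prefix xs ys" "\<not> prefix ys xs"
  shows "lcp (xs @ us) (ys @ vs) = lcp xs ys"
  using assms by (induction xs ys rule: list_induct2') (auto simp: lcp_def)

lemma take_eq_take_iff_lcp:
  assumes "xs \<noteq> ys"
  shows "take g xs = take g ys \<longleftrightarrow> g \<le> lcp xs ys"
  using assms
proof (induction xs ys arbitrary: g rule: longest_common_prefix.induct)
  case (1 x xs y ys)
  then show ?case by (cases g) (auto simp: lcp_def)
qed (auto simp: lcp_def take_Cons split: nat.splits)

text \<open>Sorting by a key also sorts by every coarser one. Prefixes of contexts are coarser than
  the key of a phase and than the whole context.\<close>

lemma sorted_map_sort_key: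
  assumes "\<And>x y. f x \<le> f y \<Longrightarrow> g x \<le> g y"
  shows "sorted (map g (sort_key f xs))"
proof -
  have "sorted_wrt (\<lambda>x y. f x \<le> f y) (sort_key f xs)"
    using sorted_sort_key[of f xs] by (simp add: sorted_wrt_map)
  then have "sorted_wrt (\<lambda>x y. g x \<le> g y) (sort_key f xs)"
    using assms by (metis (mono_tags, lifting) sorted_wrt_mono_rel)
  then show ?thesis by (simp add: sorted_wrt_map)
qed

text \<open>An injective key makes sorting a bijection from ranks to positions, inverted by counting
  smaller keys. It serves for the order of a phase, for the suffix array of \<open>T0 @ T1\<close>
  and for those of the single strings.\<close>

lemma sort_key_ranks:
  fixes f :: "nat \<Rightarrow> 'b::linorder"
  assumes inj: "inj_on f {1..n}" and xs: "xs = sort_key f [1..<Suc n]"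
  shows sort_key_bij: "bij_betw ((!!) xs) {1..n} {1..n}"
    and sort_key_less_iff: "\<And>k k'. k \<in> {1..n} \<Longrightarrow> k' \<in> {1..n} \<Longrightarrow> f (xs !! k) < f (xs !! k') \<longleftrightarrow> k < k'"
    and sort_key_rank: "\<And>k. k \<in> {1..n} \<Longrightarrow> card {q \<in> {1..n}. f q < f (xs !! k)} = k - 1"
proof -
  have len: "length xs = n" and set: "set xs = {1..n}" and dist: "distinct xs"
    by (auto simp: xs)
  show bij: "bij_betw ((!!) xs) {1..n} {1..n}"
  proof -
    have "bij_betw ((!) xs) {..<n} {1..n}"
      using bij_betw_nth[OF dist, of "{..<n}" "{1..n}"] len set by auto
    moreover have "bij_betw (\<lambda>k. k - 1) {1..n} {..<n}"
      by (rule bij_betw_byWitness[where f' = Suc]) auto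
    ultimately have "bij_betw ((!) xs \<circ> (\<lambda>k. k - 1)) {1..n} {1..n}" by (rule bij_betw_trans[rotated])
    then show ?thesis by (simp add: nth1_def comp_def cong: bij_betw_cong)
  qed
  have srt: "sorted (map f xs)" by (simp add: xs)
  have strict: "f (xs !! k) < f (xs !! k')" if "k \<in> {1..n}" "k' \<in> {1..n}" "k < k'" for k k'
  proof -
    have "f (xs !! k) \<le> f (xs !! k')"
      using sorted_nth_mono[OF srt, of "k - 1" "k' - 1"] that len by (auto simp: nth1_def)
    moreover have "xs !! k \<noteq> xs !! k'"
      using bij that by (metis bij_betw_def inj_on_def less_irrefl)
    moreover have "xs !! k \<in> {1..n}" "xs !! k' \<in> {1..n}" using bij that by (auto simp: bij_betw_def)
    ultimately show ?thesis using inj by (metis inj_on_def order.not_eq_order_implies_strict)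
  qed
  show less: "f (xs !! k) < f (xs !! k') \<longleftrightarrow> k < k'" if "k \<in> {1..n}" "k' \<in> {1..n}" for k k'
    using strict[OF that] strict[of k' k] that by (metis linorder_neqE_nat order.asym less_irrefl)
  show "card {q \<in> {1..n}. f q < f (xs !! k)} = k - 1" if k: "k \<in> {1..n}" for k
  proof -
    have "{q \<in> {1..n}. f q < f (xs !! k)} = (!!) xs ` {1..<k}"
    proof (intro equalityI subsetI)
      fix q assume q: "q \<in> {q \<in> {1..n}. f q < f (xs !! k)}"
      then obtain k' where "k' \<in> {1..n}" "q = xs !! k'" using bij
        by (metis (no_types, lifting) bij_betw_imp_surj_on imageE mem_Collect_eq)
      then show "q \<in> (!!) xs ` {1..<k}" using q less[of k' k] k by auto
    next
      fix q assume "q \<in> (!!) xs ` {1..<k}"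
      then obtain k' where "k' \<in> {1..<k}" "q = xs !! k'" by auto
      then show "q \<in> {q \<in> {1..n}. f q < f (xs !! k)}"
        using less[of k' k] k bij by (auto simp: bij_betw_def)
    qed
    moreover have "inj_on ((!!) xs) {1..<k}"
      using bij k by (auto simp: bij_betw_def intro: inj_on_subset)
    ultimately show ?thesis by (simp add: card_image)
  qed
qed

section \<open>Merging contexts by bounded prefixes\<close>

locale string_pair =
  fixes \<Sigma> :: "'a::linorder set" and d0 d1 :: 'a and T0 T1 :: "'a list"
  assumes finite_alphabet: "finite \<Sigma>"
    and terminated: "terminated_pair \<Sigma> d0 d1 T0 T1"
begin

abbreviation "n0 \<equiv> length T0"
abbreviation "n1 \<equiv> length T1"
abbreviation "n \<equiv> n0 + n1"

definition letter :: "nat \<Rightarrow> 'a" where "letter p = (T0 @ T1) !! p"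
definition sf :: "nat \<Rightarrow> 'a list" where "sf p = suf (T0 @ T1) p"
definition side :: "nat \<Rightarrow> bool" where "side p \<longleftrightarrow> n0 < p"
text \<open>The wrap-around is the BWT convention for the entry whose context is its whole string.
  So \<open>letter (prv p)\<close> is the BWT symbol of entry \<open>p\<close>.\<close>

definition prv :: "nat \<Rightarrow> nat" where
  "prv p = (if p = 1 then n0 else if p = n0 + 1 then n else p - 1)"
definition nxt :: "nat \<Rightarrow> nat" where
  "nxt p = (if p = n0 then 1 else if p = n then n0 + 1 else p + 1)"

lemma n0_pos: "0 < n0" and n1_pos: "0 < n1"
  using terminated by (auto simp: terminated_pair_def)

lemma n_bounds: "Suc 0 \<le> n0" "Suc 0 \<le> n1"
  using n0_pos n1_pos by (simp_all only: Suc_le_eq)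

lemma letter_in: "p \<in> {1..n} \<Longrightarrow> letter p \<in> \<Sigma>"
proof -
  assume "p \<in> {1..n}"
  then have "letter p \<in> set (T0 @ T1)" unfolding letter_def nth1_def by (intro nth_mem) auto
  then show ?thesis using terminated by (auto simp: terminated_pair_def)
qed

lemma T0_eq: "T0 = butlast T0 @ [d0]" and T1_eq: "T1 = butlast T1 @ [d1]"
  using terminated by (auto simp: terminated_pair_def)

lemma nth_eq_last_iff:
  assumes "xs \<noteq> []" "last xs \<notin> set (butlast xs)" "i < length xs"
  shows "xs ! i = last xs \<longleftrightarrow> i = length xs - 1"
proof
  assume e: "xs ! i = last xs"
  show "i = length xs - 1"
  proof (rule ccontr)
    assume "i \<noteq> length xs - 1"
    then have "i < length (butlast xs)" using assms by simp
    then have "xs ! i \<in> set (butlast xs)" by (metis nth_butlast nth_mem)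
    then show False using e assms by simp
  qed
qed (use assms in \<open>simp add: last_conv_nth\<close>)

lemma letter_d0: "p \<in> {1..n} \<Longrightarrow> letter p = d0 \<longleftrightarrow> p = n0"
proof -
  assume p: "p \<in> {1..n}"
  show ?thesis
  proof (cases "p \<le> n0")
    case True
    then have "letter p = T0 ! (p - 1)" using p by (auto simp: letter_def nth1_def nth_append)
    then show ?thesis using nth_eq_last_iff[of T0 "p - 1"] terminated p True
      by (auto simp: terminated_pair_def)
  next
    case False
    then have "letter p = T1 ! (p - 1 - n0)" using p by (auto simp: letter_def nth1_def nth_append)
    moreover have "p - 1 - n0 < n1" using p False by auto
    ultimately have "letter p \<in> set T1" by simp
    then show ?thesis using terminated False by (auto simp: terminated_pair_def)
  qed
qed

lemma letter_d1: "p \<in> {1..n} \<Longrightarrow> letter p = d1 \<longleftrightarrow> p = n"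
proof -
  assume p: "p \<in> {1..n}"
  show ?thesis
  proof (cases "p \<le> n0")
    case True
    then have "letter p = T0 ! (p - 1)" using p by (auto simp: letter_def nth1_def nth_append)
    moreover have "p - 1 < n0" using p True by auto
    ultimately have "letter p \<in> set T0" by simp
    then show ?thesis using terminated n1_pos True by (auto simp: terminated_pair_def)
  next
    case False
    then have "letter p = T1 ! (p - 1 - n0)" using p by (auto simp: letter_def nth1_def nth_append)
    then show ?thesis using nth_eq_last_iff[of T1 "p - 1 - n0"] terminated p False
      by (auto simp: terminated_pair_def)
  qed
qed

lemma sf_Cons: "p \<in> {1..n} \<Longrightarrow> sf p = letter p # sf (p + 1)"
  using Cons_nth_drop_Suc[of "p - 1" "T0 @ T1"]
  by (auto simp: sf_def suf_def letter_def nth1_def simp del: drop_append)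

lemma length_sf: "length (sf p) = n - (p - 1)"
  by (simp add: sf_def suf_def)

lemma sf_inj: "inj_on sf {1..n}"
  by (rule inj_on_inverseI[where g = "\<lambda>xs. n + 1 - length xs"]) (auto simp: length_sf)

lemma prv_range: "p \<in> {1..n} \<Longrightarrow> prv p \<in> {1..n}"
  using n0_pos n1_pos by (auto simp: prv_def)

lemma nxt_range: "p \<in> {1..n} \<Longrightarrow> nxt p \<in> {1..n}"
  using n_bounds by (auto simp: nxt_def)

lemma prv_nxt: "p \<in> {1..n} \<Longrightarrow> prv (nxt p) = p"
  using n0_pos n1_pos by (auto simp: nxt_def prv_def)

lemma nxt_prv: "p \<in> {1..n} \<Longrightarrow> nxt (prv p) = p"
  using n0_pos n1_pos by (auto simp: nxt_def prv_def)

lemma side_prv: "p \<in> {1..n} \<Longrightarrow> side (prv p) = side p"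
  using n0_pos n1_pos by (auto simp: side_def prv_def)

lemma prv_inj: "p \<in> {1..n} \<Longrightarrow> q \<in> {1..n} \<Longrightarrow> prv p = prv q \<longleftrightarrow> p = q"
  by (metis nxt_prv)

text \<open>The two cyclic steps of \<open>prv\<close> produce the unique symbols \<open>d0\<close> and \<open>d1\<close>, so they are harmless:
  they never compete with another entry that has the same letter.\<close>

lemma equal_letters:
  assumes "p \<in> {1..n}" "q \<in> {1..n}" "p \<noteq> q" "letter p = letter q"
  shows "nxt p = p + 1"
  using assms letter_d0[of p] letter_d0[of q] letter_d1[of p] letter_d1[of q]
  by (auto simp: nxt_def)

lemma take_sf_prv:
  assumes "p \<in> {1..n}" "q \<in> {1..n}" "p \<noteq> q" "letter (prv p) = letter (prv q)"
  shows "sf (prv p) = letter (prv p) # sf p"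
  using equal_letters[of "prv p" "prv q"] assms sf_Cons[of "prv p"] prv_range nxt_prv prv_inj by metis

definition key :: "nat \<Rightarrow> nat \<Rightarrow> 'a list \<times> bool \<times> 'a list" where
  "key h p = (take h (sf p), side p, sf p)"

lemma key_inj: "inj_on (key h) {1..n}"
  using sf_inj by (auto simp: key_def inj_on_def)

text \<open>If different entries carry the same symbol, neither step wraps, and prepending a common
  symbol preserves every comparison. Different symbols decide alone; for \<open>p = q\<close> both
  sides are false.\<close>

lemma key_prv:
  assumes "p \<in> {1..n}" "q \<in> {1..n}"
  shows "key (Suc h) (prv p) < key (Suc h) (prv q) \<longleftrightarrow>
    letter (prv p) < letter (prv q) \<or> letter (prv p) = letter (prv q) \<and> key h p < key h q"
proof (cases "p \<noteq> q \<and> letter (prv p) = letter (prv q)")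
  case True
  then have "sf (prv p) = letter (prv p) # sf p" "sf (prv q) = letter (prv q) # sf q"
    using assms by (metis take_sf_prv)+
  then show ?thesis using True assms by (auto simp: key_def side_prv)
next
  case False
  then show ?thesis using assms prv_range[of p] prv_range[of q] by (auto simp: key_def sf_Cons)
qed

lemma key_le_take: "key h p \<le> key h q \<Longrightarrow> take h (sf p) \<le> take h (sf q)"
  by (auto simp: key_def)

text \<open>Truncation is monotone, so within one string it cannot contradict the order of the whole
  contexts. Hence the \<open>i\<close>-th zero stands for the \<open>i\<close>-th symbol of the
  first BWT in every phase.\<close>

lemma key_less_same_side:
  assumes "side p = side q"
  shows "key h p < key h q \<longleftrightarrow> sf p < sf q"
  using take_less_imp_less[of h "sf p" "sf q"] take_mono[of "sf p" "sf q" h] assms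
  by (auto simp: key_def)

section \<open>Ranks of the entries in the order of each phase\<close>

definition item :: "nat \<Rightarrow> nat \<Rightarrow> nat" where
  "item h k = sort_key (key h) [1..<Suc n] !! k"
definition pos :: "nat \<Rightarrow> nat \<Rightarrow> nat" where
  "pos h p = Suc (card {q \<in> {1..n}. key h q < key h p})"
definition sa :: "nat \<Rightarrow> nat" where
  "sa k = suffix_array (T0 @ T1) !! k"

lemma item_bij: "bij_betw (item h) {1..n} {1..n}"
  using sort_key_bij[OF key_inj refl, of h] by (simp add: item_def[abs_def])

lemma item_range: "k \<in> {1..n} \<Longrightarrow> item h k \<in> {1..n}"
  using item_bij[of h] by (auto simp: bij_betw_def)

lemma item_less_iff:
  "k \<in> {1..n} \<Longrightarrow> k' \<in> {1..n} \<Longrightarrow> key h (item h k) < key h (item h k') \<longleftrightarrow> k < k'"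
  unfolding item_def by (rule sort_key_less_iff[OF key_inj refl])

lemma pos_item: "k \<in> {1..n} \<Longrightarrow> pos h (item h k) = k"
  unfolding item_def pos_def using sort_key_rank[OF key_inj refl, of k h] by auto

lemma pos_range: "p \<in> {1..n} \<Longrightarrow> pos h p \<in> {1..n}"
  and item_pos: "p \<in> {1..n} \<Longrightarrow> item h (pos h p) = p"
proof -
  assume "p \<in> {1..n}"
  then obtain k where k: "k \<in> {1..n}" "p = item h k"
    using item_bij[of h] by (metis bij_betw_imp_surj_on imageE)
  then show "pos h p \<in> {1..n}" "item h (pos h p) = p" using pos_item by auto
qed

lemma sa_eq: "suffix_array (T0 @ T1) = sort_key sf [1..<Suc n]"
  by (simp add: suffix_array_def sf_def[abs_def])

lemma sa_bij: "bij_betw sa {1..n} {1..n}"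
  using sort_key_bij[OF sf_inj refl] by (simp add: sa_def[abs_def] sa_eq)

lemma sa_range: "k \<in> {1..n} \<Longrightarrow> sa k \<in> {1..n}"
  using sa_bij by (auto simp: bij_betw_def)

lemma sa_less_iff:
  "k \<in> {1..n} \<Longrightarrow> k' \<in> {1..n} \<Longrightarrow> sf (sa k) < sf (sa k') \<longleftrightarrow> k < k'"
  unfolding sa_def sa_eq by (rule sort_key_less_iff[OF sf_inj refl])

text \<open>\<open>Z h\<close> is the bit vector after phase \<open>h\<close>. The entry at position \<open>k\<close> has the BWT symbol \<open>ch h k\<close>, and
  phase \<open>h + 1\<close> sends it to position \<open>dest h k\<close>.\<close>

definition Z :: "nat \<Rightarrow> nat \<Rightarrow> bool" where "Z h k = side (item h k)"
definition ch :: "nat \<Rightarrow> nat \<Rightarrow> 'a" where "ch h k = letter (prv (item h k))"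
definition dest :: "nat \<Rightarrow> nat \<Rightarrow> nat" where "dest h k = pos (Suc h) (prv (item h k))"
definition cnt :: "nat \<Rightarrow> bool \<Rightarrow> nat \<Rightarrow> nat" where
  "cnt h b k = card {k' \<in> {1..<k}. Z h k' = b}"
definition occ :: "nat \<Rightarrow> 'a \<Rightarrow> nat \<Rightarrow> nat" where
  "occ h c k = card {k' \<in> {1..<k}. ch h k' = c}"

lemma ch_in: "k \<in> {1..n} \<Longrightarrow> ch h k \<in> \<Sigma>"
  unfolding ch_def by (intro letter_in prv_range item_range)

lemma dest_range: "k \<in> {1..n} \<Longrightarrow> dest h k \<in> {1..n}"
  unfolding dest_def by (intro pos_range prv_range item_range)

lemma item_dest: "k \<in> {1..n} \<Longrightarrow> item (Suc h) (dest h k) = prv (item h k)"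
  unfolding dest_def by (intro item_pos prv_range item_range)

lemma Z_dest: "k \<in> {1..n} \<Longrightarrow> Z (Suc h) (dest h k) = Z h k"
  unfolding Z_def by (metis item_dest side_prv item_range)

lemma dest_surj: "j \<in> {1..n} \<Longrightarrow> \<exists>k \<in> {1..n}. dest h k = j"
proof
  assume j: "j \<in> {1..n}"
  let ?p = "nxt (item (Suc h) j)"
  have p: "?p \<in> {1..n}" using nxt_range item_range[OF j] .
  show "pos h ?p \<in> {1..n}" using pos_range[OF p] .
  show "dest h (pos h ?p) = j"
    by (simp add: dest_def item_pos[OF p] prv_nxt[OF item_range[OF j]] pos_item[OF j])
qed

lemma item_inj: "k \<in> {1..n} \<Longrightarrow> k' \<in> {1..n} \<Longrightarrow> item h k = item h k' \<longleftrightarrow> k = k'"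
  by (metis pos_item)

lemma dest_inj: "k \<in> {1..n} \<Longrightarrow> k' \<in> {1..n} \<Longrightarrow> dest h k = dest h k' \<longleftrightarrow> k = k'"
  by (metis item_dest prv_inj item_range item_inj)

lemma dest_less_iff:
  assumes "k \<in> {1..n}" "k' \<in> {1..n}"
  shows "dest h k < dest h k' \<longleftrightarrow> ch h k < ch h k' \<or> ch h k = ch h k' \<and> k < k'"
proof -
  have "dest h k < dest h k' \<longleftrightarrow> key (Suc h) (prv (item h k)) < key (Suc h) (prv (item h k'))"
    using item_less_iff[of "dest h k" "dest h k'" "Suc h"] dest_range item_dest assms by metis
  then show ?thesis
    using key_prv item_less_iff item_range assms unfolding ch_def by presburger
qed

text \<open>The ranks sent below \<open>dest h k\<close> have a smaller symbol, or the same symbol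
  and a smaller rank. The right-hand side is the value of the counter \<open>F[c]\<close> when
  \<open>k\<close> is processed.\<close>

lemma dest_eq:
  assumes k: "k \<in> {1..n}"
  shows "dest h k = 1 + card {k' \<in> {1..n}. ch h k' < ch h k} + occ h (ch h k) k"
proof -
  have "dest h k - 1 = card {1..<dest h k}" by simp
  also have "{1..<dest h k} = dest h ` {k' \<in> {1..n}. dest h k' < dest h k}"
  proof (intro equalityI subsetI)
    fix j assume j: "j \<in> {1..<dest h k}"
    then have "j \<in> {1..n}" using dest_range[OF k, of h] by auto
    from dest_surj[OF this, of h] show "j \<in> dest h ` {k' \<in> {1..n}. dest h k' < dest h k}"
      using j by auto
  next
    fix j assume "j \<in> dest h ` {k' \<in> {1..n}. dest h k' < dest h k}"
    then show "j \<in> {1..<dest h k}" using dest_range[of _ h] by force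
  qed
  also have "card \<dots> = card {k' \<in> {1..n}. dest h k' < dest h k}"
    by (rule card_image) (auto simp: inj_on_def dest_inj simp del: atLeastAtMost_iff)
  also have "{k' \<in> {1..n}. dest h k' < dest h k} =
      {k' \<in> {1..n}. ch h k' < ch h k} \<union> {k' \<in> {1..<k}. ch h k' = ch h k}"
    using dest_less_iff[OF _ k, of _ h] k by fastforce
  also have "card \<dots> = card {k' \<in> {1..n}. ch h k' < ch h k} + occ h (ch h k) k"
    unfolding occ_def by (intro card_Un_disjoint) auto
  finally show ?thesis using dest_range[OF k, of h] by auto
qed

subsection \<open>The single strings\<close>

definition Tb :: "bool \<Rightarrow> 'a list" where "Tb b = (if b then T1 else T0)"
definition off :: "bool \<Rightarrow> nat" where "off b = (if b then n0 else 0)"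

lemma sf_off:
  "r \<in> {1..length (Tb b)} \<Longrightarrow> sf (off b + r) = suf (Tb b) r @ (if b then [] else T1)"
  by (auto simp: sf_def suf_def Tb_def off_def)

lemma off_range: "r \<in> {1..length (Tb b)} \<Longrightarrow> off b + r \<in> {1..n} \<and> side (off b + r) = b"
  by (auto simp: Tb_def off_def side_def split: if_splits)

lemma off_cases:
  assumes "p \<in> {1..n}"
  shows "\<exists>r \<in> {1..length (Tb (side p))}. p = off (side p) + r"
  using assms by (intro bexI[of _ "p - off (side p)"]) (auto simp: Tb_def off_def side_def)

text \<open>A suffix ends in the terminator; were it a prefix of a different suffix, the terminator
  would also occur before the end of the string.\<close>

lemma not_prefix_suf:
  assumes "r \<in> {1..length (Tb b)}" "r' \<in> {1..length (Tb b)}" "r \<noteq> r'"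
  shows "\<not> prefix (suf (Tb b) r) (suf (Tb b) r')"
proof
  assume pr: "prefix (suf (Tb b) r) (suf (Tb b) r')"
  have T: "Tb b \<noteq> []" "last (Tb b) \<notin> set (butlast (Tb b))"
    using terminated by (auto simp: Tb_def terminated_pair_def)
  let ?m = "length (Tb b)"
  have le: "length (suf (Tb b) r) \<le> length (suf (Tb b) r')" using pr prefix_length_le by blast
  then have rr: "r' \<le> r" using assms by (auto simp: suf_def)
  obtain us where "suf (Tb b) r' = suf (Tb b) r @ us" using pr by (auto simp: prefix_def)
  then have "suf (Tb b) r' ! (?m - r) = suf (Tb b) r ! (?m - r)"
    using assms by (simp add: nth_append suf_def) auto
  moreover have "suf (Tb b) r ! (?m - r) = Tb b ! (?m - 1)" "suf (Tb b) r' ! (?m - r) = Tb b ! (?m - 1 - (r - r'))"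
    using assms rr by (auto simp: suf_def intro!: arg_cong[of _ _ "(!) (Tb b)"])
  ultimately have "Tb b ! (?m - 1 - (r - r')) = last (Tb b)" using T by (simp add: last_conv_nth)
  then have "?m - 1 - (r - r') = ?m - 1"
    using T assms by (subst (asm) nth_eq_last_iff) auto
  then show False using assms rr by auto
qed

lemma suf_less_iff:
  assumes "r \<in> {1..length (Tb b)}" "r' \<in> {1..length (Tb b)}"
  shows "sf (off b + r) < sf (off b + r') \<longleftrightarrow> suf (Tb b) r < suf (Tb b) r'"
  unfolding sf_off[OF assms(1)] sf_off[OF assms(2)]
  using append_less_append_iff not_prefix_suf[OF assms] not_prefix_suf[OF assms(2,1)]
  by (cases "r = r'") blast+

lemma suf_lcp:
  assumes "r \<in> {1..length (Tb b)}" "r' \<in> {1..length (Tb b)}" "r \<noteq> r'"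
  shows "lcp (sf (off b + r)) (sf (off b + r')) = lcp (suf (Tb b) r) (suf (Tb b) r')"
  unfolding sf_off[OF assms(1)] sf_off[OF assms(2)]
  using lcp_append not_prefix_suf[OF assms] not_prefix_suf[OF assms(2,1)] assms(3) by metis

lemma suf_inj: "inj_on (suf T) {1..length T}" for T :: "'a list"
  by (rule inj_on_inverseI[where g = "\<lambda>xs. length T + 1 - length xs"]) (auto simp: suf_def)

text \<open>Among entries with the same bit, the key orders by whole contexts. Hence the number of
  equal bits before \<open>k\<close> is the number of smaller suffixes of that string, transported
  by the shift \<open>off b\<close> and by \<open>item h\<close>. The pointer
  \<open>k\<^sub>b\<close> therefore addresses the right BWT entry.\<close>

lemma suffix_array_cnt:
  fixes h assumes k: "k \<in> {1..n}"
  defines "b \<equiv> Z h k"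
  shows "off b + suffix_array (Tb b) !! (Suc (cnt h b k)) = item h k"
    and "Suc (cnt h b k) \<in> {1..length (Tb b)}"
    and "suffix_array (Tb b) !! (Suc (cnt h b k)) \<in> {1..length (Tb b)}"
proof -
  let ?m = "length (Tb b)" and ?A = "suffix_array (Tb b)"
  have A: "?A = sort_key (suf (Tb b)) [1..<Suc ?m]" by (simp add: suffix_array_def)
  obtain r where r: "r \<in> {1..?m}" "item h k = off b + r"
    using off_cases[OF item_range[OF k]] unfolding b_def Z_def by blast
  obtain i where i: "i \<in> {1..?m}" "?A !! i = r"
    using sort_key_bij[OF suf_inj A] r(1) by (metis bij_betw_imp_surj_on imageE)
  have "i - 1 = card {q \<in> {1..?m}. suf (Tb b) q < suf (Tb b) r}"
    using sort_key_rank[OF suf_inj A i(1)] i(2) by simp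
  also have "\<dots> = card ((\<lambda>q. off b + q) ` {q \<in> {1..?m}. suf (Tb b) q < suf (Tb b) r})"
    by (rule card_image[symmetric]) (auto simp: inj_on_def)
  also have "(\<lambda>q. off b + q) ` {q \<in> {1..?m}. suf (Tb b) q < suf (Tb b) r} =
      {p \<in> {1..n}. side p = b \<and> key h p < key h (item h k)}" (is "?L = ?R")
  proof (intro equalityI subsetI)
    fix p assume "p \<in> ?L"
    then obtain q where q: "q \<in> {1..?m}" "suf (Tb b) q < suf (Tb b) r" "p = off b + q" by auto
    then have "side p = b" "p \<in> {1..n}" "sf p < sf (item h k)"
      using suf_less_iff[of q b r] off_range[of q b] r by auto
    moreover have "side (item h k) = b" by (simp add: b_def Z_def)
    ultimately show "p \<in> ?R" using key_less_same_side[of p "item h k" h] by simp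
  next
    fix p assume p: "p \<in> ?R"
    then obtain q where q: "q \<in> {1..?m}" "p = off b + q" using off_cases[of p] by auto
    have "side (item h k) = b" by (simp add: b_def Z_def)
    then have "sf p < sf (item h k)" using key_less_same_side[of p "item h k" h] p by simp
    then show "p \<in> ?L" using suf_less_iff[of q b r] q r by auto
  qed
  also have "?R = item h ` {k' \<in> {1..<k}. Z h k' = b}"
  proof (intro equalityI subsetI)
    fix p assume p: "p \<in> ?R"
    then have "pos h p \<in> {1..n}" "item h (pos h p) = p" using pos_range item_pos by auto
    moreover from this have "pos h p < k" using p item_less_iff[of "pos h p" k h] k by auto
    ultimately show "p \<in> item h ` {k' \<in> {1..<k}. Z h k' = b}"
      using p by (intro image_eqI[of _ _ "pos h p"]) (auto simp: Z_def)
  next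
    fix p assume "p \<in> item h ` {k' \<in> {1..<k}. Z h k' = b}"
    then obtain k' where k': "k' \<in> {1..<k}" "p = item h k'" "Z h k' = b" by auto
    then show "p \<in> ?R" using item_less_iff[of k' k h] item_range[of k' h] k by (auto simp: Z_def)
  qed
  also have "card \<dots> = cnt h b k"
    unfolding cnt_def using k by (intro card_image) (auto simp: inj_on_def item_inj)
  finally have "i = Suc (cnt h b k)" using i by auto
  then show "off b + ?A !! (Suc (cnt h b k)) = item h k" "Suc (cnt h b k) \<in> {1..?m}"
    "?A !! (Suc (cnt h b k)) \<in> {1..?m}"
    using i r by auto
qed

definition bw :: "bool \<Rightarrow> 'a list" where "bw b = bwt (Tb b)"

lemma length_bw: "length (bw b) = length (Tb b)"
  by (simp add: bw_def bwt_def suffix_array_def del: upt_Suc)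

lemma bw_cnt:
  assumes k: "k \<in> {1..n}"
  shows "bw (Z h k) !! (Suc (cnt h (Z h k) k)) = ch h k"
proof -
  let ?b = "Z h k" let ?i = "Suc (cnt h ?b k)"
  define r where "r = suffix_array (Tb ?b) !! ?i"
  note s = suffix_array_cnt[OF k, of h, folded r_def]
  have "bw ?b !! ?i = (if r > 1 then Tb ?b !! (r - 1) else Tb ?b !! length (Tb ?b))"
    using s(2) by (auto simp: bw_def bwt_def nth1_def r_def suffix_array_def)
  also have "\<dots> = letter (prv (off ?b + r))"
    using s(3) n0_pos n1_pos by (auto simp: letter_def prv_def off_def Tb_def nth1_def nth_append numeral_2_eq_2)
  also have "\<dots> = ch h k" by (simp add: ch_def s(1))
  finally show ?thesis .
qed

lemma cnt_Suc: "1 \<le> k \<Longrightarrow> cnt h b (Suc k) = cnt h b k + (if Z h k = b then 1 else 0)"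
proof -
  assume "1 \<le> k"
  then have "{k' \<in> {1..<Suc k}. Z h k' = b} =
      (if Z h k = b then insert k {k' \<in> {1..<k}. Z h k' = b} else {k' \<in> {1..<k}. Z h k' = b})"
    by (auto simp: less_Suc_eq)
  then show ?thesis by (simp add: cnt_def)
qed

lemma occ_Suc: "1 \<le> k \<Longrightarrow> occ h c (Suc k) = occ h c k + (if ch h k = c then 1 else 0)"
proof -
  assume "1 \<le> k"
  then have "{k' \<in> {1..<Suc k}. ch h k' = c} =
      (if ch h k = c then insert k {k' \<in> {1..<k}. ch h k' = c} else {k' \<in> {1..<k}. ch h k' = c})"
    by (auto simp: less_Suc_eq)
  then show ?thesis by (simp add: occ_def)
qed

lemma cnt_1: "cnt h b (Suc 0) = 0" and occ_1: "occ h c (Suc 0) = 0"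
  by (auto simp: cnt_def occ_def)

lemma cnt_le: "k \<le> n \<Longrightarrow> 1 \<le> k \<Longrightarrow> cnt h b (Suc k) \<le> length (Tb b)"
proof (induction k)
  case (Suc k)
  show ?case
  proof (cases "Z h (Suc k) = b")
    case True
    then show ?thesis using suffix_array_cnt(2)[of "Suc k" h] Suc.prems cnt_Suc[of "Suc k"] by auto
  next
    case False
    then show ?thesis using Suc cnt_Suc[of "Suc k" h b] by (cases "k = 0") (auto simp: cnt_1)
  qed
qed simp

text \<open>The ranks before \<open>k\<close> use up exactly the first \<open>cnt h b k\<close>
  symbols of each input. Two rank queries thus recover the earlier occurrences of \<open>c\<close>
  even across skipped blocks.\<close>

lemma rank_sum:
  assumes "k \<in> {1..Suc n}"
  shows "count_list (take (cnt h False k) (bw False)) c + count_list (take (cnt h True k) (bw True)) c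
    = occ h c k"
  using assms
proof (induction k)
  case (Suc k)
  show ?case
  proof (cases "k = 0")
    case True
    then show ?thesis by (simp add: cnt_1 occ_1)
  next
    case False
    then have k: "k \<in> {1..n}" using Suc by auto
    have "cnt h (Z h k) k < length (bw (Z h k))" using suffix_array_cnt(2)[OF k, of h] by (simp add: length_bw)
    moreover have "bw (Z h k) ! (cnt h (Z h k) k) = ch h k" using bw_cnt[OF k] by (simp add: nth1_def)
    ultimately show ?thesis
      using Suc.IH k by (cases "Z h k") (auto simp: cnt_Suc occ_Suc take_Suc_conv_app_nth)
  qed
qed simp

lemma cnt_total: "cnt h b (Suc n) = length (Tb b)"
proof -
  have "{k' \<in> {1..<Suc n}. Z h k' = False} \<union> {k' \<in> {1..<Suc n}. Z h k' = True} = {1..<Suc n}"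
    by auto
  then have "cnt h False (Suc n) + cnt h True (Suc n) = card {1..<Suc n}"
    unfolding cnt_def by (subst card_Un_disjoint[symmetric]) auto
  moreover have "cnt h False (Suc n) \<le> n0" "cnt h True (Suc n) \<le> n1"
    using cnt_le[of n h False] cnt_le[of n h True] n0_pos by (auto simp: Tb_def)
  ultimately show ?thesis by (cases b) (auto simp: Tb_def)
qed

lemma occ_total: "count_list (bw False) c + count_list (bw True) c = occ h c (Suc n)"
  using rank_sum[of "Suc n" h c] by (simp add: cnt_total length_bw[symmetric])

subsection \<open>Blocks\<close>

definition tk :: "nat \<Rightarrow> nat \<Rightarrow> 'a list" where "tk g k = take g (sf (sa k))"
definition L :: "nat \<Rightarrow> nat" where "L k = lcp (sf (sa (k - 1))) (sf (sa k))"
definition block_start :: "nat \<Rightarrow> nat \<Rightarrow> bool" where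
  "block_start g k \<longleftrightarrow> k = 1 \<or> k = Suc n \<or> tk g (k - 1) \<noteq> tk g k"
text \<open>Stated for words, since the block from which a boundary originates is known only as the
  tail of a prefix.\<close>

definition mono_word :: "nat \<Rightarrow> 'a list \<Rightarrow> bool" where
  "mono_word g w \<longleftrightarrow> (\<forall>p \<in> {1..n}. \<forall>q \<in> {1..n}.
     take g (sf p) = w \<longrightarrow> take g (sf q) = w \<longrightarrow> side p = side q)"
definition monochrome :: "nat \<Rightarrow> nat \<Rightarrow> bool" where
  "monochrome g k \<longleftrightarrow> mono_word g (tk g k)"

text \<open>Both orders sort the same multiset of prefixes of length \<open>g\<close>, so the sorted
  lists of prefixes coincide. Blocks can thus be described by \<open>sa\<close> alone, whatever the
  phase.\<close>

lemma take_item: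
  assumes "k \<in> {1..n}" "g \<le> h"
  shows "take g (sf (item h k)) = tk g k"
proof -
  let ?f = "\<lambda>p. take g (sf p)"
  let ?xs = "sort_key (key h) [1..<Suc n]" and ?ys = "suffix_array (T0 @ T1)"
  have f: "?f p \<le> ?f q" if "key h p \<le> key h q" for p q
    using key_le_take[OF that] take_mono[of "take h (sf p)" "take h (sf q)" g] assms by (simp add: min_absorb1)
  then have "sorted (map ?f ?xs)"
    by (intro sorted_map_sort_key) (rule f)
  moreover have "sorted (map ?f ?ys)"
    unfolding sa_eq by (intro sorted_map_sort_key) (rule take_mono)
  moreover have "mset (map ?f ?xs) = mset (map ?f ?ys)" by (simp only: mset_map mset_sort sa_eq)
  ultimately have "map ?f ?xs = map ?f ?ys" by (metis properties_for_sort)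
  then have "map ?f ?xs ! (k - 1) = map ?f ?ys ! (k - 1)" by simp
  then show ?thesis using assms
    by (auto simp: item_def tk_def sa_def sa_eq nth1_def simp del: upt_Suc)
qed

lemma tk_mono:
  assumes "k \<in> {1..n}" "k' \<in> {1..n}" "k \<le> k'"
  shows "tk g k \<le> tk g k'"
proof (cases "k = k'")
  case False
  then have "sf (sa k) < sf (sa k')" using sa_less_iff assms by auto
  then show ?thesis unfolding tk_def by (intro take_mono) auto
qed simp

lemma tk_take: "g \<le> g' \<Longrightarrow> tk g k = take g (tk g' k)"
  by (simp add: tk_def min_absorb1)

lemma tk_eq_mono: "g \<le> g' \<Longrightarrow> tk g' k = tk g' k' \<Longrightarrow> tk g k = tk g k'"
  by (metis tk_take)

lemma block_start_mono: "g \<le> g' \<Longrightarrow> block_start g k \<Longrightarrow> block_start g' k"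
  using tk_eq_mono unfolding block_start_def by blast

lemma block_start_ends [simp]: "block_start g (Suc 0)" "block_start g (Suc n)"
  by (auto simp: block_start_def)

lemma tk_prev_eq_iff:
  assumes "1 < k" "k \<le> n"
  shows "tk g (k - 1) = tk g k \<longleftrightarrow> g \<le> L k"
proof -
  have "sf (sa (k - 1)) \<noteq> sf (sa k)"
    using sa_less_iff[of "k - 1" k] assms by (force dest: order.strict_implies_not_eq)
  then show ?thesis unfolding tk_def L_def by (rule take_eq_take_iff_lcp)
qed

lemma block_start_iff: "1 < k \<Longrightarrow> k \<le> n \<Longrightarrow> block_start g k \<longleftrightarrow> L k < g"
  using tk_prev_eq_iff[of k g] by (auto simp: block_start_def)

text \<open>Prefixes increase along the ranks, so equal prefixes at both ends force equality at
  every step between them.\<close>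

lemma same_block_iff:
  assumes "1 \<le> k" "k \<le> k'" "k' \<le> n"
  shows "tk g k = tk g k' \<longleftrightarrow> (\<forall>i. k < i \<and> i \<le> k' \<longrightarrow> \<not> block_start g i)"
proof
  assume eq: "tk g k = tk g k'"
  show "\<forall>i. k < i \<and> i \<le> k' \<longrightarrow> \<not> block_start g i"
  proof (intro allI impI)
    fix i assume i: "k < i \<and> i \<le> k'"
    have "tk g k \<le> tk g (i - 1)" "tk g (i - 1) \<le> tk g i" "tk g i \<le> tk g k'"
      using i assms by (auto intro!: tk_mono)
    then have "tk g (i - 1) = tk g i" using eq by auto
    then show "\<not> block_start g i" using i assms by (auto simp: block_start_def)
  qed
next
  assume nb: "\<forall>i. k < i \<and> i \<le> k' \<longrightarrow> \<not> block_start g i"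
  have "k + d \<le> k' \<Longrightarrow> tk g (k + d) = tk g k" for d
  proof (induction d)
    case (Suc d)
    then show ?case using nb[rule_format, of "k + Suc d"] by (simp add: block_start_def)
  qed simp
  from this[of "k' - k"] show "tk g k = tk g k'" using assms by simp
qed

lemma mono_word_take:
  assumes "mono_word g (take g w)" "g \<le> g'" 
  shows "mono_word g' (take g' w)"
proof -
  have "take g (sf p) = take g w" if "take g' (sf p) = take g' w" for p
    using arg_cong[OF that, of "take g"] assms(2) by (simp add: min_absorb1)
  then show ?thesis using assms(1) unfolding mono_word_def by blast
qed

lemma monochrome_mono: "g \<le> g' \<Longrightarrow> monochrome g k \<Longrightarrow> monochrome g' k"
  unfolding monochrome_def tk_def by (auto intro: mono_word_take)

lemma monochrome_cong: "tk g k = tk g k' \<Longrightarrow> monochrome g k = monochrome g k'"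
  by (simp add: monochrome_def)

lemma not_monochrome_0: "\<not> monochrome 0 k"
proof
  assume "monochrome 0 k"
  then have "\<forall>p \<in> {1..n}. \<forall>q \<in> {1..n}. side p = side q"
    unfolding monochrome_def mono_word_def tk_def take_0 by blast
  moreover have "1 \<in> {1..n}" "Suc n0 \<in> {1..n}" using n_bounds by auto
  ultimately have "side 1 = side (Suc n0)" by blast
  then show False using n0_pos by (simp add: side_def)
qed

lemma monochromeD:
  "monochrome g k \<Longrightarrow> p \<in> {1..n} \<Longrightarrow> q \<in> {1..n} \<Longrightarrow> take g (sf p) = tk g k \<Longrightarrow>
    take g (sf q) = tk g k \<Longrightarrow> side p = side q"
  unfolding monochrome_def mono_word_def by blast

text \<open>\<open>item h k\<close> and \<open>sa k\<close> both have the prefix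
  \<open>tk g k\<close>, so a monochrome block gives them the same bit. This bit is final from phase
  \<open>g\<close> on.\<close>

lemma monochrome_Z:
  assumes "monochrome g k" "g \<le> h" "k \<in> {1..n}"
  shows "Z h k = side (sa k)"
  unfolding Z_def
  by (rule monochromeD[OF assms(1) item_range[OF assms(3)] sa_range[OF assms(3)] take_item[OF assms(3,2)]])
    (rule tk_def[symmetric])

lemma monochrome_side:
  assumes "monochrome g k" "tk g k = tk g k'" "k \<in> {1..n}" "k' \<in> {1..n}"
  shows "side (sa k) = side (sa k')"
  by (rule monochromeD[OF assms(1) sa_range[OF assms(3)] sa_range[OF assms(4)] tk_def[symmetric]])
    (metis assms(2) tk_def)

text \<open>Two witnesses with different bits share their first symbol, so neither successor wraps;
  moving both one position to the right gives witnesses for the tail.\<close>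

lemma not_mono_word_tl:
  assumes "\<not> mono_word (Suc g) w"
  shows "\<not> mono_word g (tl w)"
proof -
  obtain p q where pq: "p \<in> {1..n}" "q \<in> {1..n}" "take (Suc g) (sf p) = w" "take (Suc g) (sf q) = w"
    "side p \<noteq> side q"
    using assms unfolding mono_word_def by blast
  have eq: "take (Suc g) (sf p) = take (Suc g) (sf q)" using pq by simp
  have l: "letter p = letter q" "p \<noteq> q"
    using eq pq(5) unfolding sf_Cons[OF pq(1)] sf_Cons[OF pq(2)] by auto
  have "nxt p = p + 1" "nxt q = q + 1" using equal_letters[of p q] equal_letters[of q p] pq(1,2) l by metis+
  then have "take g (sf (nxt p)) = tl w" "take g (sf (nxt q)) = tl w"
    using pq(3,4) unfolding sf_Cons[OF pq(1)] sf_Cons[OF pq(2)] by auto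
  moreover have "side (nxt p) = side p" "side (nxt q) = side q"
    using side_prv prv_nxt nxt_range pq(1,2) by metis+
  ultimately show ?thesis using pq nxt_range unfolding mono_word_def by blast
qed

section \<open>The effect of a phase on blocks\<close>

lemma tk_dest:
  assumes "k \<in> {1..n}" "g \<le> Suc h"
  shows "tk g (dest h k) = take g (sf (prv (item h k)))"
  using take_item[OF dest_range[OF assms(1), of h] assms(2)] item_dest[OF assms(1)] by simp

lemma same_block_dest:
  assumes k: "k \<in> {1..n}" "k' \<in> {1..n}"
  shows "tk (Suc h) (dest h k) = tk (Suc h) (dest h k') \<longleftrightarrow> ch h k = ch h k' \<and> tk h k = tk h k'"
proof (cases "k \<noteq> k' \<and> ch h k = ch h k'")
  case True
  have r: "item h k \<in> {1..n}" "item h k' \<in> {1..n}" "item h k \<noteq> item h k'"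
    using k item_range item_inj True by auto
  have "sf (prv (item h k)) = ch h k # sf (item h k)" "sf (prv (item h k')) = ch h k' # sf (item h k')"
    using take_sf_prv[of "item h k" "item h k'"] take_sf_prv[of "item h k'" "item h k"] r True
    by (auto simp: ch_def)
  then show ?thesis using k True by (simp add: tk_dest take_item del: atLeastAtMost_iff)
next
  case False
  then show ?thesis
    using k sf_Cons[OF prv_range[OF item_range[OF k(1), of h]]] sf_Cons[OF prv_range[OF item_range[OF k(2), of h]]]
    by (auto simp: tk_dest ch_def simp del: atLeastAtMost_iff)
qed

lemma same_block_no_start:
  assumes "1 \<le> k" "k < k'" "k' \<le> n" "tk g k = tk g k'"
  shows "\<not> block_start g k'"
  using assms same_block_iff[of k k' g] by (metis less_imp_le_nat order_refl)

text \<open>Stability sends an earlier occurrence of the symbol in the same block to an earlier rank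
  of the same new block; conversely, if the rank just before \<open>dest h k\<close> is in the new
  block, its origin is such an occurrence. This justifies the test on \<open>Bid\<close>.\<close>

lemma block_start_dest_iff:
  assumes k: "k \<in> {1..n}"
  shows "block_start (Suc h) (dest h k) \<longleftrightarrow>
    (\<forall>k' \<in> {1..<k}. \<not> (ch h k' = ch h k \<and> tk h k' = tk h k))"
proof
  let ?j = "dest h k"
  have j: "?j \<in> {1..n}" using dest_range[OF k] .
  assume bs: "block_start (Suc h) ?j"
  show "\<forall>k' \<in> {1..<k}. \<not> (ch h k' = ch h k \<and> tk h k' = tk h k)"
  proof (intro ballI notI)
    fix k' assume k': "k' \<in> {1..<k}" and e: "ch h k' = ch h k \<and> tk h k' = tk h k"
    have kr: "k' \<in> {1..n}" "k' < k" using k k' by auto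
    have less: "dest h k' < ?j" using dest_less_iff[OF kr(1) k] e kr(2) by blast
    have "tk (Suc h) (dest h k') = tk (Suc h) ?j" using same_block_dest[OF kr(1) k] e by blast
    moreover have "1 \<le> dest h k'" "?j \<le> n"
      using dest_range[OF kr(1), of h] j less by auto
    ultimately show False using same_block_no_start[of "dest h k'" ?j "Suc h"] less bs by blast
  qed
next
  let ?j = "dest h k"
  have j: "?j \<in> {1..n}" using dest_range[OF k] .
  assume first: "\<forall>k' \<in> {1..<k}. \<not> (ch h k' = ch h k \<and> tk h k' = tk h k)"
  show "block_start (Suc h) ?j"
  proof (rule ccontr)
    assume nb: "\<not> block_start (Suc h) ?j"
    then have j1: "?j \<noteq> 1" "tk (Suc h) (?j - 1) = tk (Suc h) ?j" unfolding block_start_def by blast+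
    have "?j - 1 \<in> {1..n}" using j j1(1) by auto
    from dest_surj[OF this] obtain k' where k': "k' \<in> {1..n}" "dest h k' = ?j - 1" by blast
    have e: "ch h k' = ch h k" "tk h k' = tk h k"
      using same_block_dest[OF k'(1) k, of h] j1(2) unfolding k'(2) by blast+
    have "dest h k' < ?j" unfolding k'(2) using j j1(1) by auto
    then have "k' < k" using dest_less_iff[OF k'(1) k] e by auto
    then have "k' \<in> {1..<k}" using k' by auto
    then show False using first e by blast
  qed
qed

text \<open>Another entry of the new block shares the first symbol, so removing it does not wrap and
  leads into the monochrome block of \<open>k\<close>.\<close>

lemma monochrome_dest:
  assumes k: "k \<in> {1..n}" and m: "monochrome g k" and g: "g \<le> h"
  shows "monochrome (Suc g) (dest h k)"
proof -
  let ?r = "prv (item h k)"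
  have r: "?r \<in> {1..n}" using prv_range item_range k by blast
  have nr: "nxt ?r = item h k" using nxt_prv item_range[OF k] by blast
  have *: "side p = side ?r" if p: "p \<in> {1..n}" "take (Suc g) (sf p) = take (Suc g) (sf ?r)" for p
  proof (cases "p = ?r")
    case False
    have l: "letter p = letter ?r" using p(2) unfolding sf_Cons[OF p(1)] sf_Cons[OF r] by simp
    have n: "nxt p = p + 1" "nxt ?r = ?r + 1"
      using equal_letters[OF p(1) r False l] equal_letters[OF r p(1) False[symmetric] l[symmetric]] by auto
    have "take g (sf (nxt p)) = take g (sf (nxt ?r))"
      using p(2) unfolding sf_Cons[OF p(1)] sf_Cons[OF r] n by simp
    then have "take g (sf (nxt p)) = take g (sf (item h k))"
      by (simp only: nr)
    then have "side (nxt p) = side (item h k)"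
      using monochromeD[OF m nxt_range[OF p(1)] item_range[OF k, of h]] take_item[OF k g] by simp
    then show ?thesis
      using side_prv[OF nxt_range[OF p(1)]] prv_nxt[OF p(1)] side_prv[OF item_range[OF k, of h]] by simp
  qed simp
  have "tk (Suc g) (dest h k) = take (Suc g) (sf ?r)" using tk_dest[OF k, of "Suc g" h] g by simp
  then show ?thesis using * unfolding monochrome_def mono_word_def by metis
qed

subsection \<open>The array \<open>B\<close>\<close>

text \<open>The boundary \<open>j\<close> is found in phase \<open>L j + 1\<close>, provided that the block from which the adjacent
  entries \<open>j - 1\<close> and \<open>j\<close> originate is still active. Thus \<open>Bt h\<close> is the array \<open>B\<close> after phase \<open>h\<close>.\<close>

definition found :: "nat \<Rightarrow> bool" where
  "found j \<longleftrightarrow> L j = 0 \<or> \<not> mono_word (L j - 1) (tl (tk (L j) j))"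

definition Bt :: "nat \<Rightarrow> nat \<Rightarrow> nat" where
  "Bt h j = (if j = 1 \<or> j = Suc n then 1 else if L j < h \<and> found j then Suc (L j) else 0)"

text \<open>An LCP value of at least 1 means that the rank before the target has the same first
  symbol. This competing entry excludes a wrap, so dropping the symbol leads back to the block of
  \<open>k\<close>.\<close>

lemma tl_tk_dest:
  assumes k: "k \<in> {1..n}" and j: "1 < dest h k" and g: "1 \<le> L (dest h k)" "g \<le> h"
  shows "tl (tk (Suc g) (dest h k)) = tk g k"
proof -
  let ?j = "dest h k" and ?r = "prv (item h k)"
  have jr: "?j \<in> {1..n}" using dest_range[OF k] .
  then have j1: "?j - 1 \<in> {1..n}" using j by auto
  from dest_surj[OF j1, of h] obtain k' where k': "k' \<in> {1..n}" "dest h k' = ?j - 1" by blast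
  have "tk 1 (?j - 1) = tk 1 ?j" using tk_prev_eq_iff[of ?j 1] j jr g by auto
  then have "take 1 (sf (prv (item h k'))) = take 1 (sf ?r)"
    using tk_dest[OF k(1), of 1 h] tk_dest[OF k'(1), of 1 h] k'(2) by simp
  then have l: "letter (prv (item h k')) = letter ?r"
    using sf_Cons[OF prv_range[OF item_range[OF k], of h]] sf_Cons[OF prv_range[OF item_range[OF k'(1)], of h]]
    by simp
  have "k \<noteq> k'" using k' j by auto
  then have "item h k \<noteq> item h k'" using item_inj k k' by blast
  then have "sf ?r = letter ?r # sf (item h k)"
    using take_sf_prv item_range k k'(1) l by metis
  then have "tk (Suc g) ?j = letter ?r # tk g k"
    using tk_dest[OF k, of "Suc g" h] take_item[OF k g(2)] g by simp
  then show ?thesis by simp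
qed

text \<open>Inside an \<open>(h - 1)\<close>-block the LCP values are at least \<open>h - 1\<close>,
  so a start of an \<open>h\<close>-block has the value \<open>h - 1\<close>. Its word of that
  length has both bits, hence so has the tail, and the boundary is found.\<close>

lemma Bt_interior:
  assumes "1 < k" "k \<le> n" "\<not> monochrome (h - 1) k" "\<not> block_start (h - 1) k"
  shows "Bt h k \<noteq> 0 \<longleftrightarrow> block_start h k"
proof -
  have ge: "h - 1 \<le> L k" using block_start_iff[of k "h - 1"] assms by auto
  have "found k" if "L k < h"
  proof (cases "L k")
    case (Suc g)
    then have e: "h - 1 = Suc g" using ge that by auto
    then have "\<not> mono_word g (tl (tk (Suc g) k))"
      using not_mono_word_tl[of g "tk (Suc g) k"] assms(3) by (simp add: monochrome_def)
    then show ?thesis using Suc by (simp add: found_def)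
  qed (simp add: found_def)
  then show ?thesis using assms block_start_iff[of k h] by (auto simp: Bt_def)
qed

lemma Bt_bounds: "1 < k \<Longrightarrow> k \<le> n \<Longrightarrow> Bt h k \<le> h"
  by (auto simp: Bt_def)

text \<open>If the \<open>(h - 1)\<close>-block of \<open>k\<close> has both bits, so has the
  possibly larger block that \<open>found\<close> asks about.\<close>

lemma found_dest:
  assumes k: "k \<in> {1..n}" and m: "\<not> monochrome (h - 1) k" and j: "dest h k \<noteq> 1" "L (dest h k) \<le> h"
  shows "found (dest h k)"
proof (cases "L (dest h k)")
  case (Suc g)
  have "1 < dest h k" using j dest_range[OF k, of h] by auto
  then have "tl (tk (Suc g) (dest h k)) = tk g k"
    using tl_tk_dest[OF k, of h g] Suc j by auto
  moreover have "g \<le> h - 1" using Suc j(2) by linarith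
  then have "\<not> monochrome g k" using monochrome_mono m by blast
  ultimately show ?thesis using Suc by (auto simp: found_def monochrome_def)
qed (simp add: found_def)

lemma Bt_dest_first:
  assumes k: "k \<in> {1..n}" and m: "\<not> monochrome (h - 1) k" and b: "block_start (Suc h) (dest h k)"
  shows "(if Bt h (dest h k) = 0 then Suc h else Bt h (dest h k)) = Bt (Suc h) (dest h k)"
proof (cases "dest h k = 1")
  case False
  have r: "1 < dest h k" "dest h k \<le> n" using False dest_range[OF k, of h] by auto
  then have "L (dest h k) \<le> h" using b block_start_iff[of "dest h k" "Suc h"] by auto
  then show ?thesis using found_dest[OF k m False] r by (auto simp: Bt_def)
qed (simp add: Bt_def)

lemma Bt_dest_later:
  assumes k: "k \<in> {1..n}" and b: "\<not> block_start (Suc h) (dest h k)"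
  shows "Bt (Suc h) (dest h k) = Bt h (dest h k)"
proof -
  have "dest h k \<noteq> 1" using b by (auto simp: block_start_def)
  then have "\<not> L (dest h k) < Suc h"
    using b block_start_iff[of "dest h k" "Suc h"] dest_range[OF k, of h] by auto
  then show ?thesis by (auto simp: Bt_def)
qed

text \<open>A change concerns a boundary with LCP value \<open>h\<close>, and \<open>found\<close>
  then speaks about the block of its origin \<open>k\<close>. So no update is lost by skipping
  irrelevant blocks.\<close>

lemma Bt_changed:
  assumes "j \<in> {1..Suc n}" "Bt (Suc h) j \<noteq> Bt h j"
  shows "\<exists>k \<in> {1..n}. dest h k = j \<and> \<not> monochrome (h - 1) k"
proof -
  have j: "j \<in> {1..n}" "j \<noteq> 1" "L j = h" "found j"
    using assms by (auto simp: Bt_def split: if_splits)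
  obtain k where k: "k \<in> {1..n}" "dest h k = j" using dest_surj[OF j(1)] by blast
  have "\<not> monochrome (h - 1) k"
  proof (cases h)
    case 0
    then show ?thesis by (simp add: not_monochrome_0)
  next
    case (Suc g)
    then have "tl (tk (Suc g) j) = tk g k" using tl_tk_dest[OF k(1), of h g] k j by auto
    then show ?thesis using j Suc by (auto simp: found_def monochrome_def)
  qed
  then show ?thesis using k by blast
qed

end

section \<open>Programs\<close>

lemma wr_store:
  "wr arr_Z_update i v s = ((), s\<lparr>arr_Z := (arr_Z s)(i := v)\<rparr>, 1)"
  "wr arr_Z'_update i v s = ((), s\<lparr>arr_Z' := (arr_Z' s)(i := v)\<rparr>, 1)"
  "wr arr_B_update i u s = ((), s\<lparr>arr_B := (arr_B s)(i := u)\<rparr>, 1)"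
  "wr arr_C_update c u s = ((), s\<lparr>arr_C := (arr_C s)(c := u)\<rparr>, 1)"
  "wr arr_F_update c u s = ((), s\<lparr>arr_F := (arr_F s)(c := u)\<rparr>, 1)"
  "wr arr_Bid_update c x s = ((), s\<lparr>arr_Bid := (arr_Bid s)(c := x)\<rparr>, 1)"
  "wr arr_K_update b u s = ((), s\<lparr>arr_K := (arr_K s)(b := u)\<rparr>, 1)"
  "wr arr_N_update b u s = ((), s\<lparr>arr_N := (arr_N s)(b := u)\<rparr>, 1)"
  for s :: "'a store"
  by (cases s; simp add: wr_def)+

lemmas prog_simps = prog_bind_def return_def tick_def rd_def wr_store rd_input_def

lemma foreach_invariant:
  assumes step: "\<And>xs x ys s. is = xs @ x # ys \<Longrightarrow> I xs s \<Longrightarrow> \<exists>s'. f x s = ((), s', c) \<and> I (xs @ [x]) s'"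
    and start: "I [] s"
  shows "\<exists>s'. foreach is f s = ((), s', length is * Suc c) \<and> I is s'"
proof -
  have *: "is = xs @ ys \<Longrightarrow> I xs s \<Longrightarrow> \<exists>s'. foreach ys f s = ((), s', length ys * Suc c) \<and> I is s'" for xs ys s
  proof (induction ys arbitrary: xs s)
    case Nil
    then show ?case by (simp add: prog_simps)
  next
    case (Cons y ys)
    obtain s1 where s1: "f y s = ((), s1, c)" "I (xs @ [y]) s1" using step[OF Cons.prems] by blast
    then show ?case using Cons.IH[of "xs @ [y]" s1] Cons.prems(1) by (auto simp: prog_simps)
  qed
  show ?thesis using *[of "[]" "is"] start by simp
qed

subsection \<open>Wavelet trees\<close>

lemma length_prefix_counts [simp]: "length (prefix_counts p m xs) = Suc (length xs)"
  by (induction xs arbitrary: m) auto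

lemma nth_prefix_counts:
  "i \<le> length xs \<Longrightarrow> prefix_counts p m xs ! i = m + length (filter (\<lambda>x. x < p) (take i xs))"
  by (induction xs arbitrary: m i) (auto simp: nth_Cons' take_Cons' split: nat.splits)

lemma take_length_filter:
  "take (length (filter P (take i xs))) (filter P xs) = filter P (take i xs)"
  by (metis append_take_drop_id append_eq_conv_conj filter_append)

lemma count_list_filter: "P c \<Longrightarrow> count_list (filter P xs) c = count_list xs c"
  by (induction xs) auto

lemma length_filter_less:
  fixes p :: "'a::linorder"
  assumes "i \<le> length xs"
  shows "i - length (filter (\<lambda>x. x < p) (take i xs)) = length (filter (\<lambda>x. p \<le> x) (take i xs))"
  using sum_length_filter_compl[of "\<lambda>x. x < p" "take i xs"] assms
  by (simp add: not_less)

lemma count_list_all: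
  "set xs \<subseteq> {c} \<Longrightarrow> count_list xs c = length xs"
  by (induction xs) auto

text \<open>On each of at most \<open>e\<close> levels the alphabets and the sequences are split
  without overlap, and a node costs at most \<open>2 * length syms + length xs\<close>; the last
  summand pays for the leaves. Tree and cost are the same for all stores \<open>s\<close>.\<close>

lemma build_wt_correct:
  assumes "sorted syms" "distinct syms" "syms \<noteq> []" "set xs \<subseteq> set syms" "length syms \<le> 2 ^ e"
  shows "\<exists>w t. (\<forall>s :: 's. build_wt syms xs s = (w, s, t)) \<and>
    t \<le> (2 * length syms + length xs) * e + 2 * length syms \<and>
    (\<forall>c i. c \<in> set syms \<longrightarrow> i \<le> length xs \<longrightarrow>
      (\<exists>u \<le> e + 1. \<forall>s :: 'q. wt_rank w c i s = (count_list (take i xs) c, s, u)))"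
  using assms
proof (induction syms arbitrary: xs e rule: length_induct)
  case (1 syms)
  show ?case
  proof (cases "length syms \<le> 1")
    case True
    then obtain a where a: "syms = [a]" using 1(4) by (cases syms) auto
    have "count_list (take i xs) a = i" if "i \<le> length xs" for i
      using count_list_all[of "take i xs" a] 1(5) that a set_take_subset[of i xs] by auto
    then show ?thesis using a
      by (intro exI[of _ Leaf] exI[of _ 1]) (auto simp: build_wt.simps prog_simps)
  next
    case False
    define m where "m = length syms div 2"
    define p where "p = syms ! m"
    let ?l = "take m syms" and ?r = "drop m syms"
    let ?xl = "filter (\<lambda>x. x < p) xs" and ?xr = "filter (\<lambda>x. p \<le> x) xs"
    obtain e' where e: "e = Suc e'" using 1(6) False by (cases e) auto
    have m: "0 < m" "m < length syms" "m \<le> 2 ^ e'" "length syms - m \<le> 2 ^ e'"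
      using False 1(6) e by (auto simp: m_def)
    have split: "set syms = set ?l \<union> set ?r" by (metis append_take_drop_id set_append)
    have l_less: "c < p" if c: "c \<in> set ?l" for c
    proof -
      obtain i where i: "i < m" "c = syms ! i" using c m unfolding in_set_conv_nth by auto
      then have "syms ! i \<le> p" using 1(2) m by (auto simp: p_def intro: sorted_nth_mono)
      moreover have "syms ! i \<noteq> p" using 1(3) i m by (auto simp: p_def nth_eq_iff_index_eq)
      ultimately show ?thesis using i by auto
    qed
    have r_ge: "p \<le> c" if c: "c \<in> set ?r" for c
    proof -
      obtain i where i: "i < length syms - m" "c = syms ! (m + i)" using c m unfolding in_set_conv_nth by auto
      then show ?thesis using 1(2) m by (auto simp: p_def intro: sorted_nth_mono)
    qed
    have "set ?xl \<subseteq> set ?l" "set ?xr \<subseteq> set ?r"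
      using 1(5) split l_less r_ge unfolding set_filter by (blast dest: leD)+
    note subs = this
    let ?Q = "\<lambda>syms xs w t. (\<forall>s :: 's. build_wt syms xs s = (w, s, t)) \<and>
      t \<le> (2 * length syms + length xs) * e' + 2 * length syms \<and>
      (\<forall>c i. c \<in> set syms \<longrightarrow> i \<le> length xs \<longrightarrow>
        (\<exists>u \<le> e' + 1. \<forall>s :: 'q. wt_rank w c i s = (count_list (take i xs) c, s, u)))"
    have pl: "length ?l < length syms" "sorted ?l" "distinct ?l" "?l \<noteq> []" "length ?l \<le> 2 ^ e'"
      using m 1(2-4) by (auto simp: sorted_wrt_take)
    have pr: "length ?r < length syms" "sorted ?r" "distinct ?r" "?r \<noteq> []" "length ?r \<le> 2 ^ e'"
      using m 1(2-4) by (auto simp: sorted_wrt_drop)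
    obtain wl tl where "?Q ?l ?xl wl tl"
      using 1(1)[rule_format, OF pl(1-4) subs(1) pl(5)] by blast
    then have l: "\<forall>s :: 's. build_wt ?l ?xl s = (wl, s, tl)"
        "tl \<le> (2 * length ?l + length ?xl) * e' + 2 * length ?l"
        "\<forall>c i. c \<in> set ?l \<longrightarrow> i \<le> length ?xl \<longrightarrow>
          (\<exists>u \<le> e' + 1. \<forall>s :: 'q. wt_rank wl c i s = (count_list (take i ?xl) c, s, u))"
      by blast+
    obtain wr tr where "?Q ?r ?xr wr tr"
      using 1(1)[rule_format, OF pr(1-4) subs(2) pr(5)] by blast
    then have r: "\<forall>s :: 's. build_wt ?r ?xr s = (wr, s, tr)"
        "tr \<le> (2 * length ?r + length ?xr) * e' + 2 * length ?r"
        "\<forall>c i. c \<in> set ?r \<longrightarrow> i \<le> length ?xr \<longrightarrow>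
          (\<exists>u \<le> e' + 1. \<forall>s :: 'q. wt_rank wr c i s = (count_list (take i ?xr) c, s, u))"
      by blast+
    let ?w = "Node p (prefix_counts p 0 xs) wl wr"
    have b: "build_wt syms xs s = (?w, s, 1 + length syms + length xs + tl + tr)" for s :: 's
      using False l(1) r(1) by (subst build_wt.simps) (simp add: prog_simps m_def[symmetric] p_def[symmetric])
    have len: "length ?xl + length ?xr = length xs"
      using sum_length_filter_compl[of "\<lambda>x. x < p" xs] by (simp add: not_less)
    have "tl + tr \<le> (2 * length ?l + length ?xl) * e' + 2 * length ?l
        + ((2 * length ?r + length ?xr) * e' + 2 * length ?r)"
      using l(2) r(2) by linarith
    also have "\<dots> = (2 * (length ?l + length ?r) + (length ?xl + length ?xr)) * e' + 2 * (length ?l + length ?r)"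
      by (simp add: algebra_simps)
    also have "\<dots> = (2 * length syms + length xs) * e' + 2 * length syms" using len m by simp
    finally have t: "1 + length syms + length xs + tl + tr \<le> (2 * length syms + length xs) * e + 2 * length syms"
      using m e by simp
    have rk: "\<exists>u \<le> e + 1. \<forall>s :: 'q. wt_rank ?w c i s = (count_list (take i xs) c, s, u)"
      if c: "c \<in> set syms" and i: "i \<le> length xs" for c i
    proof (cases "c < p")
      case True
      then have "c \<in> set ?l" using c split r_ge by (blast dest: leD)
      moreover have "length (filter (\<lambda>x. x < p) (take i xs)) \<le> length ?xl"
        by (metis take_length_filter length_take min.cobounded1 order_refl min.bounded_iff)
      ultimately obtain u where "u \<le> e' + 1"
        "\<forall>s :: 'q. wt_rank wl c (length (filter (\<lambda>x. x < p) (take i xs))) s =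
          (count_list (filter (\<lambda>x. x < p) (take i xs)) c, s, u)"
        using l(3) by (metis take_length_filter)
      then show ?thesis using True i e
        by (intro exI[of _ "Suc u"]) (simp add: prog_simps nth_prefix_counts count_list_filter)
    next
      case False
      then have "c \<in> set ?r" using c split l_less by blast
      moreover have "length (filter (\<lambda>x. p \<le> x) (take i xs)) \<le> length ?xr"
        by (metis take_length_filter length_take min.cobounded1 order_refl min.bounded_iff)
      ultimately obtain u where "u \<le> e' + 1"
        "\<forall>s :: 'q. wt_rank wr c (length (filter (\<lambda>x. p \<le> x) (take i xs))) s =
          (count_list (filter (\<lambda>x. p \<le> x) (take i xs)) c, s, u)"
        using r(3) by (metis take_length_filter)
      then show ?thesis using False i e
        by (intro exI[of _ "Suc u"]) (simp add: prog_simps nth_prefix_counts count_list_filter length_filter_less)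
    qed
    show ?thesis using b t rk by blast
  qed
qed

section \<open>Correctness and cost of a phase\<close>

context string_pair
begin

text \<open>The value of \<open>C[c]\<close>, counted over entries instead of ranks and thus visibly
  the same in all phases.\<close>

definition base :: "'a \<Rightarrow> nat" where
  "base c = Suc (card {p \<in> {1..n}. letter (prv p) < c})"

lemma base_eq: "base c = Suc (card {k \<in> {1..n}. ch h k < c})"
proof -
  have "{p \<in> {1..n}. letter (prv p) < c} = item h ` {k \<in> {1..n}. ch h k < c}"
  proof (intro equalityI subsetI)
    fix p assume "p \<in> {p \<in> {1..n}. letter (prv p) < c}"
    then show "p \<in> item h ` {k \<in> {1..n}. ch h k < c}"
      using pos_range[of p h] item_pos[of p h] by (intro image_eqI[of _ _ "pos h p"]) (auto simp: ch_def)
  next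
    fix p assume "p \<in> item h ` {k \<in> {1..n}. ch h k < c}"
    then show "p \<in> {p \<in> {1..n}. letter (prv p) < c}"
      using item_range[of _ h] by (auto simp: ch_def)
  qed
  moreover have "inj_on (item h) {k \<in> {1..n}. ch h k < c}"
    using item_bij[of h] by (auto simp: bij_betw_def intro: inj_on_subset)
  ultimately show ?thesis by (simp add: base_def card_image)
qed

lemma dest_base: "k \<in> {1..n} \<Longrightarrow> dest h k = base (ch h k) + occ h (ch h k) k"
  using dest_eq[of k h] base_eq[of "ch h k" h] by simp

text \<open>This is activity in phase \<open>g + 1\<close>. For \<open>g = 0\<close> the truncated subtraction gives the correct answer,
  since the only \<open>0\<close>-block contains both bits.\<close>

definition active :: "nat \<Rightarrow> nat \<Rightarrow> bool" where
  "active g k \<longleftrightarrow> \<not> monochrome (g - 1) k"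

definition written :: "nat \<Rightarrow> nat \<Rightarrow> nat \<Rightarrow> bool" where
  "written g k j \<longleftrightarrow> (\<exists>k' \<in> {1..<k}. active g k' \<and> dest g k' = j)"

text \<open>The state in phase \<open>g + 1\<close> before position \<open>k\<close>, in the block starting at \<open>l\<close>. Bits of irrelevant
  positions are already correct in the array of the next phase because that array was
  filled with them when their block was closed.\<close>

definition inv :: "nat \<Rightarrow> nat \<Rightarrow> nat \<Rightarrow> 'a store \<Rightarrow> bool" where
  "inv g l k s \<longleftrightarrow>
    (\<forall>i \<in> {1..n}. arr_Z s i = Z g i) \<and>
    (\<forall>j \<in> {1..n}. written g k j \<or> \<not> active g j \<or> j < l \<and> monochrome g j \<longrightarrow> arr_Z' s j = Z (Suc g) j) \<and>
    (\<forall>j \<in> {1..Suc n}. arr_B s j = (if written g k j then Bt (Suc g) j else Bt g j)) \<and>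
    (\<forall>c \<in> \<Sigma>. arr_C s c = base c) \<and>
    (\<forall>b. arr_K s b = Suc (cnt g b k)) \<and>
    (\<forall>b. arr_N s b = card {k' \<in> {l..<k}. Z g k' = b}) \<and>
    (\<forall>c \<in> \<Sigma>. arr_Bid s c < int k) \<and>
    (\<forall>c \<in> \<Sigma>. arr_Bid s c = int l \<longleftrightarrow> (\<exists>k' \<in> {l..<k}. ch g k' = c)) \<and>
    (\<forall>c \<in> \<Sigma>. arr_Bid s c = int l \<longrightarrow> arr_F s c = base c + occ g c k)"

lemma written_Suc:
  assumes "1 \<le> k" "active g k"
  shows "written g (Suc k) j \<longleftrightarrow> j = dest g k \<or> written g k j"
  using assms unfolding written_def by (auto simp: less_Suc_eq)

lemma card_block_Suc:
  fixes l k :: nat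
  assumes "l \<le> k"
  shows "card {k' \<in> {l..<Suc k}. P k'} = card {k' \<in> {l..<k}. P k'} + (if P k then 1 else 0)"
proof -
  have "{k' \<in> {l..<Suc k}. P k'} = (if P k then insert k {k' \<in> {l..<k}. P k'} else {k' \<in> {l..<k}. P k'})"
    using assms by (auto simp: less_Suc_eq)
  then show ?thesis by simp
qed

lemma first_in_block:
  assumes "k \<in> {1..n}" "1 \<le> l" "l \<le> k" "block_start g l" "\<And>i. l < i \<Longrightarrow> i \<le> k \<Longrightarrow> \<not> block_start g i"
  shows "block_start (Suc g) (dest g k) \<longleftrightarrow> \<not> (\<exists>k' \<in> {l..<k}. ch g k' = ch g k)"
proof -
  have "tk g k' = tk g k \<longleftrightarrow> l \<le> k'" if "k' \<in> {1..<k}" for k'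
  proof
    assume "l \<le> k'"
    then show "tk g k' = tk g k" using same_block_iff[of k' k g] that assms by auto
  next
    assume e: "tk g k' = tk g k"
    show "l \<le> k'"
    proof (rule ccontr)
      assume "\<not> l \<le> k'"
      moreover have "tk g l = tk g k" using same_block_iff[of l k g] assms by auto
      ultimately show False using same_block_no_start[of k' l g] assms e that by auto
    qed
  qed
  then show ?thesis using assms unfolding block_start_dest_iff[OF assms(1)] by fastforce
qed

definition wt_ok :: "nat \<Rightarrow> (bool \<Rightarrow> 'a wavelet_tree) \<Rightarrow> bool" where
  "wt_ok e w \<longleftrightarrow> (\<forall>b c i. c \<in> \<Sigma> \<longrightarrow> i \<le> length (bw b) \<longrightarrow>
     (\<exists>u \<le> e + 1. \<forall>s :: 'a store. wt_rank (w b) c i s = (count_list (take i (bw b)) c, s, u)))"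

text \<open>The cost is at most 16 accesses and two rank queries of at most \<open>e + 1\<close>
  nodes each. The invariant constrains \<open>F\<close> only at symbols already seen in the current
  block, which makes the lazy refresh sound.\<close>

lemma entry_correct:
  assumes inv: "inv g l k s" and w: "wt_ok e w"
    and k: "k \<in> {1..n}" and act: "active g k" and l: "1 \<le> l" "l \<le> k"
    and bs: "block_start g l" "\<And>i. l < i \<Longrightarrow> i \<le> k \<Longrightarrow> \<not> block_start g i"
  shows "\<exists>s' t. entry bw w (Suc g) l k s = ((), s', t) \<and> inv g l (Suc k) s' \<and> t \<le> 18 + 2 * e"
proof -
  define b where "b = Z g k"
  define c where "c = ch g k"
  define j where "j = dest g k"
  have c: "c \<in> \<Sigma>" unfolding c_def using ch_in k by blast
  have j: "j \<in> {1..n}" unfolding j_def using dest_range k by blast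
  have Zs: "arr_Z s k = b" and K: "\<And>b. arr_K s b = Suc (cnt g b k)"
    and C: "arr_C s c = base c"
    and B: "arr_B s j = (if written g k j then Bt (Suc g) j else Bt g j)"
    using inv k c j by (auto simp: inv_def b_def)
  have char: "bw b !! (if b then Suc (cnt g True k) else Suc (cnt g False k)) = c"
    using bw_cnt[OF k, of g] by (auto simp: b_def c_def split: if_splits)
  \<comment> \<open>By injectivity of \<open>dest\<close>, no earlier position had the target
    \<open>j\<close>, so \<open>B[j]\<close> still holds its value from the previous phase.\<close>
  have not_written: "\<not> written g k j"
    unfolding written_def j_def using k dest_inj[of _ k g] by (auto simp del: atLeastAtMost_iff) auto
  have first: "arr_Bid s c \<noteq> int l \<longleftrightarrow> block_start (Suc g) j"
    using first_in_block[OF k l bs] inv c unfolding inv_def j_def c_def by blast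
  have jc: "j = base c + occ g c k" unfolding j_def c_def using dest_base[OF k] .
  have cl: "cnt g b' k \<le> length (bw b')" for b'
    using cnt_le[of "k - 1" g b'] k by (cases "k = 1") (auto simp: cnt_1 length_bw)
  obtain u0 where u0: "u0 \<le> e + 1"
    "\<And>s :: 'a store. wt_rank (w False) c (cnt g False k) s = (count_list (take (cnt g False k) (bw False)) c, s, u0)"
    using w c cl unfolding wt_ok_def by meson
  obtain u1 where u1: "u1 \<le> e + 1"
    "\<And>s :: 'a store. wt_rank (w True) c (cnt g True k) s = (count_list (take (cnt g True k) (bw True)) c, s, u1)"
    using w c cl unfolding wt_ok_def by meson
  define F where "F = (if arr_Bid s c = int l then arr_F s else (arr_F s)(c := j))"
  define s' where "s' = s\<lparr>arr_Z' := (arr_Z' s)(j := b), arr_B := (arr_B s)(j := Bt (Suc g) j),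
     arr_F := F(c := Suc j), arr_Bid := (arr_Bid s)(c := int l),
     arr_K := (arr_K s)(b := Suc (Suc (cnt g b k))), arr_N := (arr_N s)(b := Suc (arr_N s b))\<rparr>"
  have Fc: "arr_F s c = j" if "arr_Bid s c = int l"
    using inv c that jc by (auto simp: inv_def)
  have "\<exists>t. entry bw w (Suc g) l k s = ((), s', t) \<and> t \<le> 18 + 2 * e"
  proof (cases "arr_Bid s c = int l")
    case True
    \<comment> \<open>The description \<open>s'\<close> covers both branches; for a repeated symbol
      its updates of \<open>B\<close> and \<open>Bid\<close> must change nothing.\<close>
    then have "arr_B s j = Bt (Suc g) j"
      using B not_written first Bt_dest_later[OF k, of g] unfolding j_def by auto
    then have [simp]: "(arr_B s)(j := Bt (Suc g) j) = arr_B s" by auto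
    have [simp]: "(arr_Bid s)(c := int l) = arr_Bid s" using True by auto
    show ?thesis
      using char Zs K True Fc
      by (cases b) (auto simp: entry_def prog_simps s'_def F_def)
  next
    case False
    have rank: "base c + count_list (take (cnt g False k) (bw False)) c + count_list (take (cnt g True k) (bw True)) c = j"
      using rank_sum[of k g c] k jc by simp
    have "(if arr_B s j = 0 then Suc g else arr_B s j) = Bt (Suc g) j"
      using B not_written first False Bt_dest_first[OF k, of g] act unfolding j_def active_def by auto
    then show ?thesis
      using char Zs K False C rank u0 u1
      by (cases b) (auto simp: entry_def prog_simps s'_def F_def fun_upd_idem)
  qed
  moreover have "inv g l (Suc k) s'"
  proof -
    have k1: "1 \<le> k" using k by simp
    note wS = written_Suc[OF k1 act]
    have Zj: "Z (Suc g) j = b" unfolding j_def b_def using Z_dest[OF k] .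
    have "\<forall>i \<in> {1..n}. arr_Z s' i = Z g i"
      using inv by (simp add: inv_def s'_def)
    moreover have "\<forall>i \<in> {1..n}. written g (Suc k) i \<or> \<not> active g i \<or> i < l \<and> monochrome g i \<longrightarrow> arr_Z' s' i = Z (Suc g) i"
      using inv Zj by (simp add: inv_def s'_def wS j_def[symmetric])
    moreover have "\<forall>i \<in> {1..Suc n}. arr_B s' i = (if written g (Suc k) i then Bt (Suc g) i else Bt g i)"
      using inv by (simp add: inv_def s'_def wS j_def[symmetric])
    moreover have "\<forall>c \<in> \<Sigma>. arr_C s' c = base c"
      using inv by (simp add: inv_def s'_def)
    moreover have "\<forall>b. arr_K s' b = Suc (cnt g b (Suc k))"
      using inv by (simp add: inv_def s'_def cnt_Suc[OF k1] b_def[symmetric])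
    moreover have "\<forall>b. arr_N s' b = card {k' \<in> {l..<Suc k}. Z g k' = b}"
      using inv unfolding card_block_Suc[OF l(2)] by (simp add: inv_def s'_def b_def[symmetric])
    moreover have "\<forall>c \<in> \<Sigma>. arr_Bid s' c < int (Suc k)"
      using inv l(2) unfolding inv_def by (auto simp: s'_def less_Suc_eq intro: order.strict_trans)
    moreover have "\<forall>c \<in> \<Sigma>. arr_Bid s' c = int l \<longleftrightarrow> (\<exists>k' \<in> {l..<Suc k}. ch g k' = c)"
      using inv l(2) by (auto simp: inv_def s'_def c_def less_Suc_eq)
    moreover have "\<forall>c \<in> \<Sigma>. arr_Bid s' c = int l \<longrightarrow> arr_F s' c = base c + occ g c (Suc k)"
      using inv jc by (auto simp: inv_def s'_def occ_Suc[OF k1] c_def[symmetric] F_def)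
    ultimately show ?thesis unfolding inv_def by blast
  qed
  ultimately show ?thesis by blast
qed

text \<open>All block identifiers stored so far are smaller than \<open>k\<close>, so without any
  reset no symbol counts as seen in the block starting there.\<close>

lemma inv_new_block:
  assumes "inv g l k s" "l \<le> k"
    and "\<And>j. j \<in> {1..n} \<Longrightarrow> l \<le> j \<Longrightarrow> j < k \<Longrightarrow> monochrome g j \<Longrightarrow> z' j = Z (Suc g) j"
    and "\<And>j. j \<notin> {l..<k} \<Longrightarrow> z' j = arr_Z' s j"
    and "\<And>j. j \<in> {l..<k} \<Longrightarrow> \<not> monochrome g j \<Longrightarrow> z' j = arr_Z' s j"
  shows "inv g k k (s\<lparr>arr_Z' := z', arr_N := \<lambda>b. 0\<rparr>)"
proof -
  have "z' j = Z (Suc g) j"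
    if "j \<in> {1..n}" "written g k j \<or> \<not> active g j \<or> j < k \<and> monochrome g j" for j
  proof (cases "j \<in> {l..<k}")
    case True
    then show ?thesis using assms that by (cases "monochrome g j") (auto simp: inv_def)
  next
    case False
    then show ?thesis using assms that by (auto simp: inv_def)
  qed
  moreover have "arr_Bid s c \<noteq> int k" if "c \<in> \<Sigma>" for c
    using assms(1) that by (force simp: inv_def)
  ultimately show ?thesis using assms(1) by (auto simp: inv_def)
qed

section \<open>Segments and the blocks that they represent\<close>

fun seg_ok :: "nat \<Rightarrow> nat \<Rightarrow> segment \<Rightarrow> nat \<Rightarrow> bool" where
  "seg_ok g a (Active d) m \<longleftrightarrow> m = a + d \<and> 1 \<le> a \<and> a < m \<and> m \<le> Suc n \<and> block_start g a \<and> block_start g m \<and>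
     (\<forall>i. a < i \<and> i < m \<longrightarrow> \<not> block_start g i) \<and> \<not> monochrome g a"
| "seg_ok g a (Irrelevant r0 r1) m \<longleftrightarrow> m = a + r0 + r1 \<and> 1 \<le> a \<and> m \<le> Suc n \<and>
     (\<forall>i \<in> {a..<m}. monochrome g i) \<and>
     card {i \<in> {a..<m}. side (sa i) = False} = r0 \<and> card {i \<in> {a..<m}. side (sa i) = True} = r1"

fun covers :: "nat \<Rightarrow> nat \<Rightarrow> segment list \<Rightarrow> bool" where
  "covers g a [] \<longleftrightarrow> a = Suc n"
| "covers g a (x # xs) \<longleftrightarrow> (\<exists>m. seg_ok g a x m \<and> covers g m xs)"

fun covers_rev :: "nat \<Rightarrow> nat \<Rightarrow> segment list \<Rightarrow> bool" where
  "covers_rev g m [] \<longleftrightarrow> m = 1"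
| "covers_rev g m (x # xs) \<longleftrightarrow> (\<exists>a. seg_ok g a x m \<and> covers_rev g a xs)"

lemma covers_rev_append: "covers_rev g m xs \<Longrightarrow> covers g m ys \<Longrightarrow> covers g 1 (rev xs @ ys)"
proof (induction xs arbitrary: m ys)
  case (Cons x xs)
  then obtain a where "seg_ok g a x m" "covers_rev g a xs" by auto
  then show ?case using Cons.IH[of a "x # ys"] Cons.prems by auto
qed simp

text \<open>Zeros and ones of an irrelevant run are counted by the final bits, so the numbers stay
  valid in deeper phases and add up when runs are merged.\<close>

lemma covers_rev_add_irrelevant:
  assumes "covers_rev g a acc" "seg_ok g a (Irrelevant r0 r1) m"
  shows "covers_rev g m (add_irrelevant r0 r1 acc)"
proof -
  consider s0 s1 acc' where "acc = Irrelevant s0 s1 # acc'"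
    | "add_irrelevant r0 r1 acc = Irrelevant r0 r1 # acc"
    by (cases "(r0, r1, acc)" rule: add_irrelevant.cases) auto
  then show ?thesis
  proof cases
    case 1
    then obtain a' where a': "seg_ok g a' (Irrelevant s0 s1) a" "covers_rev g a' acc'" using assms(1) by auto
    have le: "a' \<le> a" "a \<le> m" using a'(1) assms(2) by auto
    have card_sum: "card {i \<in> {a'..<m}. side (sa i) = b} =
        card {i \<in> {a'..<a}. side (sa i) = b} + card {i \<in> {a..<m}. side (sa i) = b}" for b
      by (subst card_Un_disjoint[symmetric]) (use le in \<open>auto intro!: arg_cong[where f = card]\<close>)
    have "\<forall>i \<in> {a'..<m}. monochrome g i" using a'(1) assms(2) by (auto simp: not_less)
    moreover have "card {i \<in> {a'..<m}. side (sa i) = False} = s0 + r0"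
      using card_sum[of False] a'(1) assms(2) unfolding seg_ok.simps by linarith
    moreover have "card {i \<in> {a'..<m}. side (sa i) = True} = s1 + r1"
      using card_sum[of True] a'(1) assms(2) unfolding seg_ok.simps by linarith
    moreover have "m = a' + (s0 + r0) + (s1 + r1)" "1 \<le> a'" "m \<le> Suc n"
      using a'(1) assms(2) unfolding seg_ok.simps by linarith+
    ultimately have "seg_ok g a' (Irrelevant (s0 + r0) (s1 + r1)) m"
      unfolding seg_ok.simps by blast
    then show ?thesis using 1 a'(2) by auto
  next
    case 2
    then show ?thesis using assms by auto
  qed
qed

text \<open>Merging irrelevant segments matters for the running time: it bounds the length of the
  list by twice the number of active segments plus one.\<close>

definition sparse :: "segment list \<Rightarrow> bool" where
  "sparse = successively (\<lambda>x y. is_active x \<or> is_active y)"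

lemma sparse_simps [simp]:
  "sparse []" "sparse [x]" "sparse (x # y # xs) \<longleftrightarrow> (is_active x \<or> is_active y) \<and> sparse (y # xs)"
  by (auto simp: sparse_def)

lemma sparse_Active [simp]: "sparse (Active d # xs) = sparse xs"
  by (cases xs) auto

lemma sparse_add_irrelevant: "sparse acc \<Longrightarrow> sparse (add_irrelevant r0 r1 acc)"
  by (cases "(r0, r1, acc)" rule: add_irrelevant.cases; cases "tl acc") auto

lemma sparse_rev: "sparse (rev xs) = sparse xs"
  unfolding sparse_def successively_rev by (simp add: disj_commute)

lemma sparse_tl: "sparse (x # xs) \<Longrightarrow> sparse xs"
  by (cases xs) auto

lemma length_sparse: "sparse xs \<Longrightarrow> length xs \<le> 2 * length (filter is_active xs) + 1"
  by (induction xs rule: induct_list012) (auto dest: sparse_tl)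

lemma foreach_copy:
  fixes s :: "'b store"
  shows "foreach [l..<k] (\<lambda>i. prog_bind (rd arr_Z i) (\<lambda>b. wr arr_Z'_update i b)) s =
    ((), s\<lparr>arr_Z' := \<lambda>j. if j \<in> {l..<k} then arr_Z s j else arr_Z' s j\<rparr>, 3 * (k - l))"
proof -
  let ?f = "\<lambda>i. prog_bind (rd arr_Z i) (\<lambda>b. wr arr_Z'_update i b)"
  have "\<exists>s'. foreach [l..<k] ?f s = ((), s', length [l..<k] * Suc 2) \<and>
    s' = s\<lparr>arr_Z' := \<lambda>j. if j \<in> set [l..<k] then arr_Z s j else arr_Z' s j\<rparr>"
    by (rule foreach_invariant[where I = "\<lambda>xs s'. s' = s\<lparr>arr_Z' := \<lambda>j. if j \<in> set xs then arr_Z s j else arr_Z' s j\<rparr>"])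
      (auto simp: prog_simps fun_eq_iff)
  then show ?thesis by (simp add: mult.commute)
qed

text \<open>The counters see only the ranks from \<open>l\<close> to \<open>k - 1\<close>. Since
  these hold all entries with this prefix, a vanishing count is equivalent to the block being
  monochrome.\<close>

lemma close_block_correct:
  assumes inv: "inv g l k s" and l: "1 \<le> l" "l < k" "k \<le> Suc n"
    and bs: "block_start g l" "block_start g k" "\<And>i. l < i \<Longrightarrow> i < k \<Longrightarrow> \<not> block_start g i"
    and acc: "covers_rev g l acc" "sparse acc"
  shows "\<exists>acc' s' t. close_block l k acc s = (acc', s', t) \<and> inv g k k s' \<and>
    covers_rev g k acc' \<and> sparse acc' \<and> t \<le> 4 + 3 * (k - l)"
proof -
  have N0: "(arr_N s)(False := 0, True := 0) = (\<lambda>b. 0)"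
    by (rule ext) (metis (full_types) fun_upd_apply)
  define r where "r b = card {i \<in> {l..<k}. Z g i = b}" for b
  have N: "arr_N s False = r False" "arr_N s True = r True" using inv by (auto simp: inv_def r_def)
  have tk: "tk g i = tk g l" if "i \<in> {l..<k}" for i
    using same_block_iff[of l i g] bs(3) l that by auto
  have r_sum: "r False + r True = k - l"
  proof -
    have "{i \<in> {l..<k}. Z g i = False} \<union> {i \<in> {l..<k}. Z g i = True} = {l..<k}" by auto
    then show ?thesis unfolding r_def by (subst card_Un_disjoint[symmetric]) auto
  qed
  have in_block: "pos g p \<in> {l..<k}" if p: "p \<in> {1..n}" "take g (sf p) = tk g l" for p
  proof -
    have e: "tk g (pos g p) = tk g l"
      using take_item[OF pos_range[OF p(1), of g], of g g] item_pos[OF p(1), of g] p(2) by simp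
    have "1 \<le> pos g p" "pos g p \<le> n" using pos_range[OF p(1), of g] by auto
    moreover have "\<not> pos g p < l"
      using same_block_no_start[of "pos g p" l g] e bs(1) l calculation by auto
    moreover have "\<not> k \<le> pos g p"
    proof
      assume kp: "k \<le> pos g p"
      have "tk g k \<le> tk g (pos g p)" "tk g l \<le> tk g k" using kp calculation l by (auto intro!: tk_mono)
      then have "tk g l = tk g k" using e by simp
      then show False using same_block_no_start[of l k g] bs(2) l kp calculation by auto
    qed
    ultimately show ?thesis by auto
  qed
  have mono: "monochrome g l" if "r b = 0" for b
  proof -
    have nb: "Z g i \<noteq> b" if "i \<in> {l..<k}" for i using \<open>r b = 0\<close> that by (auto simp: r_def)
    have "side p = (\<not> b)" if "p \<in> {1..n}" "take g (sf p) = tk g l" for p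
      using nb[OF in_block[OF that]] item_pos[OF that(1), of g] by (auto simp: Z_def)
    then show ?thesis unfolding monochrome_def mono_word_def by blast
  qed
  have ex: "\<exists>i \<in> {l..<k}. Z g i = b" if "r b \<noteq> 0" for b
  proof (rule ccontr)
    assume "\<not> ?thesis"
    then have "{i \<in> {l..<k}. Z g i = b} = {}" by blast
    then show False using that by (simp only: r_def card.empty)
  qed
  have not_mono: "\<not> monochrome g l" if pos: "r False \<noteq> 0" "r True \<noteq> 0"
  proof
    assume m: "monochrome g l"
    obtain i i' where i: "i \<in> {l..<k}" "Z g i = False" "i' \<in> {l..<k}" "Z g i' = True"
      using ex[OF pos(1)] ex[OF pos(2)] by blast
    then have ir: "i \<in> {1..n}" "i' \<in> {1..n}" using l by auto
    have "side (item g i) = side (item g i')"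
      using monochromeD[OF m item_range[OF ir(1)] item_range[OF ir(2)]]
        take_item[OF ir(1)] take_item[OF ir(2)] tk[OF i(1)] tk[OF i(3)] by simp
    then show False using i by (simp add: Z_def)
  qed
  show ?thesis
  proof (cases "r False = 0 \<or> r True = 0")
    case True
    let ?z = "\<lambda>j. if j \<in> {l..<k} then arr_Z s j else arr_Z' s j"
    have m: "monochrome g l" using mono True by blast
    have mi: "monochrome g i" if "i \<in> {l..<k}" for i using monochrome_cong[OF tk[OF that]] m by blast
    have Zi: "Z h i = side (sa i)" if "i \<in> {l..<k}" "g \<le> h" for i h
      using monochrome_Z[OF mi[OF that(1)] that(2)] that l by auto
    \<comment> \<open>Copying the old bits is correct because in a monochrome \<open>g\<close>-block
      phases \<open>g\<close> and \<open>Suc g\<close> both show the final bits.\<close>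
    have "inv g k k (s\<lparr>arr_Z' := ?z, arr_N := \<lambda>b. 0\<rparr>)"
    proof (rule inv_new_block[OF inv])
      fix j assume j: "j \<in> {1..n}" "l \<le> j" "j < k"
      then have "arr_Z s j = Z g j" using inv by (auto simp: inv_def)
      then show "?z j = Z (Suc g) j" using Zi[of j g] Zi[of j "Suc g"] j by auto
    qed (use l mi in auto)
    moreover have "seg_ok g l (Irrelevant (r False) (r True)) k"
    proof -
      have "{i \<in> {l..<k}. side (sa i) = b} = {i \<in> {l..<k}. Z g i = b}" for b using Zi[of _ g] by auto
      then have "r b = card {i \<in> {l..<k}. side (sa i) = b}" for b by (simp add: r_def)
      then show ?thesis using l mi r_sum by simp
    qed
    moreover have "close_block l k acc s =
        (add_irrelevant (r False) (r True) acc, s\<lparr>arr_Z' := ?z, arr_N := \<lambda>b. 0\<rparr>, 4 + 3 * (k - l))"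
      using True N N0 by (simp add: close_block_def prog_simps foreach_copy[simplified prog_simps, simplified])
    ultimately show ?thesis
      using covers_rev_add_irrelevant[OF acc(1)] sparse_add_irrelevant[OF acc(2)] by blast
  next
    case False
    have "inv g k k (s\<lparr>arr_Z' := arr_Z' s, arr_N := \<lambda>b. 0\<rparr>)"
    proof (rule inv_new_block[OF inv])
      fix j assume j: "j \<in> {1..n}" "l \<le> j" "j < k" "monochrome g j"
      then have "monochrome g l" using monochrome_cong[OF tk[of j]] by auto
      then show "arr_Z' s j = Z (Suc g) j" using not_mono False by auto
    qed (use l in auto)
    moreover have "seg_ok g l (Active (r False + r True)) k"
      using bs l r_sum not_mono False by auto
    moreover have "close_block l k acc s =
        (Active (r False + r True) # acc, s\<lparr>arr_Z' := arr_Z' s, arr_N := \<lambda>b. 0\<rparr>, 4)"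
      using False N N0 by (simp add: close_block_def prog_simps)
    moreover have "covers_rev g k (Active (r False + r True) # acc)"
      using calculation(2) acc(1) unfolding covers_rev.simps by blast
    ultimately show ?thesis using acc(2) by (metis sparse_Active le_add1)
  qed
qed

text \<open>\<open>B[k]\<close> may have been written earlier in the running phase; then it equals
  \<open>Suc g\<close>, which the second test discards, while older values are at most
  \<open>g\<close>.\<close>

lemma B_interior:
  assumes "inv g l k s" "1 < k" "k \<le> n" "active g k" "\<not> block_start (g - 1) k"
  shows "arr_B s k \<noteq> 0 \<and> arr_B s k \<noteq> Suc g \<longleftrightarrow> block_start g k"
proof -
  have "arr_B s k = Bt g k \<or> arr_B s k = Bt (Suc g) k" using assms(1-3) by (auto simp: inv_def)
  moreover have "Bt (Suc g) k = Bt g k \<or> Bt g k = 0 \<and> Bt (Suc g) k = Suc g"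
    using assms(2,3) by (auto simp: Bt_def)
  ultimately show ?thesis
    using Bt_interior[OF assms(2,3), of g] Bt_bounds[OF assms(2,3), of g] assms(4,5)
    by (auto simp: active_def)
qed

text \<open>Amortized cost: a position pays 2 for the loop, \<open>18 + 2 * e\<close> for its entry,
  4 for a possible closing and 3 for being copied later. The term \<open>3 * (k - l)\<close> is what
  the open block has saved for its copying, and the final 4 closes the last block.
  \<open>l < k \<or> 0 < d\<close> excludes closing an empty block.\<close>

lemma entries_correct:
  assumes w: "wt_ok e w" and seg: "seg_ok (g - 1) a (Active dd) m"
    and "inv g l k s" "a \<le> l" "l \<le> k" "m = k + d" "l < k \<or> 0 < d"
    "block_start g l" "\<And>i. l < i \<Longrightarrow> i < k \<Longrightarrow> \<not> block_start g i"
    "covers_rev g l acc" "sparse acc"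
  shows "\<exists>acc' s' t. entries bw w (Suc g) d l k acc s = (acc', s', t) \<and> inv g m m s' \<and>
    covers_rev g m acc' \<and> sparse acc' \<and> t \<le> d * (27 + 2 * e) + 3 * (k - l) + 4"
  using assms(3-)
proof (induction d arbitrary: l k acc s)
  case 0
  have "block_start (g - 1) m" "1 \<le> a" "m \<le> Suc n" using seg unfolding seg_ok.simps by blast+
  then have "block_start g m" using block_start_mono[of "g - 1" g m] by simp
  have "k = m" "l < k" "1 \<le> l" "k \<le> Suc n" using 0(2,4,5) \<open>1 \<le> a\<close> \<open>m \<le> Suc n\<close> by auto
  then have "\<exists>acc' s' t. close_block l k acc s = (acc', s', t) \<and> inv g k k s' \<and>
      covers_rev g k acc' \<and> sparse acc' \<and> t \<le> 4 + 3 * (k - l)"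
    using close_block_correct[OF 0(1) _ _ _ 0(6) _ 0(7-9)] \<open>block_start g m\<close> by blast
  then show ?case unfolding entries.simps \<open>k = m\<close> by (simp add: add.commute)
next
  case (Suc d)
  note prems = Suc.prems
  have a: "1 \<le> a" "m \<le> Suc n" "\<not> monochrome (g - 1) a"
    and nb: "\<And>i. a < i \<Longrightarrow> i < m \<Longrightarrow> \<not> block_start (g - 1) i"
    using seg unfolding seg_ok.simps by blast+
  have k: "k \<in> {1..n}" "1 \<le> l" "a \<le> k" "k < m" "k \<le> n" "1 \<le> k"
    using prems(2-4) a(1,2) by auto
  have act: "active g k"
  proof -
    have "\<forall>i. a < i \<and> i \<le> k \<longrightarrow> \<not> block_start (g - 1) i" using nb k(4) le_less_trans by blast
    then have "tk (g - 1) a = tk (g - 1) k" using same_block_iff[OF a(1) k(3,5)] by blast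
    then show ?thesis using a(3) monochrome_cong unfolding active_def by blast
  qed
  have split: "l < k \<and> arr_B s k \<noteq> 0 \<and> arr_B s k \<noteq> Suc g \<longleftrightarrow> l < k \<and> block_start g k"
  proof (cases "l < k")
    case True
    then have "\<not> block_start (g - 1) k" using nb k(4) prems(2) by simp
    then show ?thesis using B_interior[OF prems(1) _ k(5) act] True k(2) by simp
  qed simp
  have m: "m = Suc k + d" using prems(4) by simp
  show ?case
  proof (cases "l < k \<and> block_start g k")
    case True
    have "k \<le> Suc n" using k(5) by simp
    then obtain acc1 s1 t1 where 1: "close_block l k acc s = (acc1, s1, t1)" "inv g k k s1"
      "covers_rev g k acc1" "sparse acc1" "t1 \<le> 4 + 3 * (k - l)"
      using close_block_correct[OF prems(1) k(2) _ _ prems(6) _ prems(7-9)] True by metis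
    have nb0: "\<not> block_start g i" if "k < i" "i \<le> k" for i using that by simp
    obtain s2 t2 where 2: "entry bw w (Suc g) k k s1 = ((), s2, t2)" "inv g k (Suc k) s2" "t2 \<le> 18 + 2 * e"
      using entry_correct[OF 1(2) w k(1) act k(6) order_refl _ nb0] True by blast
    have nb1: "\<not> block_start g i" if "k < i" "i < Suc k" for i using that by simp
    have "\<exists>acc' s' t. entries bw w (Suc g) d k (Suc k) acc1 s2 = (acc', s', t) \<and> inv g m m s' \<and>
       covers_rev g m acc' \<and> sparse acc' \<and> t \<le> d * (27 + 2 * e) + 3 * (Suc k - k) + 4"
      by (rule Suc.IH[OF 2(2) k(3) _ m]) (use True nb1 1 in auto)
    then obtain acc3 s3 t3 where 3: "entries bw w (Suc g) d k (Suc k) acc1 s2 = (acc3, s3, t3)" "inv g m m s3"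
      "covers_rev g m acc3" "sparse acc3" "t3 \<le> d * (27 + 2 * e) + 3 * (Suc k - k) + 4"
      by blast
    have "entries bw w (Suc g) (Suc d) l k acc s = (acc3, s3, 2 + t1 + t2 + t3)"
      using True split 1(1) 2(1) 3(1) by (simp add: prog_simps)
    moreover have "2 + t1 + t2 + t3 \<le> Suc d * (27 + 2 * e) + 3 * (k - l) + 4"
      using 1(5) 2(3) 3(5) by simp
    ultimately show ?thesis using 3(2-4) by blast
  next
    case False
    have nb0: "\<not> block_start g i" if "l < i" "i \<le> k" for i
      using prems(7)[of i] False that by (cases "i = k") auto
    obtain s2 t2 where 2: "entry bw w (Suc g) l k s = ((), s2, t2)" "inv g l (Suc k) s2" "t2 \<le> 18 + 2 * e"
      using entry_correct[OF prems(1) w k(1) act k(2) prems(3,6) nb0] by blast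
    have "\<exists>acc' s' t. entries bw w (Suc g) d l (Suc k) acc s2 = (acc', s', t) \<and> inv g m m s' \<and>
       covers_rev g m acc' \<and> sparse acc' \<and> t \<le> d * (27 + 2 * e) + 3 * (Suc k - l) + 4"
      by (rule Suc.IH[OF 2(2) prems(2) _ m _ prems(6) _ prems(8,9)]) (use prems(3) nb0 in auto)
    then obtain acc3 s3 t3 where 3: "entries bw w (Suc g) d l (Suc k) acc s2 = (acc3, s3, t3)" "inv g m m s3"
      "covers_rev g m acc3" "sparse acc3" "t3 \<le> d * (27 + 2 * e) + 3 * (Suc k - l) + 4"
      by blast
    have "entries bw w (Suc g) (Suc d) l k acc s = (acc3, s3, 2 + t2 + t3)"
      using False split 2(1) 3(1) by (auto simp: prog_simps)
    moreover have "3 * (Suc k - l) = 3 * (k - l) + 3" using prems(3) by simp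
    then have "2 + t2 + t3 \<le> Suc d * (27 + 2 * e) + 3 * (k - l) + 4"
      using 2(3) 3(5) by simp
    ultimately show ?thesis using 3(2-4) by blast
  qed
qed

text \<open>Skipped positions are inactive: they write nothing, and their bits in
  \<open>arr_Z'\<close> are already correct. \<open>F\<close> imposes no obligation, since every
  block identifier is below \<open>m\<close>.\<close>

lemma inv_skip:
  assumes inv: "inv g k k s" and seg: "seg_ok (g - 1) k (Irrelevant r0 r1) m"
  shows "inv g m m (s\<lparr>arr_K := (arr_K s)(False := arr_K s False + r0, True := arr_K s True + r1)\<rparr>)"
proof -
  have m: "m = k + r0 + r1" "1 \<le> k" "m \<le> Suc n" and mono: "\<And>i. i \<in> {k..<m} \<Longrightarrow> monochrome (g - 1) i"
    and r: "card {i \<in> {k..<m}. side (sa i) = False} = r0" "card {i \<in> {k..<m}. side (sa i) = True} = r1"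
    using seg unfolding seg_ok.simps by blast+
  have le: "k \<le> m" using m by simp
  have w: "written g m j \<longleftrightarrow> written g k j" for j
    using mono le unfolding written_def active_def
    by (meson atLeastLessThan_iff less_le_trans not_le)
  have cnt: "cnt g b m = cnt g b k + (if b then r1 else r0)" for b
  proof -
    have "{k' \<in> {1..<m}. Z g k' = b} = {k' \<in> {1..<k}. Z g k' = b} \<union> {i \<in> {k..<m}. side (sa i) = b}"
    proof -
      have "Z g i = side (sa i)" if "i \<in> {k..<m}" for i
        using monochrome_Z[OF mono[OF that], of g] that m by auto
      then show ?thesis using le m(2) by auto
    qed
    moreover have "card ({k' \<in> {1..<k}. Z g k' = b} \<union> {i \<in> {k..<m}. side (sa i) = b}) =
        card {k' \<in> {1..<k}. Z g k' = b} + card {i \<in> {k..<m}. side (sa i) = b}"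
      by (rule card_Un_disjoint) auto
    ultimately show ?thesis using r unfolding cnt_def by (cases b) simp_all
  qed
  let ?s = "s\<lparr>arr_K := (arr_K s)(False := arr_K s False + r0, True := arr_K s True + r1)\<rparr>"
  have Bid: "arr_Bid s c < int k" if "c \<in> \<Sigma>" for c using inv that unfolding inv_def by blast
  have "\<forall>i \<in> {1..n}. arr_Z ?s i = Z g i"
    using inv by (simp add: inv_def)
  moreover have "\<forall>j \<in> {1..n}. written g m j \<or> \<not> active g j \<or> j < m \<and> monochrome g j \<longrightarrow> arr_Z' ?s j = Z (Suc g) j"
  proof (intro ballI impI)
    fix j assume j: "j \<in> {1..n}" "written g m j \<or> \<not> active g j \<or> j < m \<and> monochrome g j"
    have "\<not> active g j" if "k \<le> j" "j < m" using mono that unfolding active_def by simp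
    then have "written g k j \<or> \<not> active g j \<or> j < k \<and> monochrome g j"
      using j(2) w by (meson not_le)
    then show "arr_Z' ?s j = Z (Suc g) j" using inv j(1) by (simp add: inv_def)
  qed
  moreover have "\<forall>j \<in> {1..Suc n}. arr_B ?s j = (if written g m j then Bt (Suc g) j else Bt g j)"
    using inv by (simp add: inv_def w)
  moreover have "\<forall>c \<in> \<Sigma>. arr_C ?s c = base c"
    using inv by (simp add: inv_def)
  moreover have "\<forall>b. arr_K ?s b = Suc (cnt g b m)"
    using inv by (simp add: inv_def cnt)
  moreover have "\<forall>b. arr_N ?s b = card {k' \<in> {m..<m}. Z g k' = b}"
    using inv by (simp add: inv_def)
  moreover have "\<forall>c \<in> \<Sigma>. arr_Bid ?s c < int m"
    using Bid le by fastforce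
  ultimately show ?thesis unfolding inv_def by auto
qed

section \<open>Active positions and the cost of a phase\<close>

primrec weight :: "segment \<Rightarrow> nat" where
  "weight (Active d) = d"
| "weight (Irrelevant r0 r1) = 0"

definition weights :: "segment list \<Rightarrow> nat" where
  "weights ss = sum_list (map weight ss)"

definition A :: "nat \<Rightarrow> nat" where
  "A g = card {i \<in> {1..n}. \<not> monochrome g i}"

lemma covers_weights:
  "covers g a ss \<Longrightarrow> 1 \<le> a \<Longrightarrow> weights ss = card {i \<in> {a..<Suc n}. \<not> monochrome g i}"
proof (induction ss arbitrary: a)
  case Nil
  then show ?case by (simp add: weights_def)
next
  case (Cons x ss)
  then obtain m where m: "seg_ok g a x m" "covers g m ss" by auto
  have le: "a \<le> m" "m \<le> Suc n" using m(1) by (cases x; simp)+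
  have U: "{i \<in> {a..<Suc n}. \<not> monochrome g i} =
      {i \<in> {a..<m}. \<not> monochrome g i} \<union> {i \<in> {m..<Suc n}. \<not> monochrome g i}"
    using le by auto
  have "card {i \<in> {a..<Suc n}. \<not> monochrome g i} =
      card {i \<in> {a..<m}. \<not> monochrome g i} + card {i \<in> {m..<Suc n}. \<not> monochrome g i}"
    unfolding U by (rule card_Un_disjoint) auto
  moreover have "card {i \<in> {a..<m}. \<not> monochrome g i} = weight x"
  proof (cases x)
    case (Active d)
    then have x: "m = a + d" "a < m" "m \<le> Suc n" "\<not> monochrome g a"
      and nb: "\<And>i. a < i \<Longrightarrow> i < m \<Longrightarrow> \<not> block_start g i"
      using m(1) unfolding Active seg_ok.simps by blast+
    have "\<not> monochrome g i" if i: "i \<in> {a..<m}" for i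
    proof -
      have "1 \<le> a" "a \<le> i" "i \<le> n" "i < m" using i x(3) Cons.prems(2) by auto
      moreover from this have "\<forall>j. a < j \<and> j \<le> i \<longrightarrow> \<not> block_start g j" using nb by (meson le_less_trans)
      ultimately have "tk g a = tk g i" using same_block_iff[of a i g] by blast
      then show ?thesis using monochrome_cong x(4) by blast
    qed
    then have "{i \<in> {a..<m}. \<not> monochrome g i} = {a..<m}" by blast
    then show ?thesis using Active x(1) by (simp only: card_atLeastLessThan weight.simps add_diff_cancel_left')
  next
    case (Irrelevant r0 r1)
    then have "{i \<in> {a..<m}. \<not> monochrome g i} = {}" using m(1) unfolding Irrelevant seg_ok.simps by blast
    then show ?thesis using Irrelevant by (metis card.empty weight.simps(2))
  qed
  moreover have "weights ss = card {i \<in> {m..<Suc n}. \<not> monochrome g i}"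
    using Cons.IH[OF m(2)] Cons.prems(2) le by simp
  ultimately show ?case by (simp add: weights_def)
qed

lemma covers_A: "covers g 1 ss \<Longrightarrow> weights ss = A g"
  using covers_weights[of g 1 ss] unfolding A_def atLeastLessThanSuc_atLeastAtMost by simp

lemma covers_count: "covers g a ss \<Longrightarrow> length (filter is_active ss) \<le> weights ss"
proof (induction ss arbitrary: a)
  case (Cons x ss)
  then obtain m where m: "seg_ok g a x m" "covers g m ss" by auto
  then show ?case using Cons.IH[OF m(2)] by (cases x) (auto simp: weights_def)
qed (simp add: weights_def)

lemma A_antimono: "g \<le> g' \<Longrightarrow> A g' \<le> A g"
  unfolding A_def by (intro card_mono) (auto dest: monochrome_mono)

text \<open>The segments to come describe \<open>(g - 1)\<close>-blocks, the accumulated ones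
  \<open>g\<close>-blocks. Each segment pays 5: an irrelevant one for itself, an active one for its
  step and the closing of its last block. \<open>1 + length ss'\<close> is the final
  reversal.\<close>

lemma segments_correct:
  assumes w: "wt_ok e w"
  shows "inv g k k s \<Longrightarrow> covers (g - 1) k ss \<Longrightarrow> covers_rev g k acc \<Longrightarrow> sparse acc \<Longrightarrow>
    \<exists>ss' s' t. segments bw w (Suc g) k ss acc s = (ss', s', t) \<and> inv g (Suc n) (Suc n) s' \<and>
      covers g 1 ss' \<and> sparse ss' \<and> t \<le> 5 * length ss + weights ss * (27 + 2 * e) + 1 + length ss'"
proof (induction ss arbitrary: k acc s)
  case Nil
  then have "covers g 1 (rev acc)" using covers_rev_append[of g k acc "[]"] by simp
  then show ?case using Nil by (simp add: prog_simps sparse_rev)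
next
  case (Cons x ss)
  note prems = Cons.prems
  obtain m where m: "seg_ok (g - 1) k x m" "covers (g - 1) m ss" using prems(2) by auto
  show ?case
  proof (cases x)
    case (Irrelevant r0 r1)
    let ?s = "s\<lparr>arr_K := (arr_K s)(False := arr_K s False + r0, True := arr_K s True + r1)\<rparr>"
    have mk: "m = k + r0 + r1" using m(1) Irrelevant by simp
    have "seg_ok g k (Irrelevant r0 r1) m"
      using m(1) monochrome_mono[of "g - 1" g] unfolding Irrelevant seg_ok.simps by auto
    then have "covers_rev g m (add_irrelevant r0 r1 acc)" by (rule covers_rev_add_irrelevant[OF prems(3)])
    then obtain ss' s' t where *: "segments bw w (Suc g) m ss (add_irrelevant r0 r1 acc) ?s = (ss', s', t)"
      "inv g (Suc n) (Suc n) s'" "covers g 1 ss'" "sparse ss'"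
      "t \<le> 5 * length ss + weights ss * (27 + 2 * e) + 1 + length ss'"
      using Cons.IH[OF inv_skip[OF prems(1) m(1)[unfolded Irrelevant]] m(2)] sparse_add_irrelevant[OF prems(4)]
      by blast
    have "segments bw w (Suc g) k (x # ss) acc s = (ss', s', 5 + t)"
      using *(1) by (simp add: Irrelevant prog_simps mk)
    moreover have "5 + t \<le> 5 * length (x # ss) + weights (x # ss) * (27 + 2 * e) + 1 + length ss'"
      using *(5) by (simp add: Irrelevant weights_def)
    ultimately show ?thesis using *(2-4) by blast
  next
    case (Active d)
    have x: "m = k + d" "0 < d" "block_start (g - 1) k" using m(1) unfolding Active by auto
    have nb: "\<not> block_start g i" if "k < i" "i < k" for i using that by simp
    obtain acc1 s1 t1 where 1: "entries bw w (Suc g) d k k acc s = (acc1, s1, t1)" "inv g m m s1"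
      "covers_rev g m acc1" "sparse acc1" "t1 \<le> d * (27 + 2 * e) + 3 * (k - k) + 4"
      using entries_correct[OF w m(1)[unfolded Active] prems(1) order_refl order_refl x(1) _
          block_start_mono[OF _ x(3)] nb prems(3,4)] x(2) by auto
    obtain ss' s' t where *: "segments bw w (Suc g) m ss acc1 s1 = (ss', s', t)"
      "inv g (Suc n) (Suc n) s'" "covers g 1 ss'" "sparse ss'"
      "t \<le> 5 * length ss + weights ss * (27 + 2 * e) + 1 + length ss'"
      using Cons.IH[OF 1(2) m(2) 1(3,4)] by blast
    have "segments bw w (Suc g) k (x # ss) acc s = (ss', s', 1 + t1 + t)"
      using *(1) 1(1) x(1) by (simp add: Active prog_simps)
    moreover have "1 + t1 + t \<le> 5 * length (x # ss) + weights (x # ss) * (27 + 2 * e) + 1 + length ss'"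
      using *(5) 1(5) by (simp add: Active weights_def add_mult_distrib)
    ultimately show ?thesis using *(2-4) by blast
  qed
qed

text \<open>The state between phases \<open>g\<close> and \<open>Suc g\<close>; its segments were
  formed while phase \<open>g\<close> traversed the \<open>(g - 1)\<close>-blocks. After a swap
  \<open>arr_Z'\<close> holds older bits, and only the inactive ones are claimed to be right in
  advance.\<close>

definition phase_inv :: "nat \<Rightarrow> segment list \<Rightarrow> 'a store \<Rightarrow> bool" where
  "phase_inv g ss s \<longleftrightarrow>
    (\<forall>i \<in> {1..n}. arr_Z s i = Z g i) \<and>
    (\<forall>j \<in> {1..n}. \<not> active g j \<longrightarrow> arr_Z' s j = Z (Suc g) j) \<and>
    (\<forall>j \<in> {1..Suc n}. arr_B s j = Bt g j) \<and>
    (\<forall>c \<in> \<Sigma>. arr_C s c = base c) \<and> (\<forall>b. arr_N s b = 0) \<and>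
    covers (g - 1) 1 ss \<and> sparse ss"

lemma foreach_reset:
  fixes s :: "'b store"
  shows "\<exists>s'. foreach syms (\<lambda>c. prog_bind (rd arr_C c)
      (\<lambda>x. prog_bind (wr arr_F_update c x) (\<lambda>_. wr arr_Bid_update c (-1)))) s = ((), s', 4 * length syms) \<and>
    (\<exists>F Bid. s' = s\<lparr>arr_F := F, arr_Bid := Bid\<rparr> \<and> (\<forall>c \<in> set syms. Bid c = -1))"
proof -
  let ?f = "\<lambda>c. prog_bind (rd arr_C c) (\<lambda>x. prog_bind (wr arr_F_update c x) (\<lambda>_. wr arr_Bid_update c (-1)))"
  have "\<exists>s'. foreach syms ?f s = ((), s', length syms * Suc 3) \<and>
    (\<exists>F Bid. s' = s\<lparr>arr_F := F, arr_Bid := Bid\<rparr> \<and> (\<forall>c \<in> set syms. Bid c = -1))"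
  proof (rule foreach_invariant[where I = "\<lambda>xs s'. \<exists>F Bid. s' = s\<lparr>arr_F := F, arr_Bid := Bid\<rparr> \<and> (\<forall>c \<in> set xs. Bid c = -1)"])
    fix xs c ys and s1 :: "'b store"
    assume "\<exists>F Bid. s1 = s\<lparr>arr_F := F, arr_Bid := Bid\<rparr> \<and> (\<forall>c \<in> set xs. Bid c = -1)"
    then obtain F Bid where s1: "s1 = s\<lparr>arr_F := F, arr_Bid := Bid\<rparr>" "\<forall>c \<in> set xs. Bid c = -1" by blast
    let ?s = "s\<lparr>arr_F := F(c := arr_C s c), arr_Bid := Bid(c := -1)\<rparr>"
    have "?f c s1 = ((), ?s, 3)" by (simp add: prog_simps s1(1))
    moreover have "\<forall>c' \<in> set (xs @ [c]). (Bid(c := -1)) c' = -1" using s1(2) by simp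
    ultimately show "\<exists>s'. ?f c s1 = ((), s', 3) \<and>
        (\<exists>F Bid. s' = s\<lparr>arr_F := F, arr_Bid := Bid\<rparr> \<and> (\<forall>c \<in> set (xs @ [c]). Bid c = -1))"
      by blast
  next
    have "s = s\<lparr>arr_F := arr_F s, arr_Bid := arr_Bid s\<rparr>" by simp
    then show "\<exists>F Bid. s = s\<lparr>arr_F := F, arr_Bid := Bid\<rparr> \<and> (\<forall>c \<in> set []. Bid c = -1)"
      by (metis empty_iff list.set(1))
  qed
  then show ?thesis by (simp add: mult.commute)
qed

text \<open>The list \<open>ss\<close> is paid for six times, one of them for the loop test, and
  \<open>ss'\<close> once; each has at most \<open>2 * A (g - 1) + 1\<close> segments. Hence 41 is
  \<open>27 + 7 * 2\<close>, and 12 is 7 plus 5 for pointers, swap, test and reversal.\<close>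

lemma phase_correct:
  assumes w: "wt_ok e w" and pre: "phase_inv g ss s" and syms: "set syms = \<Sigma>"
  shows "\<exists>ss' s' t. phase syms bw w (Suc g) ss s = (ss', s', t) \<and> phase_inv (Suc g) ss' s' \<and>
    1 + length ss + t \<le> 4 * length syms + 12 + (41 + 2 * e) * A (g - 1)"
proof -
  obtain F Bid where reset: "foreach syms (\<lambda>c. prog_bind (rd arr_C c)
      (\<lambda>x. prog_bind (wr arr_F_update c x) (\<lambda>_. wr arr_Bid_update c (-1)))) s =
      ((), s\<lparr>arr_F := F, arr_Bid := Bid\<rparr>, 4 * length syms)" and Bid: "\<forall>c \<in> \<Sigma>. Bid c = -1"
    using foreach_reset[of syms s] syms by blast
  let ?s = "s\<lparr>arr_F := F, arr_Bid := Bid, arr_K := (arr_K s)(False := 1, True := 1)\<rparr>"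
  have "\<not> written g 1 j" for j by (simp add: written_def)
  then have "inv g 1 1 ?s"
    using pre Bid by (auto simp: inv_def phase_inv_def cnt_1)
  then obtain ss' s' t where *: "segments bw w (Suc g) 1 ss [] ?s = (ss', s', t)"
    "inv g (Suc n) (Suc n) s'" "covers g 1 ss'" "sparse ss'"
    "t \<le> 5 * length ss + weights ss * (27 + 2 * e) + 1 + length ss'"
    using segments_correct[OF w, of g 1 ?s ss "[]"] pre by (auto simp: phase_inv_def)
  let ?s' = "s'\<lparr>arr_Z := arr_Z' s', arr_Z' := arr_Z s'\<rparr>"
  have run: "phase syms bw w (Suc g) ss s = (ss', ?s', 4 * length syms + 3 + t)"
    using *(1) by (simp add: phase_def reset[simplified prog_simps, simplified] prog_simps swap_Z_def)
  have Z: "arr_Z' s' j = Z (Suc g) j" if j: "j \<in> {1..n}" for j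
  proof -
    obtain k where k: "k \<in> {1..n}" "dest g k = j" using dest_surj[OF j] by blast
    show ?thesis
    proof (cases "active g k")
      case True
      then have "written g (Suc n) j" using k unfolding written_def by auto
      then show ?thesis using *(2) j unfolding inv_def by blast
    next
      case False
      \<comment> \<open>In phase 1 everything is active, so \<open>g - 1\<close> is not truncated
        here. The target lies in a monochrome \<open>g\<close>-block, and the invariant at the end
        of the scan covers all of these.\<close>
      then have "g \<noteq> 0" using not_monochrome_0[of k] by (cases g) (auto simp: active_def)
      then have "monochrome g j" using monochrome_dest[OF k(1), of "g - 1" g] False k(2) by (simp add: active_def)
      moreover have "j < Suc n" using j by simp
      ultimately show ?thesis using *(2) j unfolding inv_def by blast
    qed
  qed
  have B: "arr_B s' j = Bt (Suc g) j" if j: "j \<in> {1..Suc n}" for j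
  proof (cases "written g (Suc n) j")
    case True
    then show ?thesis using *(2) j unfolding inv_def by simp
  next
    case False
    then have "Bt (Suc g) j = Bt g j"
      using Bt_changed[OF j, of g] unfolding written_def active_def atLeastLessThanSuc_atLeastAtMost by blast
    then show ?thesis using *(2) j False unfolding inv_def by simp
  qed
  have "phase_inv (Suc g) ss' ?s'"
  proof -
    have "\<forall>j \<in> {1..n}. \<not> active (Suc g) j \<longrightarrow> arr_Z s' j = Z (Suc (Suc g)) j"
    proof (intro ballI impI)
      fix j assume j: "j \<in> {1..n}" "\<not> active (Suc g) j"
      then have "monochrome g j" by (simp add: active_def)
      then have "Z g j = Z (Suc (Suc g)) j"
        using monochrome_Z[of g j g] monochrome_Z[of g j "Suc (Suc g)"] j(1) by simp
      then show "arr_Z s' j = Z (Suc (Suc g)) j" using *(2) j(1) unfolding inv_def by simp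
    qed
    moreover have "\<forall>c \<in> \<Sigma>. arr_C s' c = base c" using *(2) unfolding inv_def by blast
    moreover have "\<forall>b. arr_N s' b = 0" using *(2) by (simp add: inv_def)
    ultimately show ?thesis using *(3,4) Z B by (simp add: phase_inv_def)
  qed
  moreover have "1 + length ss + (4 * length syms + 3 + t) \<le> 4 * length syms + 12 + (41 + 2 * e) * A (g - 1)"
  proof -
    have W: "weights ss = A (g - 1)" "sparse ss" "covers (g - 1) 1 ss"
      using covers_A pre by (auto simp: phase_inv_def)
    have "length ss \<le> 2 * A (g - 1) + 1" using length_sparse[OF W(2)] covers_count[OF W(3)] W(1) by simp
    moreover have "length ss' \<le> 2 * A g + 1"
      using length_sparse[OF *(4)] covers_count[OF *(3)] covers_A[OF *(3)] by simp
    moreover have "A g \<le> A (g - 1)" by (rule A_antimono) simp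
    ultimately show ?thesis using *(5) W(1) by (simp add: algebra_simps)
  qed
  ultimately show ?thesis using run by blast
qed

section \<open>The loop over the phases\<close>

definition cost :: "nat \<Rightarrow> nat \<Rightarrow> nat \<Rightarrow> nat" where
  "cost \<sigma> e g = 4 * \<sigma> + 12 + (41 + 2 * e) * A (g - 1)"

lemma not_list_ex_active: "covers g a ss \<Longrightarrow> \<not> list_ex is_active ss \<longleftrightarrow> weights ss = 0"
proof (induction ss arbitrary: a)
  case (Cons x ss)
  then obtain m where "seg_ok g a x m" "covers g m ss" by auto
  then show ?case using Cons.IH by (cases x) (auto simp: weights_def)
qed (simp add: weights_def)

text \<open>An active segment before phase \<open>Suc g\<close> exhibits a rank that is not
  monochrome at depth \<open>g - 1\<close>, so \<open>g - 1 < M\<close>. This gives termination and,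
  because of the lag, \<open>Suc M\<close> instead of \<open>M\<close> in the bound.\<close>

lemma loop_correct:
  assumes w: "wt_ok e w" and syms: "set syms = \<Sigma>"
    and M: "\<And>g k. M \<le> g \<Longrightarrow> k \<in> {1..n} \<Longrightarrow> monochrome g k"
    and pre: "phase_inv g ss s"
  shows "\<exists>g' ss' s' t'. while_option (\<lambda>(h, ss, s, t). list_ex is_active ss)
      (\<lambda>(h, ss, s, t). let (ss', s', t') = phase syms bw w h ss s in (h + 1, ss', s', t + 1 + length ss + t'))
      (Suc g, ss, s, t) = Some (Suc g', ss', s', t') \<and>
    g \<le> g' \<and> g' \<le> max g (Suc M) \<and> phase_inv g' ss' s' \<and> A (g' - 1) = 0 \<and> length ss' \<le> 1 \<and>
    t' \<le> t + (\<Sum>i = g..<g'. cost (length syms) e i)"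
  using pre
proof (induction "Suc M - g" arbitrary: g ss s t rule: less_induct)
  case less
  have c: "covers (g - 1) 1 ss" "sparse ss" "weights ss = A (g - 1)"
    using less.prems covers_A by (auto simp: phase_inv_def)
  show ?case
  proof (cases "A (g - 1) = 0")
    case True
    then have "\<not> list_ex is_active ss" using not_list_ex_active[OF c(1)] c(3) by simp
    moreover have "length ss \<le> 1" using length_sparse[OF c(2)] covers_count[OF c(1)] c(3) True by simp
    ultimately show ?thesis using True less.prems by (subst while_option_unfold) auto
  next
    case False
    then have act: "list_ex is_active ss" using not_list_ex_active[OF c(1)] c(3) by simp
    have "\<exists>k \<in> {1..n}. \<not> monochrome (g - 1) k"
    proof (rule ccontr)
      assume "\<not> ?thesis"
      then have "{k \<in> {1..n}. \<not> monochrome (g - 1) k} = {}" by blast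
      then show False using False unfolding A_def by (metis card.empty)
    qed
    then have "g - 1 < M" using M[of "g - 1"] by (metis not_le)
    then have g: "g \<le> M" by simp
    obtain ss1 s1 t1 where 1: "phase syms bw w (Suc g) ss s = (ss1, s1, t1)" "phase_inv (Suc g) ss1 s1"
      "1 + length ss + t1 \<le> cost (length syms) e g"
      using phase_correct[OF w less.prems syms] unfolding cost_def by blast
    have "Suc M - Suc g < Suc M - g" using g by simp
    from less.hyps[OF this 1(2), of "t + 1 + length ss + t1"] obtain g' ss' s' t' where
      2: "while_option (\<lambda>(h, ss, s, t). list_ex is_active ss)
      (\<lambda>(h, ss, s, t). let (ss', s', t') = phase syms bw w h ss s in (h + 1, ss', s', t + 1 + length ss + t'))
      (Suc (Suc g), ss1, s1, t + 1 + length ss + t1) = Some (Suc g', ss', s', t')"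
      "Suc g \<le> g'" "g' \<le> max (Suc g) (Suc M)" "phase_inv g' ss' s'" "A (g' - 1) = 0" "length ss' \<le> 1"
      "t' \<le> t + 1 + length ss + t1 + (\<Sum>i = Suc g..<g'. cost (length syms) e i)"
      by blast
    have "(\<Sum>i = g..<g'. cost (length syms) e i) = cost (length syms) e g + (\<Sum>i = Suc g..<g'. cost (length syms) e i)"
      using 2(2) by (simp add: sum.atLeast_Suc_lessThan)
    then have "t' \<le> t + (\<Sum>i = g..<g'. cost (length syms) e i)" using 2(7) 1(3) by simp
    moreover have "while_option (\<lambda>(h, ss, s, t). list_ex is_active ss)
      (\<lambda>(h, ss, s, t). let (ss', s', t') = phase syms bw w h ss s in (h + 1, ss', s', t + 1 + length ss + t'))
      (Suc g, ss, s, t) = Some (Suc g', ss', s', t')"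
      using act 1(1) 2(1) by (subst while_option_unfold) simp
    moreover have "g \<le> g'" "g' \<le> max g (Suc M)" using 2(2,3) g by auto
    ultimately show ?thesis using 2(4-6) by blast
  qed
qed

end

section \<open>Initialization and output\<close>

lemma foreach_wr_Z:
  "foreach xs (\<lambda>k. wr arr_Z_update k v) s =
    ((), s\<lparr>arr_Z := \<lambda>i. if i \<in> set xs then v else arr_Z s i\<rparr>, 2 * length xs)"
  for s :: "'a store"
proof -
  have "\<exists>s'. foreach xs (\<lambda>k. wr arr_Z_update k v) s = ((), s', length xs * Suc 1) \<and>
    s' = s\<lparr>arr_Z := \<lambda>i. if i \<in> set xs then v else arr_Z s i\<rparr>"
    by (rule foreach_invariant[where I = "\<lambda>xs s'. s' = s\<lparr>arr_Z := \<lambda>i. if i \<in> set xs then v else arr_Z s i\<rparr>"])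
      (auto simp: wr_store fun_upd_def fun_eq_iff)
  then show ?thesis by (simp add: mult.commute)
qed

lemma foreach_wr_B:
  "foreach xs (\<lambda>k. wr arr_B_update k v) s =
    ((), s\<lparr>arr_B := \<lambda>i. if i \<in> set xs then v else arr_B s i\<rparr>, 2 * length xs)"
  for s :: "'a store"
proof -
  have "\<exists>s'. foreach xs (\<lambda>k. wr arr_B_update k v) s = ((), s', length xs * Suc 1) \<and>
    s' = s\<lparr>arr_B := \<lambda>i. if i \<in> set xs then v else arr_B s i\<rparr>"
    by (rule foreach_invariant[where I = "\<lambda>xs s'. s' = s\<lparr>arr_B := \<lambda>i. if i \<in> set xs then v else arr_B s i\<rparr>"])
      (auto simp: wr_store fun_upd_def fun_eq_iff)
  then show ?thesis by (simp add: mult.commute)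
qed

lemma foreach_wr_C:
  "foreach xs (\<lambda>c. wr arr_C_update c v) s =
    ((), s\<lparr>arr_C := \<lambda>i. if i \<in> set xs then v else arr_C s i\<rparr>, 2 * length xs)"
  for s :: "'a store"
proof -
  have "\<exists>s'. foreach xs (\<lambda>c. wr arr_C_update c v) s = ((), s', length xs * Suc 1) \<and>
    s' = s\<lparr>arr_C := \<lambda>i. if i \<in> set xs then v else arr_C s i\<rparr>"
    by (rule foreach_invariant[where I = "\<lambda>xs s'. s' = s\<lparr>arr_C := \<lambda>i. if i \<in> set xs then v else arr_C s i\<rparr>"])
      (auto simp: wr_store fun_upd_def fun_eq_iff)
  then show ?thesis by (simp add: mult.commute)
qed

lemma foreach_count:
  "foreach xs (\<lambda>c. prog_bind (rd arr_C c) (\<lambda>x. wr arr_C_update c (x + 1))) s =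
    ((), s\<lparr>arr_C := \<lambda>c. arr_C s c + count_list xs c\<rparr>, 3 * length xs)"
  for s :: "'a store"
proof (induction xs arbitrary: s)
  case (Cons x xs)
  have "(\<lambda>c. ((arr_C s)(x := Suc (arr_C s x))) c + count_list xs c) = (\<lambda>c. arr_C s c + count_list (x # xs) c)"
    by auto
  then show ?case by (simp add: prog_simps Cons.IH[simplified prog_simps, simplified])
qed (simp add: prog_simps)

lemma cumulate_correct:
  fixes s :: "'a::linorder store"
  assumes "sorted cs" "distinct cs"
  shows "cumulate cs x s = ((), s\<lparr>arr_C := \<lambda>c. if c \<in> set cs
    then x + (\<Sum>c' \<in> {c' \<in> set cs. c' < c}. arr_C s c') else arr_C s c\<rparr>, 3 * length cs)"
  using assms
proof (induction cs arbitrary: x s)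
  case (Cons a cs)
  have less: "a < c" if "c \<in> set cs" for c using Cons.prems that by (auto simp: order_less_le)
  let ?C = "(arr_C s)(a := x)"
  have sum: "(\<Sum>c' \<in> {c' \<in> set cs. c' < c}. ?C c') = (\<Sum>c' \<in> {c' \<in> set cs. c' < c}. arr_C s c')" for c
    using Cons.prems by (intro sum.cong) auto
  have ins: "{c' \<in> set (a # cs). c' < c} = insert a {c' \<in> set cs. c' < c}" if "c \<in> set cs" for c
    using less[OF that] by auto
  have emp: "{c' \<in> set (a # cs). c' < a} = {}" using less by (auto dest: order.asym)
  have "(if c \<in> set cs then x + arr_C s a + (\<Sum>c' \<in> {c' \<in> set cs. c' < c}. ?C c') else ?C c) =
     (if c \<in> set (a # cs) then x + (\<Sum>c' \<in> {c' \<in> set (a # cs). c' < c}. arr_C s c') else arr_C s c)" for c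
  proof (cases "c \<in> set cs")
    case True
    have "(\<Sum>c' \<in> {c' \<in> set (a # cs). c' < c}. arr_C s c') = arr_C s a + (\<Sum>c' \<in> {c' \<in> set cs. c' < c}. arr_C s c')"
      unfolding ins[OF True] using Cons.prems(2) by (intro sum.insert) auto
    then show ?thesis using True sum[of c] by simp
  next
    case False
    show ?thesis
    proof (cases "c = a")
      case True
      have "(\<Sum>c' \<in> {c' \<in> set (a # cs). c' < c}. arr_C s c') = 0" unfolding True emp by simp
      then show ?thesis using True False by simp
    qed (use False in simp)
  qed
  then have "(\<lambda>c. if c \<in> set cs then x + arr_C s a + (\<Sum>c' \<in> {c' \<in> set cs. c' < c}. ?C c') else ?C c) =
     (\<lambda>c. if c \<in> set (a # cs) then x + (\<Sum>c' \<in> {c' \<in> set (a # cs). c' < c}. arr_C s c') else arr_C s c)"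
    by blast
  moreover have "cumulate (a # cs) x s = ((), s\<lparr>arr_C := \<lambda>c. if c \<in> set cs then x + arr_C s a + (\<Sum>c' \<in> {c' \<in> set cs. c' < c}. ?C c') else ?C c\<rparr>, 3 * length (a # cs))"
    using Cons by (simp add: prog_simps cong: if_cong)
  ultimately show ?case by (simp only:)
qed (simp add: prog_simps)

context string_pair
begin

lemma Z_0:
  assumes k: "k \<in> {1..n}"
  shows "Z 0 k \<longleftrightarrow> n0 < k"
proof -
  let ?p = "item 0 k"
  have p: "?p \<in> {1..n}" using item_range[OF k] .
  have kp: "k = Suc (card {q \<in> {1..n}. key 0 q < key 0 ?p})" using pos_item[OF k, of 0] by (simp add: pos_def)
  show ?thesis
  proof (cases "side ?p")
    case True
    have "{1..n0} \<subseteq> {q \<in> {1..n}. key 0 q < key 0 ?p}" using True by (auto simp: key_def side_def)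
    then have "n0 \<le> card {q \<in> {1..n}. key 0 q < key 0 ?p}"
      using card_mono[of "{q \<in> {1..n}. key 0 q < key 0 ?p}" "{1..n0}"] by simp
    then show ?thesis using kp True by (simp add: Z_def)
  next
    case False
    have "{q \<in> {1..n}. key 0 q < key 0 ?p} \<subseteq> {1..n0} - {?p}" using False by (auto simp: key_def side_def)
    then have "card {q \<in> {1..n}. key 0 q < key 0 ?p} \<le> card ({1..n0} - {?p})" by (intro card_mono) auto
    moreover have "?p \<in> {1..n0}" using False p by (simp add: side_def)
    then have "card ({1..n0} - {?p}) = n0 - 1" by simp
    ultimately have "k \<le> n0" using kp n0_pos by linarith
    then show ?thesis using False by (simp add: Z_def)
  qed
qed

lemma base_sum: "base c = 1 + (\<Sum>c' \<in> {c' \<in> \<Sigma>. c' < c}. count_list (bw False) c' + count_list (bw True) c')"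
proof -
  have "{k \<in> {1..n}. ch 0 k < c} = (\<Union>c' \<in> {c' \<in> \<Sigma>. c' < c}. {k \<in> {1..<Suc n}. ch 0 k = c'})"
    using ch_in[of _ 0] by auto
  then have "card {k \<in> {1..n}. ch 0 k < c} = (\<Sum>c' \<in> {c' \<in> \<Sigma>. c' < c}. card {k \<in> {1..<Suc n}. ch 0 k = c'})"
    using finite_alphabet by (simp only:) (rule card_UN_disjoint; auto)
  also have "\<dots> = (\<Sum>c' \<in> {c' \<in> \<Sigma>. c' < c}. count_list (bw False) c' + count_list (bw True) c')"
    by (intro sum.cong refl) (simp only: occ_total[of _ 0] occ_def)
  finally show ?thesis using base_eq[of c 0] by simp
qed

definition syms :: "'a list" where "syms = sorted_list_of_set \<Sigma>"

lemma set_syms: "set syms = \<Sigma>" and sorted_syms: "sorted syms" and distinct_syms: "distinct syms"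
  and length_syms: "length syms = card \<Sigma>"
  using finite_alphabet by (auto simp: syms_def)

lemma d0_d1_in: "d0 \<in> \<Sigma>" "d1 \<in> \<Sigma>" "d0 \<noteq> d1"
proof -
  have "d0 \<in> set T0" "d1 \<in> set T1" by (subst T0_eq, simp) (subst T1_eq, simp)
  then show "d0 \<in> \<Sigma>" "d1 \<in> \<Sigma>" "d0 \<noteq> d1" using terminated by (auto simp: terminated_pair_def)
qed

lemma set_bw: "set (bw b) \<subseteq> \<Sigma>"
proof
  fix c assume "c \<in> set (bw b)"
  then have "0 < count_list (bw b) c" by (metis count_list_0_iff gr0I)
  then have "0 < occ 0 c (Suc n)" unfolding occ_total[of c 0, symmetric] by (cases b) auto
  then have "{k \<in> {1..<Suc n}. ch 0 k = c} \<noteq> {}" unfolding occ_def by (metis card.empty less_irrefl)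
  then obtain k where "k \<in> {1..<Suc n}" "ch 0 k = c" by blast
  moreover from this have "k \<in> {1..n}" by auto
  ultimately show "c \<in> \<Sigma>" using ch_in by blast
qed

text \<open>Bits and \<open>B\<close> cost 2 per position each, counting symbols 3. Per symbol,
  \<open>C\<close> costs 5 and the additive terms of the two trees 4.\<close>

lemma initialize_correct:
  assumes e: "card \<Sigma> \<le> 2 ^ e"
  shows "\<exists>w s' t. initialize syms bw s = (w, s', t) \<and> wt_ok e w \<and> phase_inv 0 [Active n] s' \<and>
    t \<le> 7 * n + 6 + 9 * card \<Sigma> + (4 * card \<Sigma> + n) * e"
proof -
  have ne: "syms \<noteq> []" using d0_d1_in(1) set_syms by auto
  have len: "length (bw False) = n0" "length (bw True) = n1" by (auto simp: length_bw Tb_def)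
  have wt: "\<exists>w t. (\<forall>s :: 'a store. build_wt syms (bw b) s = (w, s, t)) \<and>
    t \<le> (2 * card \<Sigma> + length (bw b)) * e + 2 * card \<Sigma> \<and>
    (\<forall>c i. c \<in> \<Sigma> \<longrightarrow> i \<le> length (bw b) \<longrightarrow>
      (\<exists>u \<le> e + 1. \<forall>s :: 'a store. wt_rank w c i s = (count_list (take i (bw b)) c, s, u)))" for b
    using build_wt_correct[OF sorted_syms distinct_syms ne, of "bw b" e] set_bw e
    unfolding set_syms length_syms by blast
  obtain w0 t0 where w0: "\<And>s :: 'a store. build_wt syms (bw False) s = (w0, s, t0)"
    "t0 \<le> (2 * card \<Sigma> + n0) * e + 2 * card \<Sigma>"
    "\<forall>c i. c \<in> \<Sigma> \<longrightarrow> i \<le> length (bw False) \<longrightarrow>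
      (\<exists>u \<le> e + 1. \<forall>s :: 'a store. wt_rank w0 c i s = (count_list (take i (bw False)) c, s, u))"
    using wt[of False] unfolding len by blast
  obtain w1 t1 where w1: "\<And>s :: 'a store. build_wt syms (bw True) s = (w1, s, t1)"
    "t1 \<le> (2 * card \<Sigma> + n1) * e + 2 * card \<Sigma>"
    "\<forall>c i. c \<in> \<Sigma> \<longrightarrow> i \<le> length (bw True) \<longrightarrow>
      (\<exists>u \<le> e + 1. \<forall>s :: 'a store. wt_rank w1 c i s = (count_list (take i (bw True)) c, s, u))"
    using wt[of True] unfolding len by blast
  let ?w = "\<lambda>b. if b then w1 else w0"
  let ?Z = "\<lambda>i. if i \<in> set [Suc n0..<Suc n] then True else if i \<in> set [1..<Suc n0] then False else arr_Z s i"
  let ?B = "(\<lambda>i. if i \<in> set [1..<n + 2] then 0 else arr_B s i)(1 := 1, n + 1 := 1)"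
  let ?D = "\<lambda>c. (if c \<in> set syms then 0 else arr_C s c) + count_list (bw False) c + count_list (bw True) c"
  let ?C = "\<lambda>c. if c \<in> set syms then 1 + (\<Sum>c' \<in> {c' \<in> set syms. c' < c}. ?D c') else ?D c"
  let ?s = "s\<lparr>arr_Z := ?Z, arr_B := ?B, arr_C := ?C, arr_N := (arr_N s)(False := 0, True := 0)\<rparr>"
  have "initialize syms bw s = (?w, ?s, 7 * n + 6 + 5 * card \<Sigma> + t0 + t1)"
    by (simp add: initialize_def Let_def len prog_simps foreach_wr_Z foreach_wr_B foreach_wr_C
        foreach_count[simplified prog_simps, simplified] cumulate_correct[OF sorted_syms distinct_syms]
        w0(1) w1(1) length_syms del: upt_Suc upt_rec_numeral cong: if_cong)
  moreover have "wt_ok e ?w" using w0(3) w1(3) by (simp add: wt_ok_def)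
  moreover have "phase_inv 0 [Active n] ?s"
  proof -
    have "?C c = base c" if "c \<in> \<Sigma>" for c
    proof -
      have "(\<Sum>c' \<in> {c' \<in> set syms. c' < c}. ?D c') =
          (\<Sum>c' \<in> {c' \<in> \<Sigma>. c' < c}. count_list (bw False) c' + count_list (bw True) c')"
        unfolding set_syms by (intro sum.cong) auto
      then show ?thesis unfolding base_sum using that set_syms by (simp only: if_True)
    qed
    then have "\<forall>c \<in> \<Sigma>. arr_C ?s c = base c" by simp
    moreover have "\<forall>i \<in> {1..n}. arr_Z ?s i = Z 0 i" using Z_0 by (auto simp del: upt_Suc)
    moreover have "\<forall>j \<in> {1..n}. \<not> active 0 j \<longrightarrow> arr_Z' ?s j = Z (Suc 0) j"
      using not_monochrome_0 by (simp add: active_def)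
    moreover have "\<forall>j \<in> {1..Suc n}. arr_B ?s j = Bt 0 j" by (simp add: Bt_def)
    moreover have "\<forall>b. arr_N ?s b = 0" by (simp add: all_bool_eq)
    moreover have "seg_ok 0 1 (Active n) (Suc n)"
      using n0_pos not_monochrome_0[of 1] by (auto simp: block_start_def tk_def)
    ultimately show ?thesis by (simp add: phase_inv_def)
  qed
  moreover have "7 * n + 6 + 5 * card \<Sigma> + t0 + t1 \<le> 7 * n + 6 + 9 * card \<Sigma> + (4 * card \<Sigma> + n) * e"
    using w0(2) w1(2) by (simp add: algebra_simps)
  ultimately show ?thesis by blast
qed

subsection \<open>The final arrays\<close>

text \<open>Entries with equal prefixes have equal bits here, so the bit never breaks a tie and the
  key orders like the whole context.\<close>

lemma item_eq_sa:
  assumes mono: "\<And>k. k \<in> {1..n} \<Longrightarrow> monochrome g k" and k: "k \<in> {1..n}"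
  shows "item g k = sa k"
proof -
  have less: "key g p < key g q \<longleftrightarrow> sf p < sf q" if p: "p \<in> {1..n}" and q: "q \<in> {1..n}" for p q
  proof (cases "take g (sf p) = take g (sf q)")
    case True
    obtain i where i: "i \<in> {1..n}" "sa i = p" using sa_bij p by (metis bij_betw_imp_surj_on imageE)
    have "side p = side q"
      by (rule monochromeD[OF mono[OF i(1)] p q]) (simp_all only: tk_def i(2) True)
    then show ?thesis by (rule key_less_same_side)
  next
    case False
    then have "key g p < key g q \<longleftrightarrow> take g (sf p) < take g (sf q)"
      by (simp add: key_def) (metis order.not_eq_order_implies_strict)
    moreover have "sf p < sf q \<Longrightarrow> take g (sf p) < take g (sf q)"
      using take_mono[of "sf p" "sf q" g] False by (meson order.not_eq_order_implies_strict order.strict_implies_order)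
    ultimately show ?thesis using take_less_imp_less by blast
  qed
  have "k - 1 = card {q \<in> {1..n}. sf q < sf (sa k)}"
    using sort_key_rank[OF sf_inj refl k] unfolding sa_def sa_eq by simp
  also have "{q \<in> {1..n}. sf q < sf (sa k)} = {q \<in> {1..n}. key g q < key g (sa k)}"
    using less sa_range[OF k] by blast
  finally have "k - 1 = card {q \<in> {1..n}. key g q < key g (sa k)}" .
  moreover have "1 \<le> k" using k by simp
  ultimately have "k = pos g (sa k)" unfolding pos_def by linarith
  then show ?thesis using item_pos[OF sa_range[OF k], of g] by simp
qed

lemma suffix_array_map: "suffix_array (T0 @ T1) = map sa [1..<Suc n]"
  by (rule nth_equalityI) (auto simp: sa_def nth1_def suffix_array_def simp del: upt_Suc)

lemma multi_bwt_eq: "multi_bwt T0 T1 = map (\<lambda>k. letter (prv (sa k))) [1..<Suc n]"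
proof -
  have "(if p = 1 then T0 !! n0 else if p \<le> n0 then T0 !! (p - 1) else if p = n0 + 1 then T1 !! n1
      else T1 !! (p - n0 - 1)) = letter (prv p)" if "p \<in> {1..n}" for p
    using that n_bounds by (auto simp: letter_def prv_def nth1_def nth_append)
  then show ?thesis
    using sa_range unfolding multi_bwt_def suffix_array_map by (auto simp del: upt_Suc)
qed

lemma lcp_array_nth: "1 < i \<Longrightarrow> i \<le> n \<Longrightarrow> lcp_array (T0 @ T1) !! i = int (L i)"
  by (simp add: lcp_array_def nth1_def L_def sa_def sf_def del: upt_Suc upt_rec_numeral)

lemma lcp_array_eq:
  "lcp_array (T0 @ T1) = map (\<lambda>i. if i = 1 then -1 else int (L i)) [1..<Suc n] @ [-1]"
proof (rule nth_equalityI)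
  fix i assume "i < length (lcp_array (T0 @ T1))"
  then have i: "i < Suc n" by (simp add: lcp_array_def del: upt_Suc upt_rec_numeral)
  show "lcp_array (T0 @ T1) ! i = (map (\<lambda>i. if i = 1 then -1 else int (L i)) [1..<Suc n] @ [-1]) ! i"
  proof (cases "1 \<le> i \<and> i < n")
    case True
    then show ?thesis using lcp_array_nth[of "Suc i"] by (simp add: nth1_def nth_append del: upt_Suc)
  next
    case False
    then show ?thesis using i n0_pos
      by (auto simp: lcp_array_def nth_append simp del: upt_Suc upt_rec_numeral)
  qed
qed (simp add: lcp_array_def del: upt_Suc upt_rec_numeral)

text \<open>A zero in \<open>B\<close> means that the LCP value is at least \<open>g\<close> or that
  the boundary was not found. Either way the \<open>L i\<close>-block of \<open>i\<close> is
  monochrome, so the ranks \<open>i - 1\<close> and \<open>i\<close> belong to one string and are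
  consecutive in its suffix array.\<close>

lemma lcp_single:
  assumes mono: "\<And>k. k \<in> {1..n} \<Longrightarrow> monochrome g k" and i: "1 < i" "i \<le> n" and B: "Bt g i = 0"
  shows "lcp_array (Tb (Z g i)) !! (Suc (cnt g (Z g i) i)) = int (L i)"
proof -
  have ir: "i \<in> {1..n}" "i - 1 \<in> {1..n}" using i by auto
  have "monochrome (L i) i \<or> g \<le> L i"
  proof (cases "g \<le> L i")
    case False
    then have nf: "\<not> found i" using B i by (auto simp: Bt_def)
    then obtain v where v: "L i = Suc v" by (cases "L i") (auto simp: found_def)
    then have "mono_word v (tl (tk (Suc v) i))" using nf by (simp add: found_def)
    then have "mono_word (Suc v) (tk (Suc v) i)" using not_mono_word_tl by blast
    then show ?thesis using v by (simp add: monochrome_def)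
  qed simp
  moreover have "monochrome g i" using mono ir(1) .
  ultimately have "monochrome (L i) i" using monochrome_mono by blast
  then have "side (sa i) = side (sa (i - 1))"
    using monochrome_side[OF _ _ ir] tk_prev_eq_iff[OF i, of "L i"] by simp
  then have Zeq: "Z g (i - 1) = Z g i" using item_eq_sa[OF mono] ir by (simp only: Z_def)
  define b where "b = Z g i"
  define r where "r = Suc (cnt g b i)"
  have r: "r = Suc (Suc (cnt g b (i - 1)))"
    using cnt_Suc[of "i - 1" g b] i Zeq by (simp add: r_def b_def)
  let ?A = "suffix_array (Tb b)"
  note A1 = suffix_array_cnt[OF ir(1), of g, folded b_def, folded r_def]
  note A0 = suffix_array_cnt[OF ir(2), of g, unfolded Zeq, folded b_def]
  have r1: "Suc (cnt g b (i - 1)) = r - 1" using r by simp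
  have len: "r \<le> length (Tb b)" using A1(2) by simp
  have ne: "?A !! (r - 1) \<noteq> ?A !! r"
  proof
    assume "?A !! (r - 1) = ?A !! r"
    then have "item g (i - 1) = item g i" using A0(1) A1(1) unfolding r1 by simp
    then show False using item_inj[OF ir(2,1)] i by simp
  qed
  have "lcp_array (Tb b) !! r = int (lcp (suf (Tb b) (?A !! (r - 1))) (suf (Tb b) (?A !! r)))"
    using len r by (simp add: lcp_array_def nth1_def del: upt_Suc upt_rec_numeral)
  also have "\<dots> = int (lcp (sf (off b + ?A !! (r - 1))) (sf (off b + ?A !! r)))"
    using suf_lcp[OF A0(3)[unfolded r1] A1(3) ne] by simp
  also have "\<dots> = int (L i)"
    using A0(1) A1(1) item_eq_sa[OF mono] ir unfolding r1 L_def by simp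
  finally show ?thesis by (simp add: b_def r_def)
qed

lemma merge_output_correct:
  assumes mono: "\<And>k. k \<in> {1..n} \<Longrightarrow> monochrome g k"
  shows "(\<And>i. i \<in> {1..n} \<Longrightarrow> arr_Z s i = Z g i) \<Longrightarrow> (\<And>i. i \<in> {1..n} \<Longrightarrow> arr_B s i = Bt g i) \<Longrightarrow>
    (\<And>b. arr_K s b = Suc (cnt g b i)) \<Longrightarrow> 1 \<le> i \<Longrightarrow> i + d = Suc n \<Longrightarrow>
    \<exists>s'. merge_output bw (\<lambda>b. lcp_array (Tb b)) d i s =
      ((map (\<lambda>k. letter (prv (sa k))) [i..<Suc n],
        map (\<lambda>i. if i = 1 then -1 else int (L i)) [i..<Suc n] @ [-1]), s', 1 + 7 * d)"
proof (induction d arbitrary: i s)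
  case 0
  then show ?case by (simp add: prog_simps)
next
  case (Suc d)
  have i: "i \<in> {1..n}" using Suc.prems by simp
  let ?b = "Z g i"
  let ?s = "s\<lparr>arr_K := (arr_K s)(?b := Suc (Suc (cnt g ?b i)))\<rparr>"
  have "\<exists>s'. merge_output bw (\<lambda>b. lcp_array (Tb b)) d (Suc i) ?s =
      ((map (\<lambda>k. letter (prv (sa k))) [Suc i..<Suc n],
        map (\<lambda>i. if i = 1 then -1 else int (L i)) [Suc i..<Suc n] @ [-1]), s', 1 + 7 * d)"
    by (rule Suc.IH) (use Suc.prems cnt_Suc[of i g] in auto)
  then obtain s' where *: "merge_output bw (\<lambda>b. lcp_array (Tb b)) d (Suc i) ?s =
      ((map (\<lambda>k. letter (prv (sa k))) [Suc i..<Suc n],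
        map (\<lambda>i. if i = 1 then -1 else int (L i)) [Suc i..<Suc n] @ [-1]), s', 1 + 7 * d)"
    by blast
  have char: "bw ?b !! (Suc (cnt g ?b i)) = letter (prv (sa i))"
    using bw_cnt[OF i, of g] item_eq_sa[OF mono i] by (simp add: ch_def)
  have lc: "(if i = 1 then -1 else if Bt g i \<noteq> 0 then int (Bt g i) - 1
      else lcp_array (Tb ?b) !! (Suc (cnt g ?b i))) = (if i = 1 then -1 else int (L i))"
    using lcp_single[OF mono, of i] i by (auto simp: Bt_def)
  have upt: "[i..<Suc n] = i # [Suc i..<Suc n]" using i by (simp add: upt_conv_Cons del: upt_Suc)
  have run: "merge_output bw (\<lambda>b. lcp_array (Tb b)) (Suc d) i s =
      ((letter (prv (sa i)) # map (\<lambda>k. letter (prv (sa k))) [Suc i..<Suc n],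
        (if i = 1 then -1 else if Bt g i \<noteq> 0 then int (Bt g i) - 1
          else lcp_array (Tb ?b) !! (Suc (cnt g ?b i))) #
        map (\<lambda>i. if i = 1 then -1 else int (L i)) [Suc i..<Suc n] @ [-1]), s', 1 + 7 * Suc d)"
    using Suc.prems(1)[OF i] Suc.prems(2)[OF i] Suc.prems(3) * char
    by (simp add: prog_simps del: upt_Suc)
  show ?case unfolding run lc upt by simp
qed

lemma final_output_correct:
  assumes pre: "phase_inv g ss s" and A: "A (g - 1) = 0"
  shows "\<exists>s'. final_output bw (\<lambda>b. lcp_array (Tb b)) s =
    ((multi_bwt T0 T1, lcp_array (T0 @ T1)), s', 3 + 7 * n)"
proof -
  have mono: "monochrome g k" if "k \<in> {1..n}" for k
  proof -
    have "{i \<in> {1..n}. \<not> monochrome (g - 1) i} = {}" using A unfolding A_def by simp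
    then have "monochrome (g - 1) k" using that by blast
    then show ?thesis using monochrome_mono[of "g - 1" g] by simp
  qed
  let ?s = "s\<lparr>arr_K := (arr_K s)(False := 1, True := 1)\<rparr>"
  have len: "length (bw False) = n0" "length (bw True) = n1" by (auto simp: length_bw Tb_def)
  have "\<exists>s'. merge_output bw (\<lambda>b. lcp_array (Tb b)) n 1 ?s =
      ((map (\<lambda>k. letter (prv (sa k))) [1..<Suc n],
        map (\<lambda>i. if i = 1 then -1 else int (L i)) [1..<Suc n] @ [-1]), s', 1 + 7 * n)"
    by (rule merge_output_correct[OF mono]) (use pre in \<open>auto simp: phase_inv_def cnt_1\<close>)
  then show ?thesis unfolding multi_bwt_eq lcp_array_eq
    by (auto simp: final_output_def prog_simps len simp del: upt_Suc)
qed

end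

section \<open>The running time\<close>

lemma drop_less_iff:
  fixes xs ys :: "'a::linorder list"
  assumes "take t xs = take t ys" "t \<le> length xs" "t \<le> length ys"
  shows "drop t xs < drop t ys \<longleftrightarrow> xs < ys"
  using assms
proof (induction t arbitrary: xs ys)
  case (Suc t)
  then show ?case by (cases xs; cases ys) auto
qed simp

context string_pair
begin

definition sum_L :: nat where "sum_L = (\<Sum>i = 2..n. L i)"
definition max_L :: nat where "max_L = Max (L ` {2..n})"

lemma n_ge_2: "2 \<le> n"
  using n0_pos n1_pos by linarith

lemma L_le_max: "i \<in> {2..n} \<Longrightarrow> L i \<le> max_L"
  unfolding max_L_def by (intro Max_ge) auto

lemma max_L_attained: "\<exists>i \<in> {2..n}. L i = max_L"
proof -
  have "max_L \<in> L ` {2..n}" unfolding max_L_def using n_ge_2 by (intro Max_in) auto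
  then show ?thesis by auto
qed

lemma L_ge:
  assumes "1 \<le> i" "i < j" "j \<le> n" "tk g i = tk g j"
  shows "g \<le> L j"
proof -
  have "\<not> block_start g j" using same_block_no_start[OF assms] .
  then show ?thesis using block_start_iff[of j g] assms by auto
qed

lemma sa_surj: "p \<in> {1..n} \<Longrightarrow> \<exists>k \<in> {1..n}. sa k = p"
  using sa_bij by (metis bij_betw_imp_surj_on imageE)

text \<open>Different bits come from different ranks, so the block of \<open>k\<close> has another
  rank \<open>k'\<close>. The neighbour of \<open>k\<close> on the side of \<open>k'\<close> is in
  the block too, and the LCP entry between them is at least \<open>g\<close>.\<close>

lemma not_monochrome_neighbour:
  assumes k: "k \<in> {1..n}" and m: "\<not> monochrome g k"
  shows "k \<in> {2..n} \<and> g \<le> L k \<or> Suc k \<in> {2..n} \<and> g \<le> L (Suc k)"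
proof -
  obtain p q where pq: "p \<in> {1..n}" "q \<in> {1..n}" "take g (sf p) = tk g k" "take g (sf q) = tk g k" "side p \<noteq> side q"
    using m unfolding monochrome_def mono_word_def by blast
  obtain i j where ij: "i \<in> {1..n}" "sa i = p" "j \<in> {1..n}" "sa j = q"
    using sa_surj[OF pq(1)] sa_surj[OF pq(2)] by blast
  have "tk g i = take g (sf p)" "tk g j = take g (sf q)" by (simp_all only: tk_def ij)
  note t = trans[OF this(1) pq(3)] trans[OF this(2) pq(4)]
  have "i \<noteq> j" using ij pq(5) by blast
  define k' where "k' = (if i = k then j else i)"
  have k': "k' \<in> {1..n}" "tk g k' = tk g k" "k' \<noteq> k"
    unfolding k'_def using ij(1,3) t \<open>i \<noteq> j\<close> by (cases "i = k"; simp)+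
  show ?thesis
  proof (cases "k' < k")
    case True
    then have "g \<le> L k" using L_ge[of k' k g] k k'(1,2) by simp
    then show ?thesis using True k k'(1) by simp
  next
    case False
    then have *: "1 \<le> k" "k \<le> k'" "k' \<le> n" "k < Suc k" "Suc k \<le> k'" using k k'(1,3) by auto
    have "\<forall>i. k < i \<and> i \<le> k' \<longrightarrow> \<not> block_start g i"
      using k'(2)[symmetric] by (rule iffD1[OF same_block_iff[OF *(1-3)]])
    then have "\<not> block_start g (Suc k)" using *(4,5) by blast
    then show ?thesis using block_start_iff[of "Suc k" g] * by simp
  qed
qed

lemma monochrome_above: "Suc max_L \<le> g \<Longrightarrow> k \<in> {1..n} \<Longrightarrow> monochrome g k"
  using not_monochrome_neighbour[of k g] L_le_max[of k] L_le_max[of "Suc k"]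
  by (meson Suc_n_not_le_n order_trans)

lemma A_le_n: "A g \<le> n"
proof -
  have "A g \<le> card {1..n}" unfolding A_def by (intro card_mono) auto
  then show ?thesis by simp
qed

text \<open>The entry \<open>L i\<close> is charged only by the ranks \<open>i\<close> and
  \<open>i - 1\<close>.\<close>

lemma A_le: "A g \<le> 2 * card {i \<in> {2..n}. g \<le> L i}"
proof -
  let ?X = "{i \<in> {2..n}. g \<le> L i}"
  have "{k \<in> {1..n}. \<not> monochrome g k} \<subseteq> ?X \<union> (\<lambda>i. i - 1) ` ?X"
  proof
    fix k assume "k \<in> {k \<in> {1..n}. \<not> monochrome g k}"
    then have "k \<in> ?X \<or> Suc k \<in> ?X" using not_monochrome_neighbour by blast
    then show "k \<in> ?X \<union> (\<lambda>i. i - 1) ` ?X" by (force intro: image_eqI[of _ _ "Suc k"])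
  qed
  then have "A g \<le> card (?X \<union> (\<lambda>i. i - 1) ` ?X)" unfolding A_def by (intro card_mono) auto
  also have "\<dots> \<le> card ?X + card ((\<lambda>i. i - 1) ` ?X)" by (rule card_Un_le)
  also have "\<dots> \<le> card ?X + card ?X" by (intro add_left_mono card_image_le) auto
  finally show ?thesis by simp
qed

text \<open>After exchanging the sums, \<open>i\<close> is counted at most once for each
  \<open>g\<close> from 1 to \<open>L i\<close>.\<close>

lemma sum_A_from_1: "(\<Sum>g \<in> {1..<M}. A g) \<le> 2 * sum_L"
proof -
  have "(\<Sum>g \<in> {1..<M}. card {i \<in> {2..n}. g \<le> L i}) = (\<Sum>g \<in> {1..<M}. \<Sum>i \<in> {2..n}. if g \<le> L i then 1 else 0)"
    by (intro sum.cong refl) (simp add: sum.If_cases Int_def conj_commute)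
  also have "\<dots> = (\<Sum>i \<in> {2..n}. \<Sum>g \<in> {1..<M}. if g \<le> L i then 1 else 0)" by (rule sum.swap)
  also have "\<dots> \<le> (\<Sum>i \<in> {2..n}. L i)"
  proof (rule sum_mono)
    fix i
    have "(\<Sum>g \<in> {1..<M}. if g \<le> L i then 1 else 0) = card {g \<in> {1..<M}. g \<le> L i}"
      by (simp add: sum.If_cases Int_def)
    also have "\<dots> \<le> card {1..L i}" by (intro card_mono) auto
    finally show "(\<Sum>g \<in> {1..<M}. if g \<le> L i then 1 else 0) \<le> L i" by simp
  qed
  finally have "2 * (\<Sum>g \<in> {1..<M}. card {i \<in> {2..n}. g \<le> L i}) \<le> 2 * sum_L" by (simp add: sum_L_def)
  moreover have "(\<Sum>g \<in> {1..<M}. A g) \<le> (\<Sum>g \<in> {1..<M}. 2 * card {i \<in> {2..n}. g \<le> L i})"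
    by (intro sum_mono A_le)
  ultimately show ?thesis by (simp only: sum_distrib_left)
qed

text \<open>By truncation the first two phases both contribute \<open>A 0\<close>, which gives
  \<open>2 * n\<close>.\<close>

lemma sum_A: "(\<Sum>g < M. A (g - 1)) \<le> 2 * n + 2 * sum_L"
proof (cases M)
  case (Suc M')
  have "(\<Sum>g < M. A (g - 1)) = A 0 + (\<Sum>g < M'. A g)"
    unfolding Suc by (subst sum.lessThan_Suc_shift) simp
  also have "(\<Sum>g < M'. A g) \<le> A 0 + (\<Sum>g \<in> {1..<M'}. A g)"
    by (cases "M' = 0") (simp_all add: lessThan_atLeast0 sum.atLeast_Suc_lessThan)
  also have "A 0 + (A 0 + (\<Sum>g \<in> {1..<M'}. A g)) \<le> n + (n + 2 * sum_L)"
    by (intro add_mono A_le_n sum_A_from_1)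
  finally show ?thesis by simp
qed simp

text \<open>Ranks with LCP value 0 begin with pairwise different symbols; every other rank adds at
  least 1 to the sum. The extra 1 is the first rank, which is outside the sum.\<close>

lemma n_le_sum_L: "n \<le> sum_L + card \<Sigma> + 1"
proof -
  let ?X = "{i \<in> {2..n}. L i = 0}"
  have "inj_on (\<lambda>i. letter (sa i)) ?X"
  proof (rule linorder_inj_onI)
    fix i j assume ij: "i < j" "i \<in> ?X" "j \<in> ?X"
    have "letter (sa i) \<noteq> letter (sa j)"
    proof
      assume "letter (sa i) = letter (sa j)"
      then have "tk 1 i = tk 1 j" using sf_Cons[OF sa_range[of i]] sf_Cons[OF sa_range[of j]] ij by (simp add: tk_def)
      then show False using L_ge[of i j 1] ij by auto
    qed
    then show "letter (sa i) \<noteq> letter (sa j)" .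
  qed auto
  moreover have "(\<lambda>i. letter (sa i)) ` ?X \<subseteq> \<Sigma>" using letter_in sa_range by auto
  ultimately have "card ?X \<le> card \<Sigma>" using finite_alphabet by (rule card_inj_on_le)
  moreover have "card {2..n} \<le> card ?X + sum_L"
  proof -
    have "card {2..n} = (\<Sum>i \<in> {2..n}. 1)" by simp
    also have "\<dots> \<le> (\<Sum>i \<in> {2..n}. (if L i = 0 then 1 else 0) + L i)" by (intro sum_mono) auto
    also have "\<dots> = (\<Sum>i \<in> {2..n}. if L i = 0 then 1 else 0) + sum_L"
      by (simp only: sum.distrib sum_L_def)
    also have "(\<Sum>i \<in> {2..n}. if L i = 0 then 1 else 0) = card ?X"
      by (simp add: sum.If_cases Int_def)
    finally show ?thesis .
  qed
  ultimately show ?thesis by simp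
qed

text \<open>Remove the first \<open>t < max_L\<close> letters from two adjacent suffixes with LCP value \<open>max_L\<close>: the larger of
  the two remaining suffixes has an LCP entry of at least \<open>max_L - t\<close>.\<close>

lemma max_L_square: "max_L * (max_L + 1) \<le> 2 * sum_L"
proof -
  obtain j where j: "j \<in> {2..n}" "L j = max_L" using max_L_attained by blast
  let ?m = max_L
  define p where "p = sa (j - 1)"
  define q where "q = sa j"
  have jr: "j - 1 \<in> {1..n}" "j \<in> {1..n}" using j by auto
  have pq: "p \<in> {1..n}" "q \<in> {1..n}" using sa_range jr by (auto simp: p_def q_def)
  have less: "sf p < sf q" using sa_less_iff[OF jr] j unfolding p_def q_def by auto
  have eq: "take ?m (sf p) = take ?m (sf q)"
    using tk_prev_eq_iff[of j ?m] j by (auto simp: tk_def p_def q_def)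
  have len: "?m \<le> length (sf p)" "?m \<le> length (sf q)"
  proof -
    have "?m = lcp (sf p) (sf q)" using j(2) by (simp add: L_def p_def q_def)
    then show "?m \<le> length (sf p)" "?m \<le> length (sf q)"
      unfolding lcp_def using longest_common_prefix_prefix1 longest_common_prefix_prefix2 prefix_length_le by metis+
  qed
  have "\<exists>r \<in> {2..n}. sa r = q + t \<and> ?m - t \<le> L r" if t: "t < ?m" for t
  proof -
    have pt: "p + t \<in> {1..n}" "q + t \<in> {1..n}" using pq len t by (auto simp: length_sf)
    have drop: "sf (p + t) = drop t (sf p)" "sf (q + t) = drop t (sf q)"
    proof -
      have "p + t - 1 = t + (p - 1)" "q + t - 1 = t + (q - 1)" using pq by auto
      then show "sf (p + t) = drop t (sf p)" "sf (q + t) = drop t (sf q)"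
        by (simp_all only: sf_def suf_def drop_drop)
    qed
    have "take t (sf p) = take t (sf q)" using arg_cong[OF eq, of "take t"] t by (simp add: min_absorb1)
    then have lt: "sf (p + t) < sf (q + t)" using drop_less_iff[of t "sf p" "sf q"] less len t drop by simp
    have e: "take (?m - t) (sf (p + t)) = take (?m - t) (sf (q + t))"
      using arg_cong[OF eq, of "drop t"] unfolding drop by (simp add: drop_take)
    obtain i r where ir: "i \<in> {1..n}" "sa i = p + t" "r \<in> {1..n}" "sa r = q + t"
      using sa_surj[OF pt(1)] sa_surj[OF pt(2)] by blast
    have "i < r" using sa_less_iff[OF ir(1,3)] lt ir by simp
    moreover have "tk (?m - t) i = tk (?m - t) r" using e by (simp only: tk_def ir)
    ultimately have "?m - t \<le> L r" using L_ge[of i r "?m - t"] ir by auto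
    moreover have "r \<in> {2..n}" using \<open>i < r\<close> ir by auto
    ultimately show ?thesis using ir by blast
  qed
  then obtain r where r: "\<And>t. t < ?m \<Longrightarrow> r t \<in> {2..n} \<and> sa (r t) = q + t \<and> ?m - t \<le> L (r t)" by metis
  \<comment> \<open>\<open>sa (r t) = q + t\<close> makes the ranks distinct, so the lower bounds
    \<open>?m - t\<close> apply to different summands of \<open>sum_L\<close>.\<close>
  have "inj_on r {..<?m}" using r by (intro inj_onI) (metis add_left_cancel lessThan_iff)
  then have "(\<Sum>t < ?m. L (r t)) = (\<Sum>i \<in> r ` {..<?m}. L i)" by (simp add: sum.reindex)
  also have "\<dots> \<le> sum_L" unfolding sum_L_def by (intro sum_mono2) (use r in auto)
  finally have "(\<Sum>t < ?m. ?m - t) \<le> sum_L" using sum_mono[of "{..<?m}" "\<lambda>t. ?m - t" "\<lambda>t. L (r t)"] r by fastforce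
  moreover have "2 * (\<Sum>t < m. m - t) = m * (m + 1)" for m :: nat
  proof (induction m)
    case (Suc m)
    have "(\<Sum>t < Suc m. Suc m - t) = Suc m + (\<Sum>t < m. m - t)"
      by (subst sum.lessThan_Suc_shift) simp
    then show ?case using Suc by simp
  qed simp
  ultimately show ?thesis by (metis mult_le_mono2)
qed

section \<open>The total running time\<close>

lemma avelcp_eq: "real n * avelcp T0 T1 = real sum_L"
proof -
  have "(\<Sum>i = 2..n. real_of_int (lcp_array (T0 @ T1) !! i)) = (\<Sum>i = 2..n. real (L i))"
    by (intro sum.cong refl) (simp add: lcp_array_nth)
  then show ?thesis using n0_pos by (simp add: avelcp_def sum_L_def)
qed

text \<open>\<open>14 * n + 11\<close> collects initialization, output and the failing last loop
  test. There are at most \<open>max_L + 2\<close> phases: everything is monochrome at depth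
  \<open>Suc max_L\<close>, and the lag adds one.\<close>

lemma gap_correct:
  assumes e: "card \<Sigma> \<le> 2 ^ e"
  shows "\<exists>t. gap syms (bwt T0) (lcp_array T0) (bwt T1) (lcp_array T1) =
      Some ((multi_bwt T0 T1, lcp_array (T0 @ T1)), t) \<and>
    t \<le> 14 * n + 11 + 9 * card \<Sigma> + (4 * card \<Sigma> + n) * e +
      (max_L + 2) * (4 * card \<Sigma> + 12) + (41 + 2 * e) * (2 * n + 2 * sum_L)"
proof -
  have bw_eq: "(\<lambda>b. if b then bwt T1 else bwt T0) = bw"
    by (auto simp: bw_def Tb_def)
  have lc_eq: "(\<lambda>b. if b then lcp_array T1 else lcp_array T0) = (\<lambda>b. lcp_array (Tb b))"
    by (auto simp: Tb_def)
  have len: "length (bwt T0) = n0" "length (bwt T1) = n1"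
    using length_bw[of False] length_bw[of True] by (simp_all add: bw_def Tb_def)
  obtain w s ti where init: "initialize syms bw undefined = (w, s, ti)" "wt_ok e w" "phase_inv 0 [Active n] s"
    "ti \<le> 7 * n + 6 + 9 * card \<Sigma> + (4 * card \<Sigma> + n) * e"
    using initialize_correct[OF e] by blast
  obtain g ss' s' tp where loop: "while_option (\<lambda>(h, ss, s, t). list_ex is_active ss)
      (\<lambda>(h, ss, s, t). let (ss', s', t') = phase syms bw w h ss s in (h + 1, ss', s', t + 1 + length ss + t'))
      (Suc 0, [Active n], s, 0) = Some (Suc g, ss', s', tp)"
    "g \<le> max 0 (Suc (Suc max_L))" "phase_inv g ss' s'" "A (g - 1) = 0" "length ss' \<le> 1"
    "tp \<le> 0 + (\<Sum>i = 0..<g. cost (length syms) e i)"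
    using loop_correct[where M = "Suc max_L" and t = 0, OF init(2) set_syms _ init(3)] monochrome_above by blast
  obtain s'' where fin: "final_output bw (\<lambda>b. lcp_array (Tb b)) s' =
      ((multi_bwt T0 T1, lcp_array (T0 @ T1)), s'', 3 + 7 * n)"
    using final_output_correct[OF loop(3,4)] by blast
  have "phases syms bw w [Active n] s = Some (s', tp + 1 + length ss')"
    using loop(1) by (simp add: phases_def)
  then have "gap syms (bwt T0) (lcp_array T0) (bwt T1) (lcp_array T1) =
      Some ((multi_bwt T0 T1, lcp_array (T0 @ T1)), ti + (tp + 1 + length ss') + (3 + 7 * n))"
    unfolding gap_def Let_def bw_eq lc_eq len init(1) using fin by simp
  moreover have "tp \<le> (max_L + 2) * (4 * card \<Sigma> + 12) + (41 + 2 * e) * (2 * n + 2 * sum_L)"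
  proof -
    have "tp \<le> (\<Sum>i < g. 4 * card \<Sigma> + 12 + (41 + 2 * e) * A (i - 1))"
      using loop(6) by (simp add: cost_def length_syms lessThan_atLeast0)
    also have "\<dots> = g * (4 * card \<Sigma> + 12) + (41 + 2 * e) * (\<Sum>i < g. A (i - 1))"
      by (simp add: sum.distrib sum_distrib_left)
    also have "\<dots> \<le> (max_L + 2) * (4 * card \<Sigma> + 12) + (41 + 2 * e) * (2 * n + 2 * sum_L)"
      using loop(2) by (intro add_mono mult_le_mono order_refl sum_A) simp
    finally show ?thesis .
  qed
  then have "ti + (tp + 1 + length ss') + (3 + 7 * n) \<le> 14 * n + 11 + 9 * card \<Sigma> + (4 * card \<Sigma> + n) * e +
      (max_L + 2) * (4 * card \<Sigma> + 12) + (41 + 2 * e) * (2 * n + 2 * sum_L)"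
    using init(4) loop(5) by linarith
  ultimately show ?thesis by blast
qed

end

text \<open>The threshold yields \<open>\<sigma> \<le> n\<close> and \<open>n \<le> 2 * S\<close>.
  The alphabet cost of all phases is absorbed by \<open>n\<close> if
  \<open>m \<le> \<sigma>\<close>, and by the square of \<open>m\<close> otherwise. 354 is 68 for
  linear terms, 40 for overhead of phases and 246 for active positions; 22 is 10 for the trees and
  12 for rank queries.\<close>

lemma time_bound_arithmetic:
  fixes n \<sigma> S m e :: nat
  assumes "2 \<le> \<sigma>" "(\<sigma> + 2) * (\<sigma> + 2) \<le> n" "n \<le> S + \<sigma> + 1" "m * (m + 1) \<le> 2 * S"
  shows "14 * n + 11 + 9 * \<sigma> + (4 * \<sigma> + n) * e + (m + 2) * (4 * \<sigma> + 12) + (41 + 2 * e) * (2 * n + 2 * S)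
    \<le> 354 * S + 22 * (S * e)"
proof -
  have sq: "\<sigma> * \<sigma> + 4 * \<sigma> + 4 \<le> n" using assms(2) by (simp add: algebra_simps)
  then have n: "n \<le> 2 * S" "\<sigma> \<le> n" "1 \<le> n" using assms(3) by linarith+
  have "(m + 2) * \<sigma> \<le> 4 * S"
  proof (cases "m \<le> \<sigma>")
    case True
    then have "(m + 2) * \<sigma> \<le> (\<sigma> + 2) * \<sigma>" by (intro mult_le_mono1) simp
    also have "\<dots> \<le> n" using sq by (simp add: algebra_simps)
    finally show ?thesis using n by linarith
  next
    case False
    then have "(m + 2) * \<sigma> \<le> (m + 2) * m" by (intro mult_le_mono2) simp
    also have "\<dots> \<le> 2 * (m * (m + 1))" by (simp add: algebra_simps)
    finally show ?thesis using assms(4) by linarith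
  qed
  moreover have "(m + 2) * (4 * \<sigma> + 12) \<le> (m + 2) * (10 * \<sigma>)"
    using assms(1) by (intro mult_le_mono2) simp
  ultimately have m: "(m + 2) * (4 * \<sigma> + 12) \<le> 40 * S" by (simp add: algebra_simps)
  have "(4 * \<sigma> + n) * e \<le> (10 * S) * e" using n by (intro mult_le_mono1) linarith
  moreover have "(41 + 2 * e) * (2 * n + 2 * S) \<le> (41 + 2 * e) * (6 * S)" using n by (intro mult_le_mono2) linarith
  moreover have "(41 + 2 * e) * (6 * S) = 246 * S + 12 * (S * e)" "(10 * S) * e = 10 * (S * e)"
    by (simp_all add: algebra_simps)
  ultimately show ?thesis using m n by linarith
qed

theorem theorem1:
  shows "\<exists>K::real. \<forall>\<Sigma>::'a::linorder set. finite \<Sigma> \<longrightarrow>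
    (\<exists>N::nat. \<forall>d0 d1 T0 T1. terminated_pair \<Sigma> d0 d1 T0 T1 \<longrightarrow>
      (\<exists>t::nat.
        gap (sorted_list_of_set \<Sigma>) (bwt T0) (lcp_array T0) (bwt T1) (lcp_array T1)
          = Some ((multi_bwt T0 T1, lcp_array (T0 @ T1)), t) \<and>
        (length T0 + length T1 \<ge> N \<longrightarrow>
          real t \<le> K * (log 2 (real (card \<Sigma>)) * real (length T0 + length T1) * avelcp T0 T1))))"
proof (rule exI[of _ 398], intro allI impI)
  fix \<Sigma> :: "'a set" assume fin: "finite \<Sigma>"
  let ?\<sigma> = "card \<Sigma>"
  let ?lg = "log 2 (real ?\<sigma>)"
  define e where "e = nat \<lceil>?lg\<rceil>"
  show "\<exists>N::nat. \<forall>d0 d1 T0 T1. terminated_pair \<Sigma> d0 d1 T0 T1 \<longrightarrow>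
      (\<exists>t::nat.
        gap (sorted_list_of_set \<Sigma>) (bwt T0) (lcp_array T0) (bwt T1) (lcp_array T1)
          = Some ((multi_bwt T0 T1, lcp_array (T0 @ T1)), t) \<and>
        (length T0 + length T1 \<ge> N \<longrightarrow>
          real t \<le> 398 * (?lg * real (length T0 + length T1) * avelcp T0 T1)))"
  \<comment> \<open>The quadratic threshold lets \<open>n\<close> absorb an overhead of order
    \<open>?\<sigma>\<close> in each of up to \<open>?\<sigma> + 2\<close> phases.\<close>
  proof (rule exI[of _ "(?\<sigma> + 2) * (?\<sigma> + 2)"], intro allI impI)
    fix d0 d1 T0 T1 assume "terminated_pair \<Sigma> d0 d1 T0 T1"
    with fin interpret string_pair \<Sigma> d0 d1 T0 T1 by unfold_locales
    have "card {d0, d1} \<le> ?\<sigma>" using d0_d1_in fin by (intro card_mono) auto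
    then have \<sigma>: "2 \<le> ?\<sigma>" using d0_d1_in(3) by simp
    then have lg: "1 \<le> ?lg" by (simp add: le_log_iff)
    have e_ge: "?lg \<le> real e" and e_le: "real e \<le> 2 * ?lg"
      using lg unfolding e_def by linarith+
    have "real ?\<sigma> \<le> 2 powr real e" using e_ge \<sigma> by (simp add: log_le_iff)
    then have "real ?\<sigma> \<le> real (2 ^ e)" by (simp add: powr_realpow)
    then have "?\<sigma> \<le> 2 ^ e" by (simp only: of_nat_le_iff)
    from gap_correct[OF this] obtain t where
      t: "gap syms (bwt T0) (lcp_array T0) (bwt T1) (lcp_array T1) = Some ((multi_bwt T0 T1, lcp_array (T0 @ T1)), t)"
        "t \<le> 14 * n + 11 + 9 * ?\<sigma> + (4 * ?\<sigma> + n) * e + (max_L + 2) * (4 * ?\<sigma> + 12) + (41 + 2 * e) * (2 * n + 2 * sum_L)"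
      by blast
    have "real t \<le> 398 * (?lg * real n * avelcp T0 T1)" if N: "(?\<sigma> + 2) * (?\<sigma> + 2) \<le> n"
    proof -
      have "t \<le> 354 * sum_L + 22 * (sum_L * e)"
        using t(2) time_bound_arithmetic[OF \<sigma> N n_le_sum_L max_L_square, of e] by linarith
      then have "real t \<le> real (354 * sum_L + 22 * (sum_L * e))" by (simp only: of_nat_le_iff)
      also have "\<dots> = 354 * (real sum_L * 1) + 22 * (real sum_L * real e)" by simp
      \<comment> \<open>Rounding the logarithm up at most doubles it because
        \<open>?lg \<ge> 1\<close>; hence 398 = 354 + 2 * 22.\<close>
      also have "\<dots> \<le> 354 * (real sum_L * ?lg) + 22 * (real sum_L * (2 * ?lg))"
        using lg e_le by (intro add_mono mult_left_mono) auto
      also have "\<dots> = 398 * (?lg * (real n * avelcp T0 T1))" unfolding avelcp_eq by (simp add: algebra_simps)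
      finally show ?thesis by (simp only: mult.assoc)
    qed
    then show "\<exists>t::nat.
        gap (sorted_list_of_set \<Sigma>) (bwt T0) (lcp_array T0) (bwt T1) (lcp_array T1)
          = Some ((multi_bwt T0 T1, lcp_array (T0 @ T1)), t) \<and>
        (length T0 + length T1 \<ge> (?\<sigma> + 2) * (?\<sigma> + 2) \<longrightarrow>
          real t \<le> 398 * (?lg * real (length T0 + length T1) * avelcp T0 T1))"
      using t(1) unfolding syms_def by blast
  qed
qed

end
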